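(* Let $M^3$ be a hypersurface of $\mathbb{R}^4$ with zero scalar curvature ($R=0$ everywhere) and such that the mean curvature satisfies $H\neq0$ everywhere. Let $\Omega\subset M$ be a regular domain, and let $r_\Omega$ be the radius of the smallest extrinsic ball (ball of $\mathbb{R}^4$) which contains $\Omega$. If $$\sup_\Omega\left(\frac{-3K}{H}\right)\leq \frac{3}{2r_\Omega^2},$$ then $\Omega$ is stable.
   Context: A hypersurface $M^3$ of $\mathbb{R}^4$ is a smooth 3-manifold immersed in $\mathbb{R}^4$, oriented by a choice of unit normal, with the induced metric. Let $A:TM\to TM$ be the shape operator, with principal curvatures $k_1,k_2,k_3$. Normalizations: mean curvature $H=\frac13(k_1+k_2+k_3)$, scalar curvature $R=\frac13(k_1k_2+k_1k_3+k_2k_3)$, Gauss-Kronecker curvature $K=k_1k_2k_3$. $dM$ is the induced volume element. Note that $K/H$ does not depend on the choice of orientation. A regular domain is a domain $\Omega\subset M$ with compact closure and piecewise smooth boundary. Stability: hypersurfaces with $R=0$ are the critical points of $\mathcal{A}_1(\Omega)=\int_\Omega H\,dM$ under variations compactly supported in $\Omega$. If the orientation is chosen with $H>0$ everywhere, $\Omega$ is stable if $\frac{d^2\mathcal{A}_1}{dt^2}\big|_{t=0}>0$ for all (nontrivial) compactly supported variations in $\Omega$; if it is chosen with $H<0$ everywhere, $\Omega$ is stable if $\frac{d^2\mathcal{A}_1}{dt^2}\big|_{t=0}<0$ for all such variations (the two definitions agree). When $R=0$, the second variation in the direction of the normal variation with function $g$ is, up to a positive constant factor depending only on normalization, $$-\int_{\Omega}\left(g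 L_1 g-3Kg^2\right)dM=\int_\Omega\left(\langle P_1(\nabla g),\nabla g\rangle+3Kg^2\right)dM,$$ where $P_1=3H\,I-A$ and $L_1 g=\operatorname{div}(P_1(\nabla g))$. Thus, with the orientation such that $H>0$, $\Omega$ is stable if this quantity is positive for every smooth $g\not\equiv0$ with compact support in $\Omega$. *)

theory Defs
  imports "HOL-Analysis.Analysis"
begin

subsection \<open>Smooth maps between Euclidean spaces\<close>

text \<open>Intended for open \<open>S\<close>.\<close>

primrec Ck_on :: "nat \<Rightarrow> 'a::euclidean_space set \<Rightarrow> ('a \<Rightarrow> 'b::real_normed_vector) \<Rightarrow> bool" where
  "Ck_on 0 S f \<longleftrightarrow> continuous_on S f"
| "Ck_on (Suc k) S f \<longleftrightarrow>
     (\<forall>x\<in>S. f differentiable (at x)) \<and>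
     (\<forall>b\<in>Basis. Ck_on k S (\<lambda>x. frechet_derivative f (at x) b))"

definition smooth_on :: "'a::euclidean_space set \<Rightarrow> ('a \<Rightarrow> 'b::real_normed_vector) \<Rightarrow> bool" where
  "smooth_on S f \<longleftrightarrow> (\<forall>k. Ck_on k S f)"


subsection \<open>Smooth 3-manifolds\<close>

text \<open>
  A manifold is a Hausdorff, second countable type \<open>'m\<close> (the manifold is the whole type) with an
  atlas. An atlas consists of local parametrizations \<open>(U, \<phi>)\<close>, where \<open>\<phi>\<close> maps the open set \<open>U\<close> of
  3-space homeomorphically onto an open subset of \<open>'m\<close>; the values of \<open>\<phi>\<close> outside \<open>U\<close> play no role.
\<close>

type_synonym 'm param = "(real^3) set \<times> (real^3 \<Rightarrow> 'm)"

definition smooth_atlas :: "'m::{t2_space,second_countable_topology} param set \<Rightarrow> bool" where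
  "smooth_atlas \<A> \<longleftrightarrow>
     (\<forall>(U, \<phi>)\<in>\<A>. open U \<and> open (\<phi> ` U) \<and> homeomorphism U (\<phi> ` U) \<phi> (inv_into U \<phi>)) \<and>
     (\<Union>(U, \<phi>)\<in>\<A>. \<phi> ` U) = UNIV \<and>
     (\<forall>(U, \<phi>)\<in>\<A>. \<forall>(V, \<psi>)\<in>\<A>. smooth_on (U \<inter> \<phi> -` (\<psi> ` V)) (inv_into V \<psi> \<circ> \<phi>))"

definition smooth_map :: "'m param set \<Rightarrow> ('m \<Rightarrow> 'b::real_normed_vector) \<Rightarrow> bool" where
  "smooth_map \<A> f \<longleftrightarrow> (\<forall>(U, \<phi>)\<in>\<A>. smooth_on U (f \<circ> \<phi>))"

definition immersion :: "'m param set \<Rightarrow> ('m \<Rightarrow> real^4) \<Rightarrow> bool" where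
  "immersion \<A> X \<longleftrightarrow> smooth_map \<A> X \<and>
     (\<forall>(U, \<phi>)\<in>\<A>. \<forall>u\<in>U. inj (frechet_derivative (X \<circ> \<phi>) (at u)))"


subsection \<open>Immersed hypersurfaces of 4-space\<close>

text \<open>
  For an immersion \<open>X\<close>, the tangent space of the manifold at \<open>p\<close> is identified, as usual, with its
  image in \<open>\<real>\<^sup>4\<close> under the differential of \<open>X\<close>. The induced metric is then the
  restriction of the inner product of \<open>\<real>\<^sup>4\<close>.
\<close>

definition tangent_space :: "'m param set \<Rightarrow> ('m \<Rightarrow> real^4) \<Rightarrow> 'm \<Rightarrow> (real^4) set" where
  "tangent_space \<A> X p =
     {frechet_derivative (X \<circ> \<phi>) (at u) v | U \<phi> u v. (U, \<phi>) \<in> \<A> \<and> u \<in> U \<and> \<phi> u = p}"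

text \<open>
  The derivative of \<open>f\<close> at \<open>p\<close> in the direction of the tangent vector \<open>w\<close>, computed in any
  parametrization. For smooth \<open>f\<close> and \<open>w \<in> tangent_space \<A> X p\<close> the value is
  independent of the parametrization by the chain rule.
\<close>

definition differential ::
  "'m param set \<Rightarrow> ('m \<Rightarrow> real^4) \<Rightarrow> ('m \<Rightarrow> 'b::real_normed_vector) \<Rightarrow> 'm \<Rightarrow> real^4 \<Rightarrow> 'b" where
  "differential \<A> X f p w =
     (THE y. \<exists>U \<phi> u v. (U, \<phi>) \<in> \<A> \<and> u \<in> U \<and> \<phi> u = p \<and>
        frechet_derivative (X \<circ> \<phi>) (at u) v = w \<and>
        frechet_derivative (f \<circ> \<phi>) (at u) v = y)"

definition unit_normal :: "'m param set \<Rightarrow> ('m \<Rightarrow> real^4) \<Rightarrow> ('m \<Rightarrow> real^4) \<Rightarrow> bool" where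
  "unit_normal \<A> X N \<longleftrightarrow> smooth_map \<A> N \<and>
     (\<forall>p. norm (N p) = 1 \<and> (\<forall>w\<in>tangent_space \<A> X p. N p \<bullet> w = 0))"

definition oriented_hypersurface ::
  "'m::{t2_space,second_countable_topology} param set \<Rightarrow> ('m \<Rightarrow> real^4) \<Rightarrow> ('m \<Rightarrow> real^4) \<Rightarrow> bool" where
  "oriented_hypersurface \<A> X N \<longleftrightarrow> smooth_atlas \<A> \<and> immersion \<A> X \<and> unit_normal \<A> X N"

definition shape_operator ::
  "'m param set \<Rightarrow> ('m \<Rightarrow> real^4) \<Rightarrow> ('m \<Rightarrow> real^4) \<Rightarrow> 'm \<Rightarrow> real^4 \<Rightarrow> real^4" where
  "shape_operator \<A> X N p w = - differential \<A> X N p w"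

text \<open>
  The principal curvatures are determined only up to order; the three curvature functions below are
  symmetric in them.
\<close>

definition principal_curvatures ::
  "'m param set \<Rightarrow> ('m \<Rightarrow> real^4) \<Rightarrow> ('m \<Rightarrow> real^4) \<Rightarrow> 'm \<Rightarrow> real^3" where
  "principal_curvatures \<A> X N p =
     (SOME k. \<exists>e :: 3 \<Rightarrow> real^4.
        (\<forall>i. e i \<in> tangent_space \<A> X p) \<and>
        (\<forall>i j. e i \<bullet> e j = (if i = j then 1 else 0)) \<and>
        (\<forall>i. shape_operator \<A> X N p (e i) = (k $ i) *\<^sub>R e i))"

definition mean_curvature ::
  "'m param set \<Rightarrow> ('m \<Rightarrow> real^4) \<Rightarrow> ('m \<Rightarrow> real^4) \<Rightarrow> 'm \<Rightarrow> real" where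
  "mean_curvature \<A> X N p =
     (let k = principal_curvatures \<A> X N p in (k $ 1 + k $ 2 + k $ 3) / 3)"

definition scalar_curvature ::
  "'m param set \<Rightarrow> ('m \<Rightarrow> real^4) \<Rightarrow> ('m \<Rightarrow> real^4) \<Rightarrow> 'm \<Rightarrow> real" where
  "scalar_curvature \<A> X N p =
     (let k = principal_curvatures \<A> X N p in
        (k $ 1 * k $ 2 + k $ 1 * k $ 3 + k $ 2 * k $ 3) / 3)"

definition gauss_kronecker_curvature ::
  "'m param set \<Rightarrow> ('m \<Rightarrow> real^4) \<Rightarrow> ('m \<Rightarrow> real^4) \<Rightarrow> 'm \<Rightarrow> real" where
  "gauss_kronecker_curvature \<A> X N p =
     (let k = principal_curvatures \<A> X N p in k $ 1 * k $ 2 * k $ 3)"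

definition gram_matrix :: "('m \<Rightarrow> real^4) \<Rightarrow> (real^3 \<Rightarrow> 'm) \<Rightarrow> real^3 \<Rightarrow> real^3^3" where
  "gram_matrix X \<phi> u =
     (\<chi> i j. frechet_derivative (X \<circ> \<phi>) (at u) (axis i 1) \<bullet>
            frechet_derivative (X \<circ> \<phi>) (at u) (axis j 1))"

text \<open>The Borel measure \<open>dM\<close> given by the volume element of the induced metric.\<close>

definition volume_measure ::
  "'m::{t2_space,second_countable_topology} param set \<Rightarrow> ('m \<Rightarrow> real^4) \<Rightarrow> 'm measure" where
  "volume_measure \<A> X =
     (THE \<mu>. sets \<mu> = sets borel \<and>
        (\<forall>(U, \<phi>)\<in>\<A>. \<forall>B\<in>sets borel. B \<subseteq> U \<longrightarrow>
           emeasure \<mu> (\<phi> ` B) = (\<integral>\<^sup>+u\<in>B. ennreal (sqrt (det (gram_matrix X \<phi> u))) \<partial>lborel)))"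

definition gradient ::
  "'m param set \<Rightarrow> ('m \<Rightarrow> real^4) \<Rightarrow> ('m \<Rightarrow> real) \<Rightarrow> 'm \<Rightarrow> real^4" where
  "gradient \<A> X g p =
     (THE G. G \<in> tangent_space \<A> X p \<and>
        (\<forall>w\<in>tangent_space \<A> X p. G \<bullet> w = differential \<A> X g p w))"


subsection \<open>Regular domains\<close>

text \<open>
  A piecewise smooth surface is a finite union of smooth parametrized patches. A patch is smooth up
  to the boundary of the closed unit square and is an injective immersion in the interior; sides of
  the square may be collapsed, so that triangular or conical pieces are allowed.
\<close>

definition smooth_patch ::
  "'m::{t2_space,second_countable_topology} param set \<Rightarrow> (real^2 \<Rightarrow> 'm) \<Rightarrow> bool" where
  "smooth_patch \<A> \<sigma> \<longleftrightarrow>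
     (\<exists>W. open W \<and> cbox 0 1 \<subseteq> W \<and> continuous_on W \<sigma> \<and>
        (\<forall>(U, \<phi>)\<in>\<A>. smooth_on (W \<inter> \<sigma> -` (\<phi> ` U)) (inv_into U \<phi> \<circ> \<sigma>))) \<and>
     inj_on \<sigma> (box 0 1) \<and>
     (\<forall>(U, \<phi>)\<in>\<A>. \<forall>s\<in>box 0 1. \<sigma> s \<in> \<phi> ` U \<longrightarrow>
        inj (frechet_derivative (inv_into U \<phi> \<circ> \<sigma>) (at s)))"

definition piecewise_smooth_surface ::
  "'m::{t2_space,second_countable_topology} param set \<Rightarrow> 'm set \<Rightarrow> bool" where
  "piecewise_smooth_surface \<A> S \<longleftrightarrow>
     (\<exists>\<Sigma>. finite \<Sigma> \<and> (\<forall>\<sigma>\<in>\<Sigma>. smooth_patch \<A> \<sigma>) \<and>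
        S = (\<Union>\<sigma>\<in>\<Sigma>. \<sigma> ` cbox 0 1) \<and>
        (\<forall>\<sigma>\<in>\<Sigma>. \<forall>\<tau>\<in>\<Sigma>. \<sigma> \<noteq> \<tau> \<longrightarrow> \<sigma> ` box 0 1 \<inter> \<tau> ` box 0 1 = {}))"

definition regular_domain ::
  "'m::{t2_space,second_countable_topology} param set \<Rightarrow> 'm set \<Rightarrow> bool" where
  "regular_domain \<A> \<Omega> \<longleftrightarrow>
     open \<Omega> \<and> connected \<Omega> \<and> \<Omega> \<noteq> {} \<and> compact (closure \<Omega>) \<and>
     piecewise_smooth_surface \<A> (frontier \<Omega>)"

text \<open>The radius of the smallest ball containing \<open>S\<close>, for bounded nonempty \<open>S\<close>.\<close>

definition enclosing_radius :: "(real^4) set \<Rightarrow> real" where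
  "enclosing_radius S = Inf {r. \<exists>c. S \<subseteq> cball c r}"


subsection \<open>Stability\<close>

definition P1 ::
  "'m param set \<Rightarrow> ('m \<Rightarrow> real^4) \<Rightarrow> ('m \<Rightarrow> real^4) \<Rightarrow> 'm \<Rightarrow> real^4 \<Rightarrow> real^4" where
  "P1 \<A> X N p w = (3 * mean_curvature \<A> X N p) *\<^sub>R w - shape_operator \<A> X N p w"

text \<open>
  The second variation, at a hypersurface with \<open>R = 0\<close>, of the integral of \<open>H\<close> over \<open>\<Omega>\<close> in the
  direction of the normal variation with function \<open>g\<close>, up to a positive constant factor.
\<close>

definition second_variation ::
  "'m::{t2_space,second_countable_topology} param set \<Rightarrow> ('m \<Rightarrow> real^4) \<Rightarrow> ('m \<Rightarrow> real^4) \<Rightarrow>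
   'm set \<Rightarrow> ('m \<Rightarrow> real) \<Rightarrow> real" where
  "second_variation \<A> X N \<Omega> g =
     (LINT p:\<Omega>|volume_measure \<A> X.
        P1 \<A> X N p (gradient \<A> X g p) \<bullet> gradient \<A> X g p
        + 3 * gauss_kronecker_curvature \<A> X N p * (g p)\<^sup>2)"

definition test_function ::
  "'m::{t2_space,second_countable_topology} param set \<Rightarrow> 'm set \<Rightarrow> ('m \<Rightarrow> real) \<Rightarrow> bool" where
  "test_function \<A> \<Omega> g \<longleftrightarrow> smooth_map \<A> g \<and> (\<exists>p. g p \<noteq> 0) \<and>
     compact (closure {p. g p \<noteq> 0}) \<and> closure {p. g p \<noteq> 0} \<subseteq> \<Omega>"

text \<open>
  Reversing the orientation changes the sign of both \<open>H\<close> and the second variation, so the two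
  alternatives agree.
\<close>

definition stable_domain ::
  "'m::{t2_space,second_countable_topology} param set \<Rightarrow> ('m \<Rightarrow> real^4) \<Rightarrow> ('m \<Rightarrow> real^4) \<Rightarrow>
   'm set \<Rightarrow> bool" where
  "stable_domain \<A> X N \<Omega> \<longleftrightarrow>
     ((\<forall>p\<in>\<Omega>. mean_curvature \<A> X N p > 0) \<and>
      (\<forall>g. test_function \<A> \<Omega> g \<longrightarrow> second_variation \<A> X N \<Omega> g > 0)) \<or>
     ((\<forall>p\<in>\<Omega>. mean_curvature \<A> X N p < 0) \<and>
      (\<forall>g. test_function \<A> \<Omega> g \<longrightarrow> second_variation \<A> X N \<Omega> g < 0))"

end

theory Submission
  imports Defs
begin

text \<open>
  The operator \<open>L\<^sub>1\<close> applied to \<open>\<bar>X - c\<bar>\<^sup>2\<close> gives \<open>12 H\<close> when \<open>R = 0\<close>. If \<open>X ` \<Omega>\<close> lies in the ball of radius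
  \<open>\<surd>2 r\<close> about \<open>c\<close>, then \<open>h = 4 r\<^sup>2 - \<bar>X - c\<bar>\<^sup>2\<close> is positive on \<open>\<Omega>\<close> and, for \<open>H > 0\<close>, the curvature
  bound makes it a strict supersolution: \<open>L\<^sub>1 h - 3 K h < 0\<close>. Since \<open>R = 0\<close> also makes \<open>P\<^sub>1\<close>
  semidefinite, Picone's identity with \<open>\<eta> = g\<^sup>2 / h\<close> reduces the second variation to the divergence
  theorem for \<open>\<eta> P\<^sub>1 \<nabla>h\<close>. In coordinates \<open>P\<^sub>1 (X - c)\<^sup>T dM\<close> is, up to sign, the 2-form
  \<open>det (X - c, N, dX, dN)\<close>, whose exterior derivative is computed without any connection.
\<close>

subsection \<open>Determinants and adapted frames\<close>

text \<open>Where \<open>12 H\<close> comes from: \<open>P\<^sub>1\<close> is divergence free and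
  has trace \<open>6 H\<close>, while the normal part of \<open>X - c\<close> enters with the trace
  of \<open>P\<^sub>1 A\<close>, which is \<open>6 R\<close>. The constant
  \<open>4 r\<^sup>2\<close> in \<open>h\<close> could be anything strictly between
  \<open>2 r\<^sup>2\<close> and \<open>8 r\<^sup>2\<close>: the lower end keeps \<open>h\<close>
  positive on the ball of radius \<open>\<surd>2 r\<close>, the upper end keeps
  \<open>3 h / (2 r\<^sup>2)\<close> below 12. Because of this slack a ball slightly larger than the
  smallest one serves, so the infimum in \<open>enclosing_radius\<close> need not be attained, and a
  multiple of the integral of \<open>\<bar>H\<bar> g\<^sup>2\<close> is left over, which gives
  strict positivity without an analysis of equality in Picone's identity. The obstacle is that the
  curvatures come from a pointwise choice of principal curvatures with no regularity. Each is
  computed in a principal frame at one point and at once rewritten through determinants in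
  \<open>X\<close>, \<open>N\<close> and their coordinate derivatives, where the frame has
  disappeared and continuity is visible. The volume measure, the differential and the gradient are
  definite descriptions, so their existence and uniqueness come before any use.\<close>

definition det4 :: "real^4 \<Rightarrow> real^4 \<Rightarrow> real^4 \<Rightarrow> real^4 \<Rightarrow> real" where
  "det4 a b c d =
     (a$1 * b$2 - a$2 * b$1) * (c$3 * d$4 - c$4 * d$3)
   - (a$1 * b$3 - a$3 * b$1) * (c$2 * d$4 - c$4 * d$2)
   + (a$1 * b$4 - a$4 * b$1) * (c$2 * d$3 - c$3 * d$2)
   + (a$2 * b$3 - a$3 * b$2) * (c$1 * d$4 - c$4 * d$1)
   - (a$2 * b$4 - a$4 * b$2) * (c$1 * d$3 - c$3 * d$1)
   + (a$3 * b$4 - a$4 * b$3) * (c$1 * d$2 - c$2 * d$1)"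

text \<open>\<open>det4\<close> is the Laplace expansion along the first two rows, in products of
  complementary 2 by 2 minors. The link to \<open>det\<close> makes the theory of orthogonal
  matrices available.\<close>

lemma det_4:
  "det (A :: real^4^4) = det4 (A$1) (A$2) (A$3) (A$4)"
proof -
  have f: "finite {2::4, 3, 4}" "1 \<notin> {2::4, 3, 4}" "finite {3::4, 4}" "2 \<notin> {3::4, 4}"
    "finite {4::4}" "3 \<notin> {4::4}" by auto
  show ?thesis
    unfolding det_def UNIV_4
    unfolding sum_over_permutations_insert[OF f(1,2)]
    unfolding sum_over_permutations_insert[OF f(3,4)]
    unfolding sum_over_permutations_insert[OF f(5,6)]
    unfolding permutes_sing
    by (simp add: sign_swap_id permutation_swap_id sign_compose sign_id permutation_compose swap_id_eq
        det4_def algebra_simps)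
qed

lemma det4_linear:
  "det4 (a + a') b c d = det4 a b c d + det4 a' b c d"
  "det4 a (b + b') c d = det4 a b c d + det4 a b' c d"
  "det4 a b (c + c') d = det4 a b c d + det4 a b c' d"
  "det4 a b c (d + d') = det4 a b c d + det4 a b c d'"
  "det4 (r *\<^sub>R a) b c d = r * det4 a b c d"
  "det4 a (r *\<^sub>R b) c d = r * det4 a b c d"
  "det4 a b (r *\<^sub>R c) d = r * det4 a b c d"
  "det4 a b c (r *\<^sub>R d) = r * det4 a b c d"
  "det4 (- a) b c d = - det4 a b c d"
  "det4 a (- b) c d = - det4 a b c d"
  "det4 a b (- c) d = - det4 a b c d"
  "det4 a b c (- d) = - det4 a b c d"
  "det4 (a - a') b c d = det4 a b c d - det4 a' b c d"
  "det4 a (b - b') c d = det4 a b c d - det4 a b' c d"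
  "det4 a b (c - c') d = det4 a b c d - det4 a b c' d"
  "det4 a b c (d - d') = det4 a b c d - det4 a b c d'"
  by (simp_all add: det4_def algebra_simps)

lemma det4_alternating:
  "det4 a a c d = 0" "det4 a b a d = 0" "det4 a b c a = 0"
  "det4 a b b d = 0" "det4 a b c b = 0" "det4 a b c c = 0"
  by (simp_all add: det4_def algebra_simps)

lemma det4_swap:
  "det4 b a c d = - det4 a b c d"
  "det4 a c b d = - det4 a b c d"
  "det4 a b d c = - det4 a b c d"
  by (simp_all add: det4_def algebra_simps)

lemma det4_orthonormal:
  assumes "norm a = 1" "norm b = 1" "norm c = 1" "norm d = 1"
    and "a \<bullet> b = 0" "a \<bullet> c = 0" "a \<bullet> d = 0" "b \<bullet> c = 0" "b \<bullet> d = 0" "c \<bullet> d = 0"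
  shows "(det4 a b c d)\<^sup>2 = 1"
proof -
  let ?Q = "(vector [a, b, c, d]) :: real^4^4"
  have v: "?Q $ 1 = a" "?Q $ 2 = b" "?Q $ 3 = c" "?Q $ 4 = d"
    by (simp_all add: vector_def)
  have "orthogonal_matrix ?Q"
    unfolding orthogonal_matrix_orthonormal_rows forall_4
    using assms by (simp add: row_def v orthogonal_def inner_commute)
  then have "det ?Q = 1 \<or> det ?Q = - 1"
    by (rule det_orthogonal_matrix)
  then show ?thesis
    unfolding det_4 v by auto
qed

text \<open>The contraction of \<open>T\<close> with the Levi-Civita symbol: the single component of
  the antisymmetrised 3-form on 3-space, without the factor 1/6.\<close>

definition alternate :: "(3 \<Rightarrow> 3 \<Rightarrow> 3 \<Rightarrow> real) \<Rightarrow> real" where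
  "alternate T = T 1 2 3 - T 1 3 2 + T 2 3 1 - T 2 1 3 + T 3 1 2 - T 3 2 1"

text \<open>This is the pull-back rule for 3-forms: terms with a repeated index cancel and the
  others assemble the Leibniz formula for \<open>det M\<close>. It reduces every curvature formula
  to a computation in a principal frame.\<close>

lemma alternate_change:
  fixes M :: "real^3^3"
  assumes "\<And>i j k. T i j k = (\<Sum>a\<in>UNIV. \<Sum>b\<in>UNIV. \<Sum>c\<in>UNIV. M$i$a * M$j$b * M$k$c * t a b c)"
  shows "alternate T = det M * alternate t"
  unfolding alternate_def assms det_3 sum_3
  by (simp add: algebra_simps)

lemma orthonormal_expand:
  fixes e :: "'i::finite \<Rightarrow> 'a::euclidean_space"
  assumes orthonormal: "\<And>i j. e i \<bullet> e j = (if i = j then 1 else 0)" and "Z \<in> span (range e)"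
  shows "Z = (\<Sum>a\<in>UNIV. (Z \<bullet> e a) *\<^sub>R e a)"
  using assms(2)
  proof (induction rule: span_induct_alt)
    case base
    then show ?case by simp
  next
    case (step c y z)
    then obtain j where y: "y = e j" by auto
    have "(\<Sum>a\<in>UNIV. ((c *\<^sub>R y + z) \<bullet> e a) *\<^sub>R e a)
        = c *\<^sub>R (\<Sum>a\<in>UNIV. (if a = j then 1 else 0) *\<^sub>R e a) + (\<Sum>a\<in>UNIV. (z \<bullet> e a) *\<^sub>R e a)"
      by (simp add: y orthonormal inner_add_left scaleR_add_left sum.distrib scaleR_sum_right eq_commute)
    also have "\<dots> = c *\<^sub>R y + z"
      using step by (simp add: y if_distrib[of "\<lambda>r. r *\<^sub>R _"] cong: if_cong)
    finally show ?case by simp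
  qed

lemma alternate_det4:
  "alternate (\<lambda>i j k. det4 (x i) n (x j) (x k)) = 6 * det4 (x 1) n (x 2) (x 3)"
  by (simp add: alternate_def det4_def algebra_simps)

text \<open>Linear algebra at a single point: \<open>e\<close> will be a principal frame,
  \<open>n\<close> the unit normal, \<open>x\<close> and \<open>\<nu>\<close> the coordinate
  derivatives of position and normal, and \<open>k\<close> the principal curvatures.
  \<open>weingarten\<close> is the equation dN = - A dX in this frame.\<close>

locale adapted_frame =
  fixes e x \<nu> :: "3 \<Rightarrow> real^4" and n :: "real^4" and k :: "real^3"
  assumes orthonormal: "\<And>i j. e i \<bullet> e j = (if i = j then 1 else 0)"
    and normal: "n \<bullet> n = 1" "\<And>i. n \<bullet> e i = 0"
    and tangent: "\<And>i. x i = (\<Sum>a\<in>UNIV. (x i \<bullet> e a) *\<^sub>R e a)"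
    and weingarten: "\<And>i. \<nu> i = - (\<Sum>a\<in>UNIV. ((x i \<bullet> e a) * k$a) *\<^sub>R e a)"
begin

definition frame_matrix :: "real^3^3" where
  "frame_matrix = (\<chi> i a. x i \<bullet> e a)"

lemma x_expand: "x i = frame_matrix$i$1 *\<^sub>R e 1 + frame_matrix$i$2 *\<^sub>R e 2 + frame_matrix$i$3 *\<^sub>R e 3"
  by (subst tangent) (simp add: frame_matrix_def sum_3)

lemma \<nu>_expand: "\<nu> i = (- frame_matrix$i$1 * k$1) *\<^sub>R e 1 + (- frame_matrix$i$2 * k$2) *\<^sub>R e 2
    + (- frame_matrix$i$3 * k$3) *\<^sub>R e 3"
  by (subst weingarten) (simp add: frame_matrix_def sum_3)

text \<open>The orientation sign of the frame, 1 or -1. No orientation is imposed on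
  \<open>e\<close>; the sign is absorbed by \<open>D\<close> below.\<close>

definition \<delta> :: real where "\<delta> = det4 (e 1) n (e 2) (e 3)"

lemma \<delta>_square: "\<delta>\<^sup>2 = 1"
  unfolding \<delta>_def
  by (rule det4_orthonormal) (auto simp: orthonormal normal norm_eq_1 inner_commute[of "e _" n])

text \<open>The vectors \<open>n\<close> and \<open>e\<close> form an orthonormal basis. After
  expanding \<open>Y\<close> in it, the terms that repeat a vector already present vanish, and only
  the component along the missing \<open>e\<close> survives.\<close>

lemma det4_frame:
  "det4 Y n (e 2) (e 3) = (Y \<bullet> e 1) * \<delta>"
  "det4 Y n (e 3) (e 1) = (Y \<bullet> e 2) * \<delta>"
  "det4 Y n (e 1) (e 2) = (Y \<bullet> e 3) * \<delta>"
  "det4 Y n (e 3) (e 2) = - (Y \<bullet> e 1) * \<delta>"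
  "det4 Y n (e 1) (e 3) = - (Y \<bullet> e 2) * \<delta>"
  "det4 Y n (e 2) (e 1) = - (Y \<bullet> e 3) * \<delta>"
proof -
  let ?B = "insert n (e ` UNIV)"
  have fin: "finite ?B" by simp
  have "inj e"
    by (rule injI) (metis orthonormal zero_neq_one)
  moreover have "n \<notin> range e"
    using normal by (metis imageE zero_neq_one)
  ultimately have card: "card ?B = 4"
    by (simp add: card_image)
  have pw: "pairwise orthogonal ?B"
    by (auto simp: pairwise_def orthogonal_def orthonormal normal inner_commute[of "e _" n])
  have nz: "0 \<notin> ?B"
    using normal(1) orthonormal by (metis imageE inner_zero_left insertE zero_neq_one)
  have ind: "independent ?B"
    by (rule pairwise_orthogonal_independent[OF pw nz])
  have "span ?B = UNIV"
    using card_eq_dim[of ?B UNIV] ind card by auto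
  then have "Y \<in> span ?B" by simp
  then obtain r Z where Z: "Y = r *\<^sub>R n + Z" "Z \<in> span (range e)"
    by (auto simp: span_insert) (metis add.commute diff_add_cancel)
  have "Z = (\<Sum>a\<in>UNIV. (Z \<bullet> e a) *\<^sub>R e a)"
    using orthonormal_expand[OF orthonormal Z(2)] .
  moreover have "Z \<bullet> e a = Y \<bullet> e a" for a
    by (simp add: Z inner_add_left normal)
  ultimately have Y: "Y = r *\<^sub>R n + (\<Sum>a\<in>UNIV. (Y \<bullet> e a) *\<^sub>R e a)"
    using Z by simp
  define y where "y a = Y \<bullet> e a" for a
  have "Y = r *\<^sub>R n + (y 1 *\<^sub>R e 1 + y 2 *\<^sub>R e 2 + y 3 *\<^sub>R e 3)"
    using Y unfolding y_def sum_3 .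
  \<comment> \<open>Rewriting with this instance expands \<open>Y\<close> only inside the
    determinant and leaves the inner products on the right alone.\<close>
  note E = arg_cong[OF this, of "\<lambda>Y. det4 Y n (e _) (e _)"]
  show 1: "det4 Y n (e 2) (e 3) = (Y \<bullet> e 1) * \<delta>" 
    unfolding E by (simp add: det4_linear det4_alternating y_def \<delta>_def)
  show 2: "det4 Y n (e 3) (e 1) = (Y \<bullet> e 2) * \<delta>"
    unfolding E by (simp add: det4_linear det4_alternating y_def \<delta>_def)
      (metis det4_swap minus_minus)
  show 3: "det4 Y n (e 1) (e 2) = (Y \<bullet> e 3) * \<delta>"
    unfolding E by (simp add: det4_linear det4_alternating y_def \<delta>_def)
      (metis det4_swap minus_minus)
  show "det4 Y n (e 3) (e 2) = - (Y \<bullet> e 1) * \<delta>"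
  "det4 Y n (e 1) (e 3) = - (Y \<bullet> e 2) * \<delta>"
  "det4 Y n (e 2) (e 1) = - (Y \<bullet> e 3) * \<delta>"
    using 1 2 3 det4_swap(3)[of Y n "e 3" "e 2"] det4_swap(3)[of Y n "e 1" "e 3"]
      det4_swap(3)[of Y n "e 2" "e 1"] by simp_all
qed

text \<open>The signed volume spanned by the coordinate vectors. The normal stands in the second
  slot because the 2-form of the divergence theorem has it there.\<close>

definition D :: real where "D = det4 (x 1) n (x 2) (x 3)"

lemma D_eq: "D = det frame_matrix * \<delta>"
proof -
  have "alternate (\<lambda>i j k. det4 (x i) n (x j) (x k))
      = det frame_matrix * alternate (\<lambda>a b c. det4 (e a) n (e b) (e c))"
    by (rule alternate_change) (simp add: x_expand sum_3 det4_linear algebra_simps)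
  then show ?thesis
    unfolding alternate_det4 D_def \<delta>_def by simp
qed

text \<open>In the frame the last slot contributes the factor \<open>- k$c\<close>, and each index
  occupies the last slot in exactly two of the six permutations. This is the part of the exterior
  derivative that produces the mean curvature.\<close>

lemma alternate_trace:
  "alternate (\<lambda>i j l. det4 (x i) n (x j) (\<nu> l)) = - 2 * D * (k$1 + k$2 + k$3)"
proof -
  have "alternate (\<lambda>i j l. det4 (x i) n (x j) (\<nu> l))
      = det frame_matrix * alternate (\<lambda>a b c. - k$c * det4 (e a) n (e b) (e c))"
    by (rule alternate_change) (simp add: x_expand \<nu>_expand sum_3 det4_linear algebra_simps)
  then show ?thesis
    unfolding alternate_def det4_frame orthonormal D_eq by (simp add: algebra_simps)
qed

text \<open>Two slots carry a principal curvature, so each unordered pair of curvatures appears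
  twice and the second elementary symmetric function comes out. This is the part of the exterior
  derivative that vanishes when R = 0, for arbitrary \<open>Y\<close>.\<close>

lemma alternate_second:
  "alternate (\<lambda>i j l. det4 Y (\<nu> i) (x j) (\<nu> l))
     = 2 * det frame_matrix * det4 Y (e 1) (e 2) (e 3) * (k$1 * k$2 + k$1 * k$3 + k$2 * k$3)"
proof -
  have *: "alternate (\<lambda>i j l. det4 Y (\<nu> i) (x j) (\<nu> l))
      = det frame_matrix * alternate (\<lambda>a b c. k$a * k$c * det4 Y (e a) (e b) (e c))"
    by (rule alternate_change) (simp add: x_expand \<nu>_expand sum_3 det4_linear algebra_simps)
  have "det4 Y (e 1) (e 3) (e 2) = - det4 Y (e 1) (e 2) (e 3)"
    "det4 Y (e 2) (e 1) (e 3) = - det4 Y (e 1) (e 2) (e 3)"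
    "det4 Y (e 2) (e 3) (e 1) = det4 Y (e 1) (e 2) (e 3)"
    "det4 Y (e 3) (e 1) (e 2) = det4 Y (e 1) (e 2) (e 3)"
    "det4 Y (e 3) (e 2) (e 1) = - det4 Y (e 1) (e 2) (e 3)"
    by (simp_all add: det4_def algebra_simps)
  then show ?thesis
    unfolding * unfolding alternate_def by (simp add: algebra_simps)
qed

text \<open>All three slots carry a factor \<open>- k\<close>. This exhibits K, up to sign, as the
  Jacobian of the Gauss map relative to the volume of the coordinate vectors.\<close>

lemma det4_gauss_map: "det4 (\<nu> 1) n (\<nu> 2) (\<nu> 3) = - (k$1 * k$2 * k$3) * D"
proof -
  have "alternate (\<lambda>i j l. det4 (\<nu> i) n (\<nu> j) (\<nu> l))
      = det frame_matrix * alternate (\<lambda>a b c. - (k$a * k$b * k$c) * det4 (e a) n (e b) (e c))"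
    by (rule alternate_change) (simp add: \<nu>_expand sum_3 det4_linear algebra_simps)
  then have "6 * det4 (\<nu> 1) n (\<nu> 2) (\<nu> 3) = - 6 * (k$1 * k$2 * k$3) * D"
    unfolding alternate_det4 unfolding alternate_def det4_frame orthonormal D_eq by (simp add: algebra_simps)
  then show ?thesis by simp
qed

text \<open>With the index \<open>a\<close> of \<open>h'\<close> fixed, the last slot runs through
  the two other indices, so the two remaining curvatures add up to
  \<open>k$1 + k$2 + k$3 - k$a\<close>. That is the eigenvalue of \<open>P1\<close> on
  \<open>e a\<close>, which is how \<open>P1\<close> enters the exterior calculus.\<close>

lemma alternate_newton:
  assumes "\<And>i. h i = (\<Sum>a\<in>UNIV. (x i \<bullet> e a) * h' a)"
  shows "alternate (\<lambda>i j l. h i * det4 Y n (x j) (\<nu> l))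
     = - D * (\<Sum>a\<in>UNIV. h' a * (k$1 + k$2 + k$3 - k$a) * (Y \<bullet> e a))"
proof -
  have h: "h i = frame_matrix$i$1 * h' 1 + frame_matrix$i$2 * h' 2 + frame_matrix$i$3 * h' 3" for i
    by (simp add: assms frame_matrix_def sum_3)
  have "alternate (\<lambda>i j l. h i * det4 Y n (x j) (\<nu> l))
      = det frame_matrix * alternate (\<lambda>a b c. - k$c * h' a * det4 Y n (e b) (e c))"
    by (rule alternate_change) (simp add: h x_expand \<nu>_expand sum_3 det4_linear algebra_simps)
  then show ?thesis
    unfolding alternate_def det4_frame D_eq det4_alternating sum_3 by (simp add: algebra_simps)
qed

text \<open>Same computation as \<open>alternate_newton\<close> with the weight 1 in place of
  \<open>- k$c\<close>; each \<open>h' a\<close> is met twice. It serves to express a gradient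
  without a frame.\<close>

lemma alternate_gradient:
  assumes "\<And>i. h i = (\<Sum>a\<in>UNIV. (x i \<bullet> e a) * h' a)"
  shows "alternate (\<lambda>i j l. h i * det4 Y n (x j) (x l)) = 2 * D * (\<Sum>a\<in>UNIV. h' a * (Y \<bullet> e a))"
proof -
  have h: "h i = frame_matrix$i$1 * h' 1 + frame_matrix$i$2 * h' 2 + frame_matrix$i$3 * h' 3" for i
    by (simp add: assms frame_matrix_def sum_3)
  have "alternate (\<lambda>i j l. h i * det4 Y n (x j) (x l))
      = det frame_matrix * alternate (\<lambda>a b c. h' a * det4 Y n (e b) (e c))"
    by (rule alternate_change) (simp add: h x_expand sum_3 det4_linear algebra_simps)
  then show ?thesis
    unfolding alternate_def det4_frame D_eq sum_3 by (simp add: algebra_simps)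
qed

text \<open>The Gram matrix is \<open>frame_matrix\<close> times its transpose, and the orientation
  sign squares to 1.\<close>

lemma det_gram: "det ((\<chi> i j. x i \<bullet> x j) :: real^3^3) = D\<^sup>2"
proof -
  have "x i \<bullet> x j = (\<Sum>a\<in>UNIV. (x i \<bullet> e a) * (x j \<bullet> e a))" for i j
    by (subst tangent[of i]) (simp add: inner_sum_left inner_commute[of "x j" "e _"])
  then have "(\<chi> i j. x i \<bullet> x j) = frame_matrix ** transpose frame_matrix"
    by (simp add: frame_matrix_def matrix_matrix_mult_def transpose_def)
  then show ?thesis
    using \<delta>_square by (simp add: det_mul D_eq power2_eq_square algebra_simps)
qed

lemma D_nonzero:
  assumes "\<And>a. e a = (\<Sum>i\<in>UNIV. V$a$i *\<^sub>R x i)"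
  shows "D \<noteq> 0"
proof -
  have "(\<Sum>i\<in>UNIV. V$a$i * (x i \<bullet> e b)) = e a \<bullet> e b" for a b
    by (subst (2) assms) (simp add: inner_sum_left)
  then have "V ** frame_matrix = mat 1"
    by (simp add: frame_matrix_def matrix_matrix_mult_def mat_def orthonormal vec_eq_iff)
  then have "det V * det frame_matrix = 1" by (metis det_I det_mul)
  then show ?thesis using \<delta>_square by (auto simp: D_eq)
qed

end

subsection \<open>Spectral theorem on subspaces and second derivatives\<close>

text \<open>A maximiser \<open>v\<close> of the Rayleigh quotient on the unit sphere of
  \<open>S\<close> is an eigenvector: otherwise moving \<open>v\<close> along the component
  \<open>w\<close> of \<open>f v\<close> orthogonal to \<open>v\<close> would increase the quotient.
  Self-adjointness is asked for on \<open>S\<close> alone, as the shape operator lives on a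
  hyperplane.\<close>

lemma selfadjoint_max_eigenvector:
  fixes f :: "'a::euclidean_space \<Rightarrow> 'a"
  assumes lin: "linear f" and S: "subspace S" and inv: "\<And>x. x \<in> S \<Longrightarrow> f x \<in> S"
    and self: "\<And>x y. x \<in> S \<Longrightarrow> y \<in> S \<Longrightarrow> f x \<bullet> y = x \<bullet> f y"
    and nontriv: "S \<noteq> {0}"
  obtains v k where "v \<in> S" "norm v = 1" "f v = k *\<^sub>R v"
proof -
  interpret f: linear f by (rule lin)
  have cont: "continuous_on (S \<inter> sphere 0 1) (\<lambda>x. f x \<bullet> x)"
    by (intro continuous_intros linear_continuous_on linear_conv_bounded_linear[THEN iffD1] lin)
  have comp: "compact (S \<inter> sphere 0 1)"
    by (simp add: closed_Int_compact closed_subspace S)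
  obtain y where "y \<in> S" "y \<noteq> 0"
    using S nontriv subspace_0 by blast
  then have "y /\<^sub>R norm y \<in> S \<inter> sphere 0 1"
    by (simp add: S subspace_scale)
  then obtain v where v: "v \<in> S" "norm v = 1"
    and max: "\<And>y. y \<in> S \<Longrightarrow> norm y = 1 \<Longrightarrow> f y \<bullet> y \<le> f v \<bullet> v"
    using continuous_attains_sup[OF comp _ cont] by (metis IntD1 IntD2 IntI empty_iff mem_sphere_0)
  define k where "k = f v \<bullet> v"
  have max': "f y \<bullet> y \<le> k * (norm y)\<^sup>2" if "y \<in> S" for y
  proof (cases "y = 0")
    case False
    have "f (y /\<^sub>R norm y) \<bullet> (y /\<^sub>R norm y) \<le> k"
      unfolding k_def by (rule max) (use that False S subspace_scale in auto)
    then have "(f y \<bullet> y) / (norm y)\<^sup>2 \<le> k"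
      by (simp add: f.scaleR divide_inverse power2_eq_square ac_simps)
    then show ?thesis using False by (simp add: divide_simps)
  qed (simp add: f.zero)
  define w where "w = f v - k *\<^sub>R v"
  have wS: "w \<in> S" unfolding w_def using v inv S by (simp add: subspace_diff subspace_scale)
  have vw: "v \<bullet> w = 0" using v(2) by (simp add: w_def k_def inner_diff_right inner_commute norm_eq_1)
  have fvw: "f v \<bullet> w = w \<bullet> w"
    using vw by (simp add: w_def inner_diff_left inner_diff_right inner_commute)
  have fwv: "f w \<bullet> v = w \<bullet> w" using fvw self[OF wS v(1)] by (simp add: inner_commute)
  have vv: "v \<bullet> v = 1" using v(2) by (simp add: norm_eq_1)
  have "w \<bullet> w = 0"
  proof (rule ccontr)
    assume "w \<bullet> w \<noteq> 0"
    then have c: "w \<bullet> w > 0" by simp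
    define m where "m = k * (w \<bullet> w) - f w \<bullet> w"
    \<comment> \<open>Maximality compared at \<open>v + t *\<^sub>R w\<close>: the linear term in
      \<open>t\<close> has coefficient twice the squared norm of \<open>w\<close>, and everything
      quadratic is collected in \<open>m\<close>.\<close>
    have *: "2 * t * (w \<bullet> w) \<le> t\<^sup>2 * m" for t
    proof -
      have "f (v + t *\<^sub>R w) \<bullet> (v + t *\<^sub>R w) \<le> k * (norm (v + t *\<^sub>R w))\<^sup>2"
        by (rule max') (simp add: v wS S subspace_add subspace_scale)
      moreover have "(norm (v + t *\<^sub>R w))\<^sup>2 = 1 + t\<^sup>2 * (w \<bullet> w)"
        unfolding power2_norm_eq_inner using vw vv
        by (simp add: inner_add_left inner_add_right inner_commute[of w v] power2_eq_square)
      ultimately show ?thesis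
        using vw fvw fwv vv
        by (simp add: f.add f.scaleR inner_add_left inner_add_right
            k_def[symmetric] m_def inner_commute[of w v] algebra_simps power2_eq_square)
    qed
    \<comment> \<open>This \<open>t\<close> is small enough for the linear term to beat the
      quadratic one, whatever the sign of \<open>m\<close>.\<close>
    have "2 * (w \<bullet> w / (\<bar>m\<bar> + 1)) * (w \<bullet> w) \<le> (w \<bullet> w / (\<bar>m\<bar> + 1))\<^sup>2 * m"
      by (rule *)
    also have "\<dots> \<le> (w \<bullet> w / (\<bar>m\<bar> + 1))\<^sup>2 * (\<bar>m\<bar> + 1)"
      by (intro mult_left_mono) auto
    also have "\<dots> = (w \<bullet> w / (\<bar>m\<bar> + 1)) * (w \<bullet> w)"
      by (simp add: power2_eq_square)
    finally have "(w \<bullet> w / (\<bar>m\<bar> + 1)) * (w \<bullet> w) \<le> 0" by simp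
    moreover have "(w \<bullet> w / (\<bar>m\<bar> + 1)) * (w \<bullet> w) > 0"
      using c by (intro mult_pos_pos divide_pos_pos) auto
    ultimately show False by simp
  qed
  then have "f v = k *\<^sub>R v" by (simp add: w_def)
  then show ?thesis using that v by blast
qed

text \<open>Induction on the dimension: split off one unit eigenvector and continue in its
  orthogonal complement within \<open>S\<close>, which is invariant by self-adjointness.\<close>

lemma selfadjoint_eigenbasis:
  fixes f :: "'a::euclidean_space \<Rightarrow> 'a"
  assumes lin: "linear f" and "subspace S" and "\<And>x. x \<in> S \<Longrightarrow> f x \<in> S"
    and "\<And>x y. x \<in> S \<Longrightarrow> y \<in> S \<Longrightarrow> f x \<bullet> y = x \<bullet> f y"
  shows "\<exists>B. B \<subseteq> S \<and> pairwise orthogonal B \<and> (\<forall>b\<in>B. norm b = 1 \<and> (\<exists>k. f b = k *\<^sub>R b)) \<and> span B = S"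
  using assms(2-)
proof (induction "dim S" arbitrary: S rule: less_induct)
  case less
  show ?case
  proof (cases "S = {0}")
    case True
    then show ?thesis by (intro exI[of _ "{}"]) auto
  next
    case False
    obtain v k where v: "v \<in> S" "norm v = 1" "f v = k *\<^sub>R v"
      using selfadjoint_max_eigenvector[OF lin less.prems False] by metis
    define S' where "S' = S \<inter> {x. v \<bullet> x = 0}"
    have sub: "subspace S'"
      unfolding S'_def by (intro subspace_inter less.prems(1) subspace_hyperplane)
    have "v \<notin> S'" using v by (auto simp: S'_def)
    then have "S' \<subset> S" using v(1) unfolding S'_def by blast
    then have dim: "dim S' < dim S"
      using dim_psubset[of S' S] sub less.prems(1) by (simp add: span_eq_iff[THEN iffD2])
    have inv: "f x \<in> S'" if "x \<in> S'" for x
      using that less.prems(2) less.prems(3)[OF v(1), of x] by (auto simp: S'_def v(3))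
    obtain B where B: "B \<subseteq> S'" "pairwise orthogonal B"
      "\<forall>b\<in>B. norm b = 1 \<and> (\<exists>k. f b = k *\<^sub>R b)" "span B = S'"
      using less.hyps[OF dim sub inv] less.prems(3) unfolding S'_def by blast
    have "span (insert v B) = S"
    proof
      show "span (insert v B) \<subseteq> S"
        by (rule span_minimal) (use v B less.prems(1) in \<open>auto simp: S'_def\<close>)
      show "S \<subseteq> span (insert v B)"
      proof
        fix x assume x: "x \<in> S"
        have "x - (v \<bullet> x) *\<^sub>R v \<in> S'"
          using x v less.prems(1)
          by (simp add: S'_def subspace_diff subspace_scale inner_diff_right norm_eq_1)
        then show "x \<in> span (insert v B)"
          unfolding span_insert B(4) by blast
      qed
    qed
    moreover have "pairwise orthogonal (insert v B)"
      using B(1,2) by (auto simp: pairwise_insert orthogonal_def S'_def inner_commute)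
    ultimately show ?thesis
      using v B less.prems by (intro exI[of _ "insert v B"]) (auto simp: S'_def)
  qed
qed

lemma orthonormal_eigenframe:
  fixes f :: "'a::euclidean_space \<Rightarrow> 'a"
  assumes "linear f" "subspace S" "\<And>x. x \<in> S \<Longrightarrow> f x \<in> S"
    and "\<And>x y. x \<in> S \<Longrightarrow> y \<in> S \<Longrightarrow> f x \<bullet> y = x \<bullet> f y"
    and dim: "dim S = CARD('n)"
  obtains e :: "'n::finite \<Rightarrow> 'a" and k :: "real^'n"
  where "\<And>i. e i \<in> S" "\<And>i j. e i \<bullet> e j = (if i = j then 1 else 0)" "\<And>i. f (e i) = (k $ i) *\<^sub>R e i"
proof -
  obtain B where B: "B \<subseteq> S" "pairwise orthogonal B" "span B = S"
    and eig: "\<And>b. b \<in> B \<Longrightarrow> norm b = 1 \<and> (\<exists>k. f b = k *\<^sub>R b)"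
    using selfadjoint_eigenbasis[OF assms(1-4)] by blast
  have "0 \<notin> B" using eig by force
  then have ind: "independent B" using B(2) pairwise_orthogonal_independent by blast
  then have "finite B" by (rule independent_imp_finite)
  moreover have "card B = CARD('n)"
    using dim ind B by (metis dim_span dim_eq_card_independent)
  ultimately obtain e :: "'n \<Rightarrow> 'a" where e: "bij_betw e UNIV B"
    by (metis finite_same_card_bij finite_class.finite_UNIV)
  then have eB: "e i \<in> B" for i by (auto simp: bij_betw_def)
  obtain k where k: "\<And>i. f (e i) = k i *\<^sub>R e i"
    using eig[OF eB] by metis
  show thesis
  proof (rule that)
    show "e i \<in> S" for i using eB B by blast
    show "e i \<bullet> e j = (if i = j then 1 else 0)" for i j
    proof (cases "i = j")
      case False
      then have "e i \<noteq> e j" using e by (auto simp: bij_betw_def inj_def)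
      then show ?thesis using B(2) eB False by (auto simp: pairwise_def orthogonal_def)
    qed (use eig[OF eB] norm_eq_1 in auto)
    show "f (e i) = ((\<chi> i. k i) $ i) *\<^sub>R e i" for i using k by simp
  qed
qed

section \<open>Symmetry of second derivatives\<close>

lemma has_real_derivative_along_line:
  fixes f :: "'a::real_normed_vector \<Rightarrow> real"
  assumes "(f has_derivative f') (at (y + s *\<^sub>R b))"
  shows "((\<lambda>s. f (y + s *\<^sub>R b)) has_real_derivative f' b) (at s)"
proof -
  have "((\<lambda>s. y + s *\<^sub>R b) has_derivative (\<lambda>r. r *\<^sub>R b)) (at s)"
    by (auto intro!: derivative_eq_intros)
  from diff_chain_at[OF this assms]
  have "((\<lambda>s. f (y + s *\<^sub>R b)) has_derivative (\<lambda>r. f' (r *\<^sub>R b))) (at s)"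
    by (simp add: o_def)
  moreover have "f' (r *\<^sub>R b) = f' b * r" for r
    using assms by (simp add: has_derivative_def bounded_linear.linear linear_scale)
  ultimately show ?thesis
    by (simp add: has_field_derivative_def)
qed

text \<open>The mean value theorem is applied twice: along \<open>b\<close> to the difference of
  \<open>f\<close> over a step in direction \<open>c\<close>, then along \<open>c\<close> to the
  derivative so obtained.\<close>

lemma second_difference_mvt:
  fixes f :: "'a::real_normed_vector \<Rightarrow> real"
  assumes h: "h > 0" and seg: "\<And>s t. 0 \<le> s \<Longrightarrow> s \<le> h \<Longrightarrow> 0 \<le> t \<Longrightarrow> t \<le> h \<Longrightarrow> x + s *\<^sub>R b + t *\<^sub>R c \<in> S"
    and f: "\<And>y. y \<in> S \<Longrightarrow> (f has_derivative f' y) (at y)"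
    and fb: "\<And>y. y \<in> S \<Longrightarrow> ((\<lambda>y. f' y b) has_derivative f'' y) (at y)"
  obtains s t where "0 \<le> s" "s \<le> h" "0 \<le> t" "t \<le> h"
    "f (x + h *\<^sub>R b + h *\<^sub>R c) - f (x + h *\<^sub>R b) - f (x + h *\<^sub>R c) + f x = h * h * f'' (x + s *\<^sub>R b + t *\<^sub>R c) c"
proof -
  have line: "((\<lambda>s. f (y + s *\<^sub>R b)) has_real_derivative f' (y + s *\<^sub>R b) b) (at s)"
    if "y + s *\<^sub>R b \<in> S" for y s
    by (rule has_real_derivative_along_line[OF f[OF that]])
  have "\<exists>s. 0 < s \<and> s < h \<and> (f (x + h *\<^sub>R c + h *\<^sub>R b) - f (x + h *\<^sub>R b)) - (f (x + h *\<^sub>R c + 0 *\<^sub>R b) - f (x + 0 *\<^sub>R b))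
      = (h - 0) * (f' (x + h *\<^sub>R c + s *\<^sub>R b) b - f' (x + s *\<^sub>R b) b)"
    proof (rule MVT2)
    show "0 < h" by (rule h)
    fix r assume r: "0 \<le> r" "r \<le> h"
    have "x + h *\<^sub>R c + r *\<^sub>R b \<in> S" "x + r *\<^sub>R b \<in> S"
      using seg[OF r, of h] seg[OF r, of 0] h by (simp_all add: add_ac)
    then show "((\<lambda>s. f (x + h *\<^sub>R c + s *\<^sub>R b) - f (x + s *\<^sub>R b)) has_real_derivative
        f' (x + h *\<^sub>R c + r *\<^sub>R b) b - f' (x + r *\<^sub>R b) b) (at r)"
      by (intro DERIV_diff line)
  qed
  then obtain s where s: "0 < s" "s < h"
    "f (x + h *\<^sub>R b + h *\<^sub>R c) - f (x + h *\<^sub>R b) - f (x + h *\<^sub>R c) + f x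
       = h * (f' (x + h *\<^sub>R c + s *\<^sub>R b) b - f' (x + s *\<^sub>R b) b)"
    by (auto simp: algebra_simps)
  have "((\<lambda>t. f' (x + s *\<^sub>R b + t *\<^sub>R c) b) has_real_derivative f'' (x + s *\<^sub>R b + t *\<^sub>R c) c) (at t)"
    if "0 \<le> t" "t \<le> h" for t
    by (rule has_real_derivative_along_line[OF fb]) (use seg s that in simp)
  then have "\<exists>t. 0 < t \<and> t < h \<and> f' (x + s *\<^sub>R b + h *\<^sub>R c) b - f' (x + s *\<^sub>R b + 0 *\<^sub>R c) b = (h - 0) * f'' (x + s *\<^sub>R b + t *\<^sub>R c) c"
    by (intro MVT2) (use h in auto)
  then obtain t where "0 < t" "t < h" "f' (x + s *\<^sub>R b + h *\<^sub>R c) b - f' (x + s *\<^sub>R b) b = h * f'' (x + s *\<^sub>R b + t *\<^sub>R c) c"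
    by auto
  then show thesis
    using s by (intro that[of s t]) (auto simp: add_ac)
qed

text \<open>The second difference is symmetric in \<open>b\<close> and \<open>c\<close>, but the two
  orders of the mean value theorem express it through the two mixed derivatives at points near
  \<open>x\<close>. Continuity then forces the values at \<open>x\<close> to agree.\<close>

lemma second_derivative_symmetric:
  fixes f :: "'a::real_normed_vector \<Rightarrow> real"
  assumes S: "open S" "x \<in> S"
    and f: "\<And>y. y \<in> S \<Longrightarrow> (f has_derivative f' y) (at y)"
    and fb: "\<And>y. y \<in> S \<Longrightarrow> ((\<lambda>y. f' y b) has_derivative fb y) (at y)"
    and fc: "\<And>y. y \<in> S \<Longrightarrow> ((\<lambda>y. f' y c) has_derivative fc y) (at y)"
    and cont: "continuous_on S (\<lambda>y. fb y c)" "continuous_on S (\<lambda>y. fc y b)"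
  shows "fb x c = fc x b"
proof (rule ccontr)
  assume ne: "fb x c \<noteq> fc x b"
  define \<epsilon> where "\<epsilon> = \<bar>fb x c - fc x b\<bar> / 2"
  have \<epsilon>: "\<epsilon> > 0" using ne by (simp add: \<epsilon>_def)
  have "\<forall>\<^sub>F y in at x. dist (fb y c) (fb x c) < \<epsilon>" "\<forall>\<^sub>F y in at x. dist (fc y b) (fc x b) < \<epsilon>"
    using cont S \<epsilon> by (auto simp: continuous_on_eq_continuous_at isCont_def tendsto_iff)
  moreover have "\<forall>\<^sub>F y in at x. y \<in> S"
    using S by (simp add: eventually_at_in_open')
  ultimately have "\<forall>\<^sub>F y in at x. y \<in> S \<and> dist (fb y c) (fb x c) < \<epsilon> \<and> dist (fc y b) (fc x b) < \<epsilon>"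
    by eventually_elim auto
  then obtain d where d: "d > 0" "\<And>y. y \<noteq> x \<Longrightarrow> dist y x < d \<Longrightarrow> y \<in> S \<and> dist (fb y c) (fb x c) < \<epsilon> \<and> dist (fc y b) (fc x b) < \<epsilon>"
    by (auto simp: eventually_at)
  have d': "y \<in> S \<and> dist (fb y c) (fb x c) < \<epsilon> \<and> dist (fc y b) (fc x b) < \<epsilon>" if "dist y x < d" for y
    using d(2)[of y] that S \<epsilon> by (cases "y = x") auto
  \<comment> \<open>Half of \<open>d\<close>, scaled so that the parallelogram with sides
    \<open>h *\<^sub>R b\<close> and \<open>h *\<^sub>R c\<close> stays within distance
    \<open>d\<close> of \<open>x\<close>; the summand 1 keeps the denominator positive.\<close>
  define h where "h = d / 2 / (norm b + norm c + 1)"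
  have n: "norm b + norm c + 1 > 0"
    by (smt (verit) norm_ge_zero)
  have h: "h > 0" using d(1) n by (simp add: h_def)
  have near: "dist (x + s *\<^sub>R b + t *\<^sub>R c) x < d" if "0 \<le> s" "s \<le> h" "0 \<le> t" "t \<le> h" for s t
  proof -
    have "dist (x + s *\<^sub>R b + t *\<^sub>R c) x \<le> s * norm b + t * norm c"
      using norm_triangle_ineq[of "s *\<^sub>R b" "t *\<^sub>R c"] that by (simp add: dist_norm)
    also have "\<dots> \<le> h * norm b + h * norm c"
      using that by (intro add_mono mult_right_mono) auto
    also have "\<dots> < 2 * h * (norm b + norm c + 1)"
    proof -
      have "0 \<le> h * norm b" "0 \<le> h * norm c" using h by auto
      moreover have "2 * h * (norm b + norm c + 1) = 2 * (h * norm b) + 2 * (h * norm c) + 2 * h"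
        by (simp add: algebra_simps)
      ultimately show ?thesis using h by linarith
    qed
    also have "\<dots> = d" using n by (simp add: h_def del: distrib_left_numeral distrib_right_numeral)
    finally show ?thesis .
  qed
  obtain s t where 1: "0 \<le> s" "s \<le> h" "0 \<le> t" "t \<le> h"
    "f (x + h *\<^sub>R b + h *\<^sub>R c) - f (x + h *\<^sub>R b) - f (x + h *\<^sub>R c) + f x = h * h * fb (x + s *\<^sub>R b + t *\<^sub>R c) c"
    by (rule second_difference_mvt[where x=x and b=b and c=c and S=S, OF h _ f fb]) (use near d' in auto)
  have near': "dist (x + s *\<^sub>R c + t *\<^sub>R b) x < d" if "0 \<le> s" "s \<le> h" "0 \<le> t" "t \<le> h" for s t
    using near[of t s] that by (simp add: add_ac)
  obtain s' t' where 2: "0 \<le> s'" "s' \<le> h" "0 \<le> t'" "t' \<le> h"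
    "f (x + h *\<^sub>R c + h *\<^sub>R b) - f (x + h *\<^sub>R c) - f (x + h *\<^sub>R b) + f x = h * h * fc (x + s' *\<^sub>R c + t' *\<^sub>R b) b"
    by (rule second_difference_mvt[where x=x and b=c and c=b and S=S, OF h _ f fc]) (use near' d' in auto)
  have swap: "x + h *\<^sub>R c + h *\<^sub>R b = x + h *\<^sub>R b + h *\<^sub>R c" by (simp add: add_ac)
  have "h * h * fb (x + s *\<^sub>R b + t *\<^sub>R c) c = h * h * fc (x + s' *\<^sub>R c + t' *\<^sub>R b) b"
    using 1(5) 2(5)[unfolded swap] by linarith
  then have "fb (x + s *\<^sub>R b + t *\<^sub>R c) c = fc (x + s' *\<^sub>R c + t' *\<^sub>R b) b"
    using h by simp
  moreover have "dist (fb (x + s *\<^sub>R b + t *\<^sub>R c) c) (fb x c) < \<epsilon>" "dist (fc (x + s' *\<^sub>R c + t' *\<^sub>R b) b) (fc x b) < \<epsilon>"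
    using near 1 near' 2 d' by blast+
  ultimately show False
    using dist_triangle_half_r[of _ "fb x c" "dist (fb x c) (fc x b)" "fc x b"]
    by (simp add: \<epsilon>_def dist_real_def)
qed

section \<open>Derivatives of compactly supported functions integrate to zero\<close>

lemma has_derivative_zero_outside:
  fixes F :: "'a::real_normed_vector \<Rightarrow> 'b::real_normed_vector"
  assumes "(F has_derivative F') (at x)" "closed K" "\<And>x. x \<notin> K \<Longrightarrow> F x = 0" "x \<notin> K"
  shows "F' = (\<lambda>_. 0)"
proof -
  have "(F has_derivative (\<lambda>_. 0)) (at x)"
    by (rule has_derivative_transform_within_open[where s="-K" and f="\<lambda>_. 0"])
       (use assms in auto)
  then show ?thesis using assms(1) has_derivative_unique by blast
qed

text \<open>By translation invariance of Lebesgue measure every difference quotient in direction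
  \<open>b\<close> has integral zero, and dominated convergence passes to the derivative. No
  iterated integrals are involved.\<close>

lemma integral_directional_derivative_compact_support:
  fixes F :: "'a::euclidean_space \<Rightarrow> real"
  assumes F: "\<And>x. (F has_derivative F' x) (at x)"
    and cont: "continuous_on UNIV (\<lambda>x. F' x b)"
    and K: "compact K" "\<And>x. x \<notin> K \<Longrightarrow> F x = 0"
  shows "integrable lborel (\<lambda>x. F' x b)" "(LINT x|lborel. F' x b) = 0"
proof -
  have zero: "F' x b = 0" if "x \<notin> K" for x
    using has_derivative_zero_outside[OF F compact_imp_closed[OF K(1)] K(2) that] by simp
  have "F' x b = indicator K x *\<^sub>R F' x b" for x
    using zero by (auto simp: indicator_def)
  then have "(\<lambda>x. F' x b) = (\<lambda>x. indicator K x *\<^sub>R F' x b)" by blast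
  then show int: "integrable lborel (\<lambda>x. F' x b)"
    using borel_integrable_compact[OF K(1) continuous_on_subset[OF cont subset_UNIV]] by metis
  obtain M where M: "\<And>x. \<bar>F' x b\<bar> \<le> M"
  proof -
    have "bounded ((\<lambda>x. F' x b) ` K)"
      by (intro compact_imp_bounded compact_continuous_image continuous_on_subset[OF cont] K) auto
    then obtain M where M: "M > 0" "\<And>x. x \<in> K \<Longrightarrow> \<bar>F' x b\<bar> \<le> M"
      by (auto simp: bounded_pos)
    show ?thesis
      by (rule that[of M]) (metis M abs_zero less_eq_real_def zero)
  qed
  have contF: "continuous_on UNIV F"
    using has_derivative_continuous[OF F] by (simp add: continuous_on_eq_continuous_within)
  have intF: "integrable lborel F"
  proof -
    have "F = (\<lambda>x. indicator K x *\<^sub>R F x)" using K(2) by (auto simp: indicator_def fun_eq_iff)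
    then show ?thesis
      using borel_integrable_compact[OF K(1) continuous_on_subset[OF contF subset_UNIV]] by metis
  qed
  have meas: "F \<in> borel_measurable borel"
    using contF by (rule borel_measurable_continuous_onI)
  have shift: "integrable lborel (\<lambda>x. F (t + x))" "(LINT x|lborel. F (t + x)) = (LINT x|lborel. F x)" for t
  proof -
    have *: "lborel = distr lborel borel ((+) t)" by (rule lborel_distr_plus[symmetric])
    show "(LINT x|lborel. F (t + x)) = (LINT x|lborel. F x)"
      by (subst (2) *) (use meas in \<open>simp add: integral_distr\<close>)
    show "integrable lborel (\<lambda>x. F (t + x))"
      using intF meas by (subst (asm) *) (simp add: integrable_distr_eq)
  qed
  define g where "g n x = (F (x + inverse (real (Suc n)) *\<^sub>R b) - F x) * real (Suc n)" for n x
  \<comment> \<open>\<open>K\<close> swept backwards along \<open>b\<close> for times in [0, 1]: a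
    compact set outside which every difference quotient \<open>g n\<close> vanishes, hence the
    support of the dominating function.\<close>
  define K' where "K' = (\<lambda>(x, t). x - t *\<^sub>R b) ` (K \<times> {0..1::real})"
  have K': "compact K'"
    unfolding K'_def by (intro compact_continuous_image compact_Times K)
      (auto intro!: continuous_intros simp: case_prod_unfold)
  have K'I: "x \<in> K'" if "x + t *\<^sub>R b \<in> K" "0 \<le> t" "t \<le> 1" for x t
    unfolding K'_def using that by (auto intro!: image_eqI[of _ _ "(x + t *\<^sub>R b, t)"])
  have line: "((\<lambda>s. F (y + s *\<^sub>R b)) has_real_derivative F' (y + s *\<^sub>R b) b) (at s)" for y s
    by (rule has_real_derivative_along_line[OF F])
  have lim: "(\<lambda>n. g n x) \<longlonglongrightarrow> F' x b" for x
  proof -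
    have "((\<lambda>t. (F (x + t *\<^sub>R b) - F x) / t) \<longlongrightarrow> F' x b) (at 0)"
      using line[of x 0] by (simp add: has_field_derivative_iff)
    moreover have "filterlim (\<lambda>n. inverse (real (Suc n))) (at 0) sequentially"
      unfolding filterlim_at using LIMSEQ_inverse_real_of_nat by auto
    ultimately have "(\<lambda>n. (F (x + inverse (real (Suc n)) *\<^sub>R b) - F x) / inverse (real (Suc n))) \<longlonglongrightarrow> F' x b"
      by (rule filterlim_compose)
    then show ?thesis by (simp add: g_def field_simps)
  qed
  have bound: "norm (g n x) \<le> indicator K' x * M" for n x
  proof (cases "x \<in> K'")
    case True
    let ?t = "inverse (real (Suc n))"
    obtain z where "F (x + ?t *\<^sub>R b) - F (x + 0 *\<^sub>R b) = (?t - 0) * F' (x + z *\<^sub>R b) b"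
      using MVT2[of 0 ?t "\<lambda>s. F (x + s *\<^sub>R b)" "\<lambda>s. F' (x + s *\<^sub>R b) b"] line by auto
    then have "g n x = F' (x + z *\<^sub>R b) b" by (simp add: g_def)
    then show ?thesis using M True by simp
  next
    case False
    have "inverse (real (Suc n)) \<le> 1" by (simp add: field_simps)
    then have "x + inverse (real (Suc n)) *\<^sub>R b \<notin> K" "x \<notin> K"
      using False K'I[of x 0] K'I[of x "inverse (real (Suc n))"] by auto
    then show ?thesis using False K(2) by (simp add: g_def)
  qed
  have "(\<lambda>n. LINT x|lborel. g n x) \<longlonglongrightarrow> (LINT x|lborel. F' x b)"
  proof (rule integral_dominated_convergence[where w="\<lambda>x. indicator K' x * M"])
    show "(\<lambda>x. F' x b) \<in> borel_measurable lborel" using int by simp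
    show "g n \<in> borel_measurable lborel" for n unfolding g_def using meas by measurable
    show "integrable lborel (\<lambda>x. indicator K' x * M)"
      using borel_integrable_compact[OF K', of "\<lambda>_. M"] by simp
  qed (use lim bound in auto)
  moreover have "(LINT x|lborel. g n x) = 0" for n
    unfolding g_def using shift[of "inverse (real (Suc n)) *\<^sub>R b"] intF
    by (simp add: add.commute)
  ultimately show "(LINT x|lborel. F' x b) = 0"
    by (simp add: LIMSEQ_const_iff)
qed

subsection \<open>Continuously differentiable maps\<close>

text \<open>Continuity is required for each fixed direction \<open>v\<close>. The class C1 is the
  working regularity since the cut-off functions used later are built from the squared positive
  part, which is C1 but not C2.\<close>

definition C1_on :: "'a::euclidean_space set \<Rightarrow> ('a \<Rightarrow> 'b::real_normed_vector) \<Rightarrow> bool" where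
  "C1_on S f \<longleftrightarrow> (\<forall>x\<in>S. f differentiable (at x)) \<and> (\<forall>v. continuous_on S (\<lambda>x. frechet_derivative f (at x) v))"

lemma C1_onI:
  assumes "\<And>x. x \<in> S \<Longrightarrow> (f has_derivative f' x) (at x)" "\<And>v. continuous_on S (\<lambda>x. f' x v)"
  shows "C1_on S f"
proof -
  have "frechet_derivative f (at x) = f' x" if "x \<in> S" for x
    using frechet_derivative_at[OF assms(1)[OF that]] by simp
  then show ?thesis
    unfolding C1_on_def using assms by (auto simp: differentiable_def cong: continuous_on_cong)
qed

lemma C1_on_has_derivative:
  "C1_on S f \<Longrightarrow> x \<in> S \<Longrightarrow> (f has_derivative frechet_derivative f (at x)) (at x)"
  by (simp add: C1_on_def frechet_derivative_works)

lemma C1_on_linear: "C1_on S f \<Longrightarrow> x \<in> S \<Longrightarrow> linear (frechet_derivative f (at x))"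
  using C1_on_has_derivative has_derivative_linear by blast

lemma C1_on_continuous_derivative:
  "C1_on S f \<Longrightarrow> continuous_on S (\<lambda>x. frechet_derivative f (at x) v)"
  by (simp add: C1_on_def)

lemma C1_on_continuous: "C1_on S f \<Longrightarrow> continuous_on S f"
  by (meson C1_on_has_derivative continuous_at_imp_continuous_on has_derivative_continuous)

lemma C1_on_subset: "C1_on S f \<Longrightarrow> T \<subseteq> S \<Longrightarrow> C1_on T f"
  unfolding C1_on_def by (meson continuous_on_subset subsetD)

lemma C1_on_cong:
  assumes "open S" "\<And>x. x \<in> S \<Longrightarrow> f x = g x" "C1_on S f"
  shows "C1_on S g"
proof (rule C1_onI)
  show "(g has_derivative frechet_derivative f (at x)) (at x)" if "x \<in> S" for x
    by (rule has_derivative_transform_within_open[OF C1_on_has_derivative[OF assms(3) that] assms(1) that assms(2)])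
qed (use assms C1_on_def in blast)

lemma C1_on_Un:
  assumes "open S" "open T" "C1_on S f" "C1_on T f"
  shows "C1_on (S \<union> T) f"
  using assms unfolding C1_on_def by (auto intro: continuous_on_open_Un)

lemma linear_expand:
  fixes f :: "'a::euclidean_space \<Rightarrow> 'b::real_vector"
  assumes "linear f"
  shows "f v = (\<Sum>b\<in>Basis. (v \<bullet> b) *\<^sub>R f b)"
proof -
  have "f v = f (\<Sum>b\<in>Basis. (v \<bullet> b) *\<^sub>R b)" by (simp add: euclidean_representation)
  then show ?thesis using assms by (simp add: linear_sum linear_scale)
qed

lemma Ck_on_1_imp_C1_on:
  assumes "Ck_on (Suc 0) S f"
  shows "C1_on S f"
proof -
  have diff: "f differentiable (at x)" if "x \<in> S" for x using assms that by simp
  then have "linear (frechet_derivative f (at x))" if "x \<in> S" for x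
    using that by (simp add: linear_frechet_derivative)
  then have eq: "frechet_derivative f (at x) v = (\<Sum>b\<in>Basis. (v \<bullet> b) *\<^sub>R frechet_derivative f (at x) b)"
    if "x \<in> S" for x v using that linear_expand by blast
  have "continuous_on S (\<lambda>x. \<Sum>b\<in>Basis. (v \<bullet> b) *\<^sub>R frechet_derivative f (at x) b)" for v
    using assms by (intro continuous_intros) auto
  then have "continuous_on S (\<lambda>x. frechet_derivative f (at x) v)" for v
    by (subst continuous_on_cong[OF refl eq])
  then show ?thesis using diff by (simp add: C1_on_def)
qed

lemma smooth_on_C1: "smooth_on S f \<Longrightarrow> C1_on S f"
  unfolding smooth_on_def by (blast intro: Ck_on_1_imp_C1_on)

lemma smooth_on_derivative_C1:
  assumes "smooth_on S f" "b \<in> Basis"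
  shows "C1_on S (\<lambda>x. frechet_derivative f (at x) b)"
proof (rule Ck_on_1_imp_C1_on)
  have "Ck_on (Suc (Suc 0)) S f" using assms(1) unfolding smooth_on_def by blast
  then show "Ck_on (Suc 0) S (\<lambda>x. frechet_derivative f (at x) b)"
    using assms(2) unfolding Ck_on.simps(2)[of "Suc 0"] by blast
qed

lemma C1_on_const: "C1_on S (\<lambda>_. c)"
  by (rule C1_onI[where f'="\<lambda>_ _. 0"]) auto

lemma C1_on_bounded_linear:
  assumes "bounded_linear L" "C1_on S f"
  shows "C1_on S (\<lambda>x. L (f x))"
  by (rule C1_onI[OF bounded_linear.has_derivative[OF assms(1) C1_on_has_derivative[OF assms(2)]]])
     (auto intro!: bounded_linear.continuous_on[OF assms(1)] C1_on_continuous_derivative[OF assms(2)])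

lemma C1_on_add:
  assumes "C1_on S f" "C1_on S g" shows "C1_on S (\<lambda>x. f x + g x)"
  by (rule C1_onI[OF has_derivative_add[OF C1_on_has_derivative[OF assms(1)] C1_on_has_derivative[OF assms(2)]]])
     (use assms in \<open>auto intro!: continuous_intros C1_on_continuous_derivative\<close>)

lemma C1_on_bounded_bilinear:
  assumes "bounded_bilinear p" "C1_on S f" "C1_on S g"
  shows "C1_on S (\<lambda>x. p (f x) (g x))"
  by (rule C1_onI[OF bounded_bilinear.FDERIV[OF assms(1) C1_on_has_derivative[OF assms(2)] C1_on_has_derivative[OF assms(3)]]])
     (assumption+, intro continuous_on_add bounded_bilinear.continuous_on[OF assms(1)] C1_on_continuous_derivative
        C1_on_continuous[OF assms(2)] C1_on_continuous[OF assms(3)] assms)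

lemmas C1_on_mult = C1_on_bounded_bilinear[OF bounded_bilinear_mult]
lemmas C1_on_inner = C1_on_bounded_bilinear[OF bounded_bilinear_inner]

lemma C1_on_diff:
  assumes "C1_on S f" "C1_on S g" shows "C1_on S (\<lambda>x. f x - g x)"
  by (rule C1_onI[OF has_derivative_diff[OF C1_on_has_derivative[OF assms(1)] C1_on_has_derivative[OF assms(2)]]])
     (use assms in \<open>auto intro!: continuous_intros C1_on_continuous_derivative\<close>)

lemma C1_on_sum:
  assumes "\<And>i. i \<in> I \<Longrightarrow> C1_on S (f i)"
  shows "C1_on S (\<lambda>x. \<Sum>i\<in>I. f i x)"
  using assms by (induction I rule: infinite_finite_induct) (auto intro: C1_on_const C1_on_add)

lemma C1_on_compose:
  fixes f :: "'a::euclidean_space \<Rightarrow> 'b::euclidean_space"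
  assumes f: "C1_on S f" and g: "C1_on T g" and im: "f ` S \<subseteq> T"
  shows "C1_on S (\<lambda>x. g (f x))"
proof (rule C1_onI)
  fix x assume x: "x \<in> S"
  show "((\<lambda>x. g (f x)) has_derivative (\<lambda>v. frechet_derivative g (at (f x)) (frechet_derivative f (at x) v))) (at x)"
    using diff_chain_at[OF C1_on_has_derivative[OF f x] C1_on_has_derivative[OF g]] x im by (auto simp: o_def)
next
  fix v
  \<comment> \<open>The direction fed to the derivative of \<open>g\<close> varies with
    \<open>x\<close>, whereas \<open>C1_on\<close> speaks of fixed directions; expanding in a basis
    reduces one to the other.\<close>
  have "frechet_derivative g (at (f x)) (frechet_derivative f (at x) v)
      = (\<Sum>b\<in>Basis. (frechet_derivative f (at x) v \<bullet> b) *\<^sub>R frechet_derivative g (at (f x)) b)" if "x \<in> S" for x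
    by (rule linear_expand[OF C1_on_linear[OF g]]) (use that im in auto)
  moreover have "continuous_on S (\<lambda>x. \<Sum>b\<in>Basis. (frechet_derivative f (at x) v \<bullet> b) *\<^sub>R frechet_derivative g (at (f x)) b)"
    by (intro continuous_intros C1_on_continuous_derivative[OF f]
        continuous_on_compose2[OF C1_on_continuous_derivative[OF g] C1_on_continuous[OF f] im])
  ultimately show "continuous_on S (\<lambda>x. frechet_derivative g (at (f x)) (frechet_derivative f (at x) v))"
    by (subst continuous_on_cong[OF refl]) auto
qed

lemma C1_on_inverse:
  fixes f :: "'a::euclidean_space \<Rightarrow> real"
  assumes f: "C1_on S f" and nz: "\<And>x. x \<in> S \<Longrightarrow> f x \<noteq> 0"
  shows "C1_on S (\<lambda>x. inverse (f x))"
  by (rule C1_onI[OF Deriv.has_derivative_inverse[OF nz C1_on_has_derivative[OF f]]])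
     (use nz in \<open>auto intro!: continuous_intros C1_on_continuous[OF f] C1_on_continuous_derivative[OF f]\<close>)

lemma C1_on_divide:
  fixes f g :: "'a::euclidean_space \<Rightarrow> real"
  assumes "C1_on S f" "C1_on S g" "\<And>x. x \<in> S \<Longrightarrow> g x \<noteq> 0"
  shows "C1_on S (\<lambda>x. f x / g x)"
  unfolding divide_inverse by (intro C1_on_mult C1_on_inverse assms)

lemma smooth_on_symmetric:
  fixes f :: "'a::euclidean_space \<Rightarrow> 'b::euclidean_space"
  assumes S: "open S" "x \<in> S" and f: "smooth_on S f" and bc: "b \<in> Basis" "c \<in> Basis"
  shows "frechet_derivative (\<lambda>y. frechet_derivative f (at y) b) (at x) c
       = frechet_derivative (\<lambda>y. frechet_derivative f (at y) c) (at x) b"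
proof (rule euclidean_eqI)
  fix d :: 'b assume "d \<in> Basis"
  note C1 = smooth_on_derivative_C1[OF f]
  show "frechet_derivative (\<lambda>y. frechet_derivative f (at y) b) (at x) c \<bullet> d
       = frechet_derivative (\<lambda>y. frechet_derivative f (at y) c) (at x) b \<bullet> d"
    by (rule second_derivative_symmetric[OF S,
          where f="\<lambda>y. f y \<bullet> d" and f'="\<lambda>y v. frechet_derivative f (at y) v \<bullet> d"])
       (auto intro!: has_derivative_inner_left C1_on_has_derivative[OF smooth_on_C1[OF f]]
          C1_on_has_derivative[OF C1] continuous_intros C1_on_continuous_derivative[OF C1] bc)
qed

subsection \<open>Calculus on the hypersurface\<close>

locale hypersurface =
  fixes \<A> :: "'m::{t2_space,second_countable_topology} param set" and X N :: "'m \<Rightarrow> real^4"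
  assumes hyp: "oriented_hypersurface \<A> X N"
begin

section \<open>Charts, transition maps and the differential\<close>

definition C1_map :: "('m \<Rightarrow> 'b::real_normed_vector) \<Rightarrow> bool" where
  "C1_map f \<longleftrightarrow> (\<forall>(U, \<phi>)\<in>\<A>. C1_on U (f \<circ> \<phi>))"

lemma C1_mapD: "C1_map f \<Longrightarrow> (U, \<phi>) \<in> \<A> \<Longrightarrow> C1_on U (f \<circ> \<phi>)"
  unfolding C1_map_def by auto

lemma smooth_map_C1: "smooth_map \<A> f \<Longrightarrow> C1_map f"
  unfolding smooth_map_def C1_map_def using smooth_on_C1 by blast

lemma smooth_XN: "smooth_map \<A> X" "smooth_map \<A> N"
  using hyp unfolding oriented_hypersurface_def immersion_def unit_normal_def by blast+

lemma C1_XN: "C1_map X" "C1_map N"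
  using smooth_XN smooth_map_C1 by blast+

lemma smooth_chart: 
  assumes "(U, \<phi>) \<in> \<A>" shows "smooth_on U (X \<circ> \<phi>)" "smooth_on U (N \<circ> \<phi>)"
  using smooth_XN assms unfolding smooth_map_def by auto

lemma atlas: "smooth_atlas \<A>"
  using hyp unfolding oriented_hypersurface_def by blast

lemma chart_open: assumes "(U, \<phi>) \<in> \<A>" shows "open U" "open (\<phi> ` U)"
  using atlas assms unfolding smooth_atlas_def by auto

lemma chart_homeomorphism: "(U, \<phi>) \<in> \<A> \<Longrightarrow> homeomorphism U (\<phi> ` U) \<phi> (inv_into U \<phi>)"
  using atlas unfolding smooth_atlas_def by auto

lemma chart_continuous: assumes "(U, \<phi>) \<in> \<A>"
  shows "continuous_on U \<phi>" "continuous_on (\<phi> ` U) (inv_into U \<phi>)"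
  using chart_homeomorphism[OF assms] unfolding homeomorphism_def by auto

lemma chart_inv: "(U, \<phi>) \<in> \<A> \<Longrightarrow> u \<in> U \<Longrightarrow> inv_into U \<phi> (\<phi> u) = u"
  using chart_homeomorphism unfolding homeomorphism_def by blast

lemma chart_inj: "(U, \<phi>) \<in> \<A> \<Longrightarrow> inj_on \<phi> U"
  using chart_inv by (metis inj_onI)

lemma chart_cover: obtains U \<phi> u where "(U, \<phi>) \<in> \<A>" "u \<in> U" "\<phi> u = p"
proof -
  have "p \<in> (\<Union>(U, \<phi>)\<in>\<A>. \<phi> ` U)" using atlas unfolding smooth_atlas_def by simp
  then show ?thesis using that by auto
qed

lemma chart_immersion: "(U, \<phi>) \<in> \<A> \<Longrightarrow> u \<in> U \<Longrightarrow> inj (frechet_derivative (X \<circ> \<phi>) (at u))"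
  using hyp unfolding oriented_hypersurface_def immersion_def by auto

lemma chart_open_preimage:
  assumes "(U, \<phi>) \<in> \<A>" "open S"
  shows "open (U \<inter> \<phi> -` S)"
  using continuous_on_open_vimage[OF chart_open(1)[OF assms(1)]] chart_continuous(1)[OF assms(1)] assms(2)
  by (metis Int_commute)

lemma transition:
  assumes "(U, \<phi>) \<in> \<A>" "(V, \<psi>) \<in> \<A>"
  shows "open (U \<inter> \<phi> -` (\<psi> ` V))" "C1_on (U \<inter> \<phi> -` (\<psi> ` V)) (inv_into V \<psi> \<circ> \<phi>)"
    "(inv_into V \<psi> \<circ> \<phi>) ` (U \<inter> \<phi> -` (\<psi> ` V)) \<subseteq> V"
    "u \<in> U \<inter> \<phi> -` (\<psi> ` V) \<Longrightarrow> \<psi> ((inv_into V \<psi> \<circ> \<phi>) u) = \<phi> u"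
proof -
  show "open (U \<inter> \<phi> -` (\<psi> ` V))"
    by (rule chart_open_preimage[OF assms(1) chart_open(2)[OF assms(2)]])
  show "C1_on (U \<inter> \<phi> -` (\<psi> ` V)) (inv_into V \<psi> \<circ> \<phi>)"
    by (rule smooth_on_C1) (use atlas assms in \<open>unfold smooth_atlas_def, fast\<close>)
qed (auto simp: inv_into_into f_inv_into_f)

lemma transition_derivative:
  fixes f :: "'m \<Rightarrow> 'b::real_normed_vector"
  assumes c: "(U, \<phi>) \<in> \<A>" "(V, \<psi>) \<in> \<A>" and u: "u \<in> U" "v \<in> V" "\<phi> u = \<psi> v" and f: "C1_map f"
  shows "frechet_derivative (f \<circ> \<phi>) (at u)
       = frechet_derivative (f \<circ> \<psi>) (at v) \<circ> frechet_derivative (inv_into V \<psi> \<circ> \<phi>) (at u)"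
proof -
  let ?\<tau> = "inv_into V \<psi> \<circ> \<phi>" and ?O = "U \<inter> \<phi> -` (\<psi> ` V)"
  have uO: "u \<in> ?O" using u by auto
  have \<tau>u: "?\<tau> u = v" using u chart_inv[OF c(2)] by simp
  have L: "(?\<tau> has_derivative frechet_derivative ?\<tau> (at u)) (at u)"
    by (rule C1_on_has_derivative[OF transition(2)[OF c] uO])
  have "(f \<circ> \<psi> has_derivative frechet_derivative (f \<circ> \<psi>) (at v)) (at (?\<tau> u))"
    unfolding \<tau>u by (rule C1_on_has_derivative[OF C1_mapD[OF f c(2)] u(2)])
  from diff_chain_at[OF L this]
  have "(f \<circ> \<phi> has_derivative frechet_derivative (f \<circ> \<psi>) (at v) \<circ> frechet_derivative ?\<tau> (at u)) (at u)"
    by (rule has_derivative_transform_within_open[OF _ transition(1)[OF c] uO])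
       (use transition(4)[OF c] in auto)
  then show ?thesis by (rule frechet_derivative_at[symmetric])
qed

lemma tangent_space_chart:
  assumes c: "(U, \<phi>) \<in> \<A>" "u \<in> U"
  shows "tangent_space \<A> X (\<phi> u) = range (frechet_derivative (X \<circ> \<phi>) (at u))"
proof
  show "range (frechet_derivative (X \<circ> \<phi>) (at u)) \<subseteq> tangent_space \<A> X (\<phi> u)"
    using c unfolding tangent_space_def by blast
  show "tangent_space \<A> X (\<phi> u) \<subseteq> range (frechet_derivative (X \<circ> \<phi>) (at u))"
  proof
    fix w assume "w \<in> tangent_space \<A> X (\<phi> u)"
    then obtain V \<psi> v a where v: "(V, \<psi>) \<in> \<A>" "v \<in> V" "\<psi> v = \<phi> u" "w = frechet_derivative (X \<circ> \<psi>) (at v) a"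
      unfolding tangent_space_def by blast
    show "w \<in> range (frechet_derivative (X \<circ> \<phi>) (at u))"
      unfolding v(4) transition_derivative[OF v(1) c(1) v(2) c(2) v(3) C1_XN(1)] by auto
  qed
qed

text \<open>Shows that the description in \<open>differential\<close> has a unique witness. If two
  chart vectors represent the same tangent vector, injectivity of the derivative of \<open>X\<close>
  makes the transition map carry one to the other, and then the derivatives of \<open>f\<close>
  agree by the chain rule.\<close>

lemma differential_chart:
  fixes f :: "'m \<Rightarrow> 'b::real_normed_vector"
  assumes c: "(U, \<phi>) \<in> \<A>" "u \<in> U" and f: "C1_map f"
  shows "differential \<A> X f (\<phi> u) (frechet_derivative (X \<circ> \<phi>) (at u) v) = frechet_derivative (f \<circ> \<phi>) (at u) v"
  unfolding differential_def
proof (rule the_equality)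
  show "\<exists>U' \<phi>' u' v'. (U', \<phi>') \<in> \<A> \<and> u' \<in> U' \<and> \<phi>' u' = \<phi> u \<and>
      frechet_derivative (X \<circ> \<phi>') (at u') v' = frechet_derivative (X \<circ> \<phi>) (at u) v \<and>
      frechet_derivative (f \<circ> \<phi>') (at u') v' = frechet_derivative (f \<circ> \<phi>) (at u) v"
    using c by blast
  fix y assume "\<exists>U' \<phi>' u' v'. (U', \<phi>') \<in> \<A> \<and> u' \<in> U' \<and> \<phi>' u' = \<phi> u \<and>
      frechet_derivative (X \<circ> \<phi>') (at u') v' = frechet_derivative (X \<circ> \<phi>) (at u) v \<and>
      frechet_derivative (f \<circ> \<phi>') (at u') v' = y"
  then obtain U' \<phi>' u' v' where c': "(U', \<phi>') \<in> \<A>" "u' \<in> U'" "\<phi>' u' = \<phi> u"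
    and X': "frechet_derivative (X \<circ> \<phi>') (at u') v' = frechet_derivative (X \<circ> \<phi>) (at u) v"
    and y: "frechet_derivative (f \<circ> \<phi>') (at u') v' = y" by blast
  note * = transition_derivative[OF c'(1) c(1) c'(2) c(2) c'(3)]
  then show "y = frechet_derivative (f \<circ> \<phi>) (at u) v"
    using X' y chart_immersion[OF c] unfolding *[OF C1_XN(1)] *[OF f] by (auto dest: injD)
qed


section \<open>The tangent hyperplane and the symmetry of the shape operator\<close>

lemma normal_tangent:
  assumes "(U, \<phi>) \<in> \<A>" "u \<in> U"
  shows "N (\<phi> u) \<bullet> frechet_derivative (X \<circ> \<phi>) (at u) v = 0"
  using hyp tangent_space_chart[OF assms] unfolding oriented_hypersurface_def unit_normal_def by auto

lemma normal_unit: "norm (N p) = 1" "N p \<bullet> N p = 1"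
  using hyp unfolding oriented_hypersurface_def unit_normal_def by (auto simp: norm_eq_1)

text \<open>The tangent space is the injective image of 3-space and lies in the hyperplane
  orthogonal to \<open>N\<close>; both have dimension 3, so they coincide.\<close>

lemma tangent_space_props:
  assumes c: "(U, \<phi>) \<in> \<A>" "u \<in> U"
  shows "subspace (tangent_space \<A> X (\<phi> u))" "dim (tangent_space \<A> X (\<phi> u)) = 3"
    "tangent_space \<A> X (\<phi> u) = {w. N (\<phi> u) \<bullet> w = 0}"
proof -
  let ?L = "frechet_derivative (X \<circ> \<phi>) (at u)"
  have lin: "linear ?L" by (rule C1_on_linear[OF C1_mapD[OF C1_XN(1) c(1)] c(2)])
  show sub: "subspace (tangent_space \<A> X (\<phi> u))"
    unfolding tangent_space_chart[OF c] using lin by (simp add: linear_subspace_image)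
  show dim: "dim (tangent_space \<A> X (\<phi> u)) = 3"
    unfolding tangent_space_chart[OF c]
    using dim_image_eq[OF lin, of UNIV] chart_immersion[OF c] by (simp add: inj_on_subset)
  have "N (\<phi> u) \<noteq> 0" using normal_unit(1)[of "\<phi> u"] by auto
  then have "dim {w. N (\<phi> u) \<bullet> w = 0} = 3"
    by (simp add: dim_hyperplane)
  then show "tangent_space \<A> X (\<phi> u) = {w. N (\<phi> u) \<bullet> w = 0}"
    by (intro subspace_dim_equal sub subspace_hyperplane)
       (auto simp: dim[unfolded tangent_space_chart[OF c]] tangent_space_chart[OF c] normal_tangent[OF c])
qed

text \<open>Differentiate the identity that \<open>N\<close> is orthogonal to the coordinate vector
  in direction \<open>b\<close>.\<close>

lemma second_fundamental_form:
  assumes c: "(U, \<phi>) \<in> \<A>" "u \<in> U" and bc: "a \<in> Basis" "b \<in> Basis"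
  shows "frechet_derivative (N \<circ> \<phi>) (at u) a \<bullet> frechet_derivative (X \<circ> \<phi>) (at u) b
       = - (N (\<phi> u) \<bullet> frechet_derivative (\<lambda>u. frechet_derivative (X \<circ> \<phi>) (at u) b) (at u) a)"
proof -
  let ?h = "\<lambda>u. (N \<circ> \<phi>) u \<bullet> frechet_derivative (X \<circ> \<phi>) (at u) b"
  have "(?h has_derivative (\<lambda>a. (N \<circ> \<phi>) u \<bullet> frechet_derivative (\<lambda>u. frechet_derivative (X \<circ> \<phi>) (at u) b) (at u) a
      + frechet_derivative (N \<circ> \<phi>) (at u) a \<bullet> frechet_derivative (X \<circ> \<phi>) (at u) b)) (at u)"
    by (intro bounded_bilinear.FDERIV[OF bounded_bilinear_inner] C1_on_has_derivative[OF C1_mapD[OF C1_XN(2) c(1)] c(2)]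
        C1_on_has_derivative[OF smooth_on_derivative_C1[OF smooth_chart(1)[OF c(1)] bc(2)] c(2)])
  moreover have "(?h has_derivative (\<lambda>_. 0)) (at u)"
    by (rule has_derivative_transform_within_open[OF has_derivative_const[of 0] chart_open(1)[OF c(1)] c(2)])
       (use normal_tangent[OF c(1)] in auto)
  ultimately have "(N \<circ> \<phi>) u \<bullet> frechet_derivative (\<lambda>u. frechet_derivative (X \<circ> \<phi>) (at u) b) (at u) a
      + frechet_derivative (N \<circ> \<phi>) (at u) a \<bullet> frechet_derivative (X \<circ> \<phi>) (at u) b = 0"
    using has_derivative_unique by (metis (no_types, lifting))
  then show ?thesis by simp
qed

lemma normal_derivative_tangent:
  assumes c: "(U, \<phi>) \<in> \<A>" "u \<in> U"
  shows "N (\<phi> u) \<bullet> frechet_derivative (N \<circ> \<phi>) (at u) a = 0"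
proof -
  let ?h = "\<lambda>u. (N \<circ> \<phi>) u \<bullet> (N \<circ> \<phi>) u"
  note d = C1_on_has_derivative[OF C1_mapD[OF C1_XN(2) c(1)] c(2)]
  have "(?h has_derivative (\<lambda>a. (N \<circ> \<phi>) u \<bullet> frechet_derivative (N \<circ> \<phi>) (at u) a
      + frechet_derivative (N \<circ> \<phi>) (at u) a \<bullet> (N \<circ> \<phi>) u)) (at u)"
    by (rule bounded_bilinear.FDERIV[OF bounded_bilinear_inner d d])
  moreover have "?h = (\<lambda>_. 1)" by (simp add: normal_unit)
  ultimately have "((\<lambda>_. 1 :: real) has_derivative (\<lambda>a. (N \<circ> \<phi>) u \<bullet> frechet_derivative (N \<circ> \<phi>) (at u) a
      + frechet_derivative (N \<circ> \<phi>) (at u) a \<bullet> (N \<circ> \<phi>) u)) (at u)" by simp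
  from has_derivative_unique[OF this has_derivative_const]
  have "(N \<circ> \<phi>) u \<bullet> frechet_derivative (N \<circ> \<phi>) (at u) a
      + frechet_derivative (N \<circ> \<phi>) (at u) a \<bullet> (N \<circ> \<phi>) u = 0" by metis
  then show ?thesis by (simp add: inner_commute)
qed

text \<open>On basis vectors both sides equal minus the normal component of a second derivative of
  \<open>X\<close>, and second derivatives commute; bilinearity does the rest.\<close>

lemma weingarten_symmetric:
  assumes c: "(U, \<phi>) \<in> \<A>" "u \<in> U"
  shows "frechet_derivative (N \<circ> \<phi>) (at u) v \<bullet> frechet_derivative (X \<circ> \<phi>) (at u) w
       = frechet_derivative (X \<circ> \<phi>) (at u) v \<bullet> frechet_derivative (N \<circ> \<phi>) (at u) w"
proof -
  let ?DX = "frechet_derivative (X \<circ> \<phi>) (at u)" and ?DN = "frechet_derivative (N \<circ> \<phi>) (at u)"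
  have lin: "linear ?DX" "linear ?DN"
    by (rule C1_on_linear[OF C1_mapD[OF C1_XN(1) c(1)] c(2)], rule C1_on_linear[OF C1_mapD[OF C1_XN(2) c(1)] c(2)])
  have "?DN a \<bullet> ?DX b = ?DX a \<bullet> ?DN b" if "a \<in> Basis" "b \<in> Basis" for a b
    using second_fundamental_form[OF c that] second_fundamental_form[OF c that(2,1)]
      smooth_on_symmetric[OF chart_open(1)[OF c(1)] c(2) smooth_chart(1)[OF c(1)] that]
    by (simp add: inner_commute)
  then show ?thesis
    by (simp add: linear_expand[OF lin(1), of v] linear_expand[OF lin(1), of w]
        linear_expand[OF lin(2), of v] linear_expand[OF lin(2), of w] inner_sum_left inner_sum_right)
qed

text \<open>\<open>differential\<close> is meaningful only on tangent vectors. A left inverse of the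
  derivative of \<open>X\<close> extends it to a linear map of the whole space, to which linear
  algebra applies.\<close>

lemma differential_linear:
  fixes f :: "'m \<Rightarrow> 'b::real_normed_vector"
  assumes f: "C1_map f"
  obtains L where "linear L" "\<And>w. w \<in> tangent_space \<A> X p \<Longrightarrow> differential \<A> X f p w = L w"
proof -
  obtain U \<phi> u where c: "(U, \<phi>) \<in> \<A>" "u \<in> U" and p: "\<phi> u = p" by (rule chart_cover)
  have lin: "linear (frechet_derivative (X \<circ> \<phi>) (at u))" "linear (frechet_derivative (f \<circ> \<phi>) (at u))"
    by (rule C1_on_linear[OF C1_mapD[OF C1_XN(1) c(1)] c(2)], rule C1_on_linear[OF C1_mapD[OF f c(1)] c(2)])
  obtain g where g: "linear g" "g \<circ> frechet_derivative (X \<circ> \<phi>) (at u) = id"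
    using linear_injective_left_inverse[OF lin(1) chart_immersion[OF c]] by blast
  show thesis
  proof (rule that)
    show "linear (frechet_derivative (f \<circ> \<phi>) (at u) \<circ> g)"
      by (rule linear_compose[OF g(1) lin(2)])
    fix w assume "w \<in> tangent_space \<A> X p"
    then obtain v where "w = frechet_derivative (X \<circ> \<phi>) (at u) v"
      using tangent_space_chart[OF c] p by auto
    then show "differential \<A> X f p w = (frechet_derivative (f \<circ> \<phi>) (at u) \<circ> g) w"
      using differential_chart[OF c f] p pointfree_idE[OF g(2)] by simp
  qed
qed

section \<open>Principal frames\<close>

definition principal_frame :: "'m \<Rightarrow> (3 \<Rightarrow> real^4) \<Rightarrow> bool" where
  "principal_frame p e \<longleftrightarrow> (\<forall>i. e i \<in> tangent_space \<A> X p) \<and>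
        (\<forall>i j. e i \<bullet> e j = (if i = j then 1 else 0)) \<and>
        (\<forall>i. shape_operator \<A> X N p (e i) = (principal_curvatures \<A> X N p $ i) *\<^sub>R e i)"

text \<open>The spectral theorem on the tangent space shows that the choice in
  \<open>principal_curvatures\<close> is not vacuous. The frame obtained belongs to precisely the
  curvatures that were chosen, in their chosen order.\<close>

lemma principal_frame_exists: "\<exists>e. principal_frame p e"
proof -
  obtain U \<phi> u where c: "(U, \<phi>) \<in> \<A>" "u \<in> U" and p: "\<phi> u = p" by (rule chart_cover)
  let ?T = "tangent_space \<A> X p"
  obtain L where L: "linear L" "\<And>w. w \<in> ?T \<Longrightarrow> differential \<A> X N p w = L w"
    using differential_linear[OF C1_XN(2)] by metis
  define f where "f w = - L w" for w
  have lin: "linear f" unfolding f_def using L(1) by (simp add: linear_compose_neg)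
  have S: "shape_operator \<A> X N p w = f w" if "w \<in> ?T" for w
    using that L by (simp add: shape_operator_def f_def)
  have f: "f (frechet_derivative (X \<circ> \<phi>) (at u) v) = - frechet_derivative (N \<circ> \<phi>) (at u) v" for v
    using S[of "frechet_derivative (X \<circ> \<phi>) (at u) v"] differential_chart[OF c C1_XN(2), of v] tangent_space_chart[OF c] p
    by (simp add: shape_operator_def)
  have T: "w \<in> ?T \<Longrightarrow> \<exists>v. w = frechet_derivative (X \<circ> \<phi>) (at u) v" for w
    using tangent_space_chart[OF c] p by auto
  have inv: "f w \<in> ?T" if "w \<in> ?T" for w
    using T[OF that] f normal_derivative_tangent[OF c] tangent_space_props(3)[OF c] p by auto
  have self: "f w \<bullet> w' = w \<bullet> f w'" if "w \<in> ?T" "w' \<in> ?T" for w w'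
    using T[OF that(1)] T[OF that(2)] weingarten_symmetric[OF c] by (auto simp: f)
  have sub: "subspace ?T" and dim: "dim ?T = CARD(3)"
    using tangent_space_props[OF c] p by auto
  obtain e k where "\<And>i::3. e i \<in> ?T" "\<And>i j. e i \<bullet> e j = (if i = j then 1 else 0)" "\<And>i. f (e i) = (k $ i) *\<^sub>R e i"
    using orthonormal_eigenframe[OF lin sub inv self dim] by metis
  then have "\<exists>k e. (\<forall>i. e i \<in> ?T) \<and> (\<forall>i j. e i \<bullet> e j = (if i = j then 1 else 0)) \<and>
        (\<forall>i::3. shape_operator \<A> X N p (e i) = (k $ i) *\<^sub>R e i)"
    using S by (intro exI[of _ k] exI[of _ e]) auto
  from someI_ex[OF this] show ?thesis
    unfolding principal_frame_def principal_curvatures_def by blast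
qed


text \<open>Three orthonormal vectors in a space of dimension 3 span it.\<close>

lemma frame_expand:
  assumes e: "principal_frame p e" and w: "w \<in> tangent_space \<A> X p"
  shows "w = (\<Sum>a\<in>UNIV. (w \<bullet> e a) *\<^sub>R e a)"
proof (rule orthonormal_expand)
  show orth: "e i \<bullet> e j = (if i = j then 1 else 0)" for i j
    using e unfolding principal_frame_def by blast
  obtain U \<phi> u where c: "(U, \<phi>) \<in> \<A>" "u \<in> U" and p: "\<phi> u = p" by (rule chart_cover)
  have "inj e" by (rule injI) (metis orth zero_neq_one)
  then have card: "card (range e) = 3" by (simp add: card_image)
  have "pairwise orthogonal (range e)" by (auto simp: pairwise_def orthogonal_def orth)
  moreover have "0 \<notin> range e" using orth by (metis imageE inner_zero_left zero_neq_one)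
  ultimately have ind: "independent (range e)" by (rule pairwise_orthogonal_independent)
  have "range e \<subseteq> tangent_space \<A> X p" using e unfolding principal_frame_def by blast
  from card_eq_dim[OF this] tangent_space_props(2)[OF c] card ind
  have "tangent_space \<A> X p \<subseteq> span (range e)" by (auto simp: p)
  then show "w \<in> span (range e)" using w by blast
qed

lemma shape_operator_frame:
  assumes e: "principal_frame p e" and w: "w \<in> tangent_space \<A> X p"
  shows "shape_operator \<A> X N p w = (\<Sum>a\<in>UNIV. ((w \<bullet> e a) * principal_curvatures \<A> X N p $ a) *\<^sub>R e a)"
proof -
  obtain L where L: "linear L" "\<And>w. w \<in> tangent_space \<A> X p \<Longrightarrow> differential \<A> X N p w = L w"
    using differential_linear[OF C1_XN(2)] by metis
  have eT: "e a \<in> tangent_space \<A> X p" for a using e unfolding principal_frame_def by blast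
  have "shape_operator \<A> X N p w = - L (\<Sum>a\<in>UNIV. (w \<bullet> e a) *\<^sub>R e a)"
    unfolding shape_operator_def frame_expand[OF e w, symmetric] L(2)[OF w] ..
  also have "\<dots> = (\<Sum>a\<in>UNIV. (w \<bullet> e a) *\<^sub>R (- L (e a)))"
    using L(1) by (simp add: linear_sum linear_scale sum_negf)
  also have "\<dots> = (\<Sum>a\<in>UNIV. (w \<bullet> e a) *\<^sub>R (principal_curvatures \<A> X N p $ a *\<^sub>R e a))"
    using e L(2)[OF eT] unfolding principal_frame_def shape_operator_def by simp
  finally show ?thesis by simp
qed

lemma P1_frame:
  assumes e: "principal_frame p e" and w: "w \<in> tangent_space \<A> X p"
  defines "k \<equiv> principal_curvatures \<A> X N p"
  shows "P1 \<A> X N p w = (\<Sum>a\<in>UNIV. ((k$1 + k$2 + k$3 - k$a) * (w \<bullet> e a)) *\<^sub>R e a)"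
proof -
  have "P1 \<A> X N p w = (k$1 + k$2 + k$3) *\<^sub>R w - (\<Sum>a\<in>UNIV. ((w \<bullet> e a) * k $ a) *\<^sub>R e a)"
    unfolding P1_def shape_operator_frame[OF e w] mean_curvature_def by (simp add: Let_def k_def)
  also have "\<dots> = (k$1 + k$2 + k$3) *\<^sub>R (\<Sum>a\<in>UNIV. (w \<bullet> e a) *\<^sub>R e a) - (\<Sum>a\<in>UNIV. ((w \<bullet> e a) * k $ a) *\<^sub>R e a)"
    unfolding frame_expand[OF e w, symmetric] ..
  finally show ?thesis
    unfolding scaleR_sum_right sum_subtractf[symmetric]
    by (simp add: left_diff_distrib right_diff_distrib scaleR_left_diff_distrib mult.commute)
qed

lemma differential_frame:
  assumes e: "principal_frame p e" and f: "C1_map f" and w: "w \<in> tangent_space \<A> X p"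
  shows "differential \<A> X f p w = (\<Sum>a\<in>UNIV. (w \<bullet> e a) *\<^sub>R differential \<A> X f p (e a))"
proof -
  obtain L where L: "linear L" "\<And>w. w \<in> tangent_space \<A> X p \<Longrightarrow> differential \<A> X f p w = L w"
    using differential_linear[OF f] by metis
  have eT: "e a \<in> tangent_space \<A> X p" for a using e unfolding principal_frame_def by blast
  have "L w = L (\<Sum>a\<in>UNIV. (w \<bullet> e a) *\<^sub>R e a)" unfolding frame_expand[OF e w, symmetric] ..
  then show ?thesis
    using L(1) by (simp add: L(2)[OF w] L(2)[OF eT] linear_sum linear_scale)
qed

lemma gradient_frame:
  assumes e: "principal_frame p e" and f: "C1_map f"
  shows "gradient \<A> X f p = (\<Sum>a\<in>UNIV. differential \<A> X f p (e a) *\<^sub>R e a)"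
  unfolding gradient_def
proof (rule the_equality)
  have eT: "e a \<in> tangent_space \<A> X p" for a using e unfolding principal_frame_def by blast
  obtain U \<phi> u where c: "(U, \<phi>) \<in> \<A>" "u \<in> U" and p: "\<phi> u = p" by (rule chart_cover)
  have sub: "subspace (tangent_space \<A> X p)" using tangent_space_props(1)[OF c] p by simp
  let ?G = "\<Sum>a\<in>UNIV. differential \<A> X f p (e a) *\<^sub>R e a"
  show G: "?G \<in> tangent_space \<A> X p \<and> (\<forall>w\<in>tangent_space \<A> X p. ?G \<bullet> w = differential \<A> X f p w)"
    using differential_frame[OF e f]
    by (auto intro!: subspace_sum subspace_scale sub eT simp: inner_sum_left inner_sum_right mult.commute inner_commute)
  fix G assume G': "G \<in> tangent_space \<A> X p \<and> (\<forall>w\<in>tangent_space \<A> X p. G \<bullet> w = differential \<A> X f p w)"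
  then have d: "G - ?G \<in> tangent_space \<A> X p" using G sub by (blast intro: subspace_diff)
  then have "(G - ?G) \<bullet> (G - ?G) = 0"
    using bspec[OF conjunct2[OF G] d] bspec[OF conjunct2[OF G'] d] by (simp only: inner_diff_left[of G])
  then show "G = ?G" by simp
qed

lemma gradient_tangent: "C1_map f \<Longrightarrow> gradient \<A> X f p \<in> tangent_space \<A> X p"
proof -
  assume f: "C1_map f"
  obtain e where e: "principal_frame p e" using principal_frame_exists by blast
  obtain U \<phi> u where c: "(U, \<phi>) \<in> \<A>" "u \<in> U" and p: "\<phi> u = p" by (rule chart_cover)
  have sub: "subspace (tangent_space \<A> X p)" using tangent_space_props(1)[OF c] p by simp
  have eT: "e a \<in> tangent_space \<A> X p" for a using e unfolding principal_frame_def by blast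
  show ?thesis
    unfolding gradient_frame[OF e f] by (intro subspace_sum subspace_scale sub eT)
qed

section \<open>Curvatures and gradients as determinants in coordinates\<close>

definition pd :: "('m \<Rightarrow> 'b::real_normed_vector) \<Rightarrow> (real^3 \<Rightarrow> 'm) \<Rightarrow> real^3 \<Rightarrow> 3 \<Rightarrow> 'b" where
  "pd f \<phi> u i = frechet_derivative (f \<circ> \<phi>) (at u) (axis i 1)"

text \<open>The signed volume density. Its sign compares the chart with the orientation given by
  \<open>N\<close>; unlike the square root of the Gram determinant it is polynomial in
  \<open>N\<close> and the first derivatives of \<open>X\<close>.\<close>

definition jac :: "(real^3 \<Rightarrow> 'm) \<Rightarrow> real^3 \<Rightarrow> real" where
  "jac \<phi> u = det4 (pd X \<phi> u 1) (N (\<phi> u)) (pd X \<phi> u 2) (pd X \<phi> u 3)"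

lemma pd_differential:
  assumes c: "(U, \<phi>) \<in> \<A>" "u \<in> U" and f: "C1_map f"
  shows "pd f \<phi> u i = differential \<A> X f (\<phi> u) (pd X \<phi> u i)"
  unfolding pd_def differential_chart[OF c f] ..

lemma pd_tangent:
  assumes c: "(U, \<phi>) \<in> \<A>" "u \<in> U"
  shows "pd X \<phi> u i \<in> tangent_space \<A> X (\<phi> u)"
  unfolding pd_def tangent_space_chart[OF c] by blast

lemma principal_adapted_frame:
  assumes c: "(U, \<phi>) \<in> \<A>" "u \<in> U" and e: "principal_frame (\<phi> u) e"
  shows "adapted_frame e (pd X \<phi> u) (pd N \<phi> u) (N (\<phi> u)) (principal_curvatures \<A> X N (\<phi> u))"
proof
  show "e i \<bullet> e j = (if i = j then 1 else 0)" for i j using e unfolding principal_frame_def by blast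
  show "N (\<phi> u) \<bullet> N (\<phi> u) = 1" by (rule normal_unit)
  have "e i \<in> tangent_space \<A> X (\<phi> u)" for i using e unfolding principal_frame_def by blast
  then show "N (\<phi> u) \<bullet> e i = 0" for i using tangent_space_props(3)[OF c] by blast
  show "pd X \<phi> u i = (\<Sum>a\<in>UNIV. (pd X \<phi> u i \<bullet> e a) *\<^sub>R e a)" for i
    by (rule frame_expand[OF e pd_tangent[OF c]])
  show "pd N \<phi> u i = - (\<Sum>a\<in>UNIV. ((pd X \<phi> u i \<bullet> e a) * principal_curvatures \<A> X N (\<phi> u) $ a) *\<^sub>R e a)" for i
    unfolding pd_differential[OF c C1_XN(2)] shape_operator_frame[OF e pd_tangent[OF c], symmetric]
    by (simp add: shape_operator_def)
qed

lemma jac_gram: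
  assumes c: "(U, \<phi>) \<in> \<A>" "u \<in> U"
  shows "jac \<phi> u \<noteq> 0" "det (gram_matrix X \<phi> u) = (jac \<phi> u)\<^sup>2"
proof -
  obtain e where e: "principal_frame (\<phi> u) e" using principal_frame_exists by blast
  interpret adapted_frame e "pd X \<phi> u" "pd N \<phi> u" "N (\<phi> u)" "principal_curvatures \<A> X N (\<phi> u)"
    by (rule principal_adapted_frame[OF c e])
  have D: "D = jac \<phi> u" by (simp add: D_def jac_def)
  show "det (gram_matrix X \<phi> u) = (jac \<phi> u)\<^sup>2"
    using det_gram by (simp add: D gram_matrix_def pd_def)
  have "e a \<in> range (frechet_derivative (X \<circ> \<phi>) (at u))" for a
    using e tangent_space_chart[OF c] unfolding principal_frame_def by blast
  then obtain v where v: "\<And>a. e a = frechet_derivative (X \<circ> \<phi>) (at u) (v a)" by (auto simp: image_iff) metis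
  have "e a = (\<Sum>i\<in>UNIV. (\<chi> a i. v a $ i)$a$i *\<^sub>R pd X \<phi> u i)" for a
  proof -
    have lin: "linear (frechet_derivative (X \<circ> \<phi>) (at u))"
      by (rule C1_on_linear[OF C1_mapD[OF C1_XN(1) c(1)] c(2)])
    have "v a = (\<Sum>i\<in>UNIV. v a $ i *\<^sub>R axis i 1)"
      using basis_expansion[of "v a"] by (simp add: scalar_mult_eq_scaleR)
    then have "frechet_derivative (X \<circ> \<phi>) (at u) (v a) = frechet_derivative (X \<circ> \<phi>) (at u) (\<Sum>i\<in>UNIV. v a $ i *\<^sub>R axis i 1)"
      by (rule arg_cong)
    then show ?thesis using lin by (simp add: v pd_def linear_sum linear_scale)
  qed
  from D_nonzero[OF this] show "jac \<phi> u \<noteq> 0" unfolding D .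
qed

text \<open>A principal frame is used in the proofs and has dropped out of the results: the left
  sides involve only \<open>X\<close>, \<open>N\<close> and their first derivatives. Thus curvatures
  defined by a pointwise choice become continuous functions, and the second formula carries the
  condition R = 0 into the divergence theorem.\<close>

lemma curvature_formulas:
  assumes c: "(U, \<phi>) \<in> \<A>" "u \<in> U"
  shows "alternate (\<lambda>i j l. det4 (pd X \<phi> u i) (N (\<phi> u)) (pd X \<phi> u j) (pd N \<phi> u l))
      = - 6 * jac \<phi> u * mean_curvature \<A> X N (\<phi> u)"
    "scalar_curvature \<A> X N (\<phi> u) = 0 \<Longrightarrow>
      alternate (\<lambda>i j l. det4 Y (pd N \<phi> u i) (pd X \<phi> u j) (pd N \<phi> u l)) = 0"
    "det4 (pd N \<phi> u 1) (N (\<phi> u)) (pd N \<phi> u 2) (pd N \<phi> u 3)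
      = - gauss_kronecker_curvature \<A> X N (\<phi> u) * jac \<phi> u"
proof -
  obtain e where e: "principal_frame (\<phi> u) e" using principal_frame_exists by blast
  interpret adapted_frame e "pd X \<phi> u" "pd N \<phi> u" "N (\<phi> u)" "principal_curvatures \<A> X N (\<phi> u)"
    by (rule principal_adapted_frame[OF c e])
  have D: "D = jac \<phi> u" by (simp add: D_def jac_def)
  show "alternate (\<lambda>i j l. det4 (pd X \<phi> u i) (N (\<phi> u)) (pd X \<phi> u j) (pd N \<phi> u l))
      = - 6 * jac \<phi> u * mean_curvature \<A> X N (\<phi> u)"
    unfolding alternate_trace D mean_curvature_def by (simp add: Let_def)
  show "alternate (\<lambda>i j l. det4 Y (pd N \<phi> u i) (pd X \<phi> u j) (pd N \<phi> u l)) = 0"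
    if "scalar_curvature \<A> X N (\<phi> u) = 0"
    using that unfolding alternate_second scalar_curvature_def by (simp add: Let_def)
  show "det4 (pd N \<phi> u 1) (N (\<phi> u)) (pd N \<phi> u 2) (pd N \<phi> u 3)
      = - gauss_kronecker_curvature \<A> X N (\<phi> u) * jac \<phi> u"
    unfolding det4_gauss_map D gauss_kronecker_curvature_def by (simp add: Let_def)
qed

text \<open>\<open>Y\<close> is any vector of 4-space, not only a tangent one, so that
  \<open>Y\<close> can be the position vector and the formulas can be read componentwise.\<close>

lemma gradient_formulas:
  assumes c: "(U, \<phi>) \<in> \<A>" "u \<in> U" and h: "C1_map h"
  shows "alternate (\<lambda>i j l. pd h \<phi> u i * det4 Y (N (\<phi> u)) (pd X \<phi> u j) (pd N \<phi> u l))
      = - jac \<phi> u * (P1 \<A> X N (\<phi> u) (gradient \<A> X h (\<phi> u)) \<bullet> Y)"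
    "alternate (\<lambda>i j l. pd h \<phi> u i * det4 Y (N (\<phi> u)) (pd X \<phi> u j) (pd X \<phi> u l))
      = 2 * jac \<phi> u * (gradient \<A> X h (\<phi> u) \<bullet> Y)"
proof -
  obtain e where e: "principal_frame (\<phi> u) e" using principal_frame_exists by blast
  interpret adapted_frame e "pd X \<phi> u" "pd N \<phi> u" "N (\<phi> u)" "principal_curvatures \<A> X N (\<phi> u)"
    by (rule principal_adapted_frame[OF c e])
  have D: "D = jac \<phi> u" by (simp add: D_def jac_def)
  have pd: "pd h \<phi> u i = (\<Sum>a\<in>UNIV. (pd X \<phi> u i \<bullet> e a) * differential \<A> X h (\<phi> u) (e a))" for i
    using differential_frame[OF e h pd_tangent[OF c]] pd_differential[OF c h] by simp
  have g: "gradient \<A> X h (\<phi> u) \<bullet> e a = differential \<A> X h (\<phi> u) (e a)" for a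
    unfolding gradient_frame[OF e h] by (simp add: inner_sum_left orthonormal if_distrib cong: if_cong)
  show "alternate (\<lambda>i j l. pd h \<phi> u i * det4 Y (N (\<phi> u)) (pd X \<phi> u j) (pd N \<phi> u l))
      = - jac \<phi> u * (P1 \<A> X N (\<phi> u) (gradient \<A> X h (\<phi> u)) \<bullet> Y)"
    unfolding alternate_newton[OF pd] D P1_frame[OF e gradient_tangent[OF h]] g
    by (simp add: inner_sum_left inner_sum_right inner_commute mult_ac)
  show "alternate (\<lambda>i j l. pd h \<phi> u i * det4 Y (N (\<phi> u)) (pd X \<phi> u j) (pd X \<phi> u l))
      = 2 * jac \<phi> u * (gradient \<A> X h (\<phi> u) \<bullet> Y)"
    unfolding alternate_gradient[OF pd] D gradient_frame[OF e h]
    by (simp add: inner_sum_left inner_sum_right inner_commute mult_ac)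
qed

section \<open>Algebra of the operator \<open>P1\<close> on tangent vectors\<close>

lemma P1_symmetric:
  assumes "v \<in> tangent_space \<A> X p" "w \<in> tangent_space \<A> X p"
  shows "P1 \<A> X N p v \<bullet> w = P1 \<A> X N p w \<bullet> v"
proof -
  obtain e where e: "principal_frame p e" using principal_frame_exists by blast
  show ?thesis
    unfolding P1_frame[OF e assms(1)] P1_frame[OF e assms(2)] by (simp add: inner_sum_left inner_sum_right inner_commute mult_ac)
qed

lemma P1_add_scale:
  assumes "v \<in> tangent_space \<A> X p" "w \<in> tangent_space \<A> X p"
  shows "P1 \<A> X N p (a *\<^sub>R v + b *\<^sub>R w) = a *\<^sub>R P1 \<A> X N p v + b *\<^sub>R P1 \<A> X N p w"
proof -
  obtain e where e: "principal_frame p e" using principal_frame_exists by blast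
  obtain U \<phi> u where c: "(U, \<phi>) \<in> \<A>" "u \<in> U" and p: "\<phi> u = p" by (rule chart_cover)
  have sub: "subspace (tangent_space \<A> X p)" using tangent_space_props(1)[OF c] p by simp
  have vw: "a *\<^sub>R v + b *\<^sub>R w \<in> tangent_space \<A> X p"
    by (intro subspace_add subspace_scale sub assms)
  show ?thesis
    unfolding P1_frame[OF e assms(1)] P1_frame[OF e assms(2)] P1_frame[OF e vw]
    unfolding scaleR_sum_right sum.distrib[symmetric] inner_add_left inner_scaleR_left
    by (rule sum.cong[OF refl]) (simp add: scaleR_left_distrib distrib_left mult.left_commute)
qed

text \<open>When \<open>R = 0\<close>, \<open>(k\<^sub>1 + k\<^sub>2 + k\<^sub>3)\<^sup>2 = k\<^sub>1\<^sup>2 + k\<^sub>2\<^sup>2 + k\<^sub>3\<^sup>2\<close>, so no principal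
  curvature exceeds their sum in absolute value.\<close>

lemma P1_semidefinite:
  assumes R: "scalar_curvature \<A> X N p = 0" and w: "w \<in> tangent_space \<A> X p"
  shows "mean_curvature \<A> X N p * (P1 \<A> X N p w \<bullet> w) \<ge> 0"
proof -
  obtain e where e: "principal_frame p e" using principal_frame_exists by blast
  define k where "k = principal_curvatures \<A> X N p"
  define s where "s = k$1 + k$2 + k$3"
  have "s\<^sup>2 = (k$1)\<^sup>2 + (k$2)\<^sup>2 + (k$3)\<^sup>2"
    using R unfolding scalar_curvature_def k_def s_def Let_def by (simp add: power2_eq_square algebra_simps)
  then have "(k$a)\<^sup>2 \<le> s\<^sup>2" for a
    using exhaust_3[of a] by auto
  then have "\<bar>k$a\<bar> \<le> \<bar>s\<bar>" for a by (simp add: abs_le_square_iff)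
  then have *: "s * (s - k$a) \<ge> 0" for a
    by (smt (verit) zero_le_mult_iff)
  have H: "mean_curvature \<A> X N p = s / 3" unfolding mean_curvature_def s_def k_def Let_def ..
  have "P1 \<A> X N p w \<bullet> w = (\<Sum>a\<in>UNIV. (s - k$a) * (w \<bullet> e a)\<^sup>2)"
    unfolding P1_frame[OF e w] s_def[symmetric] k_def[symmetric] inner_sum_left inner_scaleR_left
    by (rule sum.cong[OF refl]) (simp add: inner_commute[of "e _"] power2_eq_square)
  then have "mean_curvature \<A> X N p * (P1 \<A> X N p w \<bullet> w) = (\<Sum>a\<in>UNIV. (s * (s - k$a)) * (w \<bullet> e a)\<^sup>2) / 3"
    by (simp add: H sum_distrib_left mult_ac)
  also have "\<dots> \<ge> 0" by (intro divide_nonneg_nonneg sum_nonneg mult_nonneg_nonneg *) auto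
  finally show ?thesis .
qed

end

subsection \<open>The volume measure\<close>

text \<open>The change of variables formula for measures of images applies where the Jacobian is
  integrable. A general Borel set is exhausted by bounded pieces on which the Jacobian is
  bounded.\<close>

lemma emeasure_C1_image:
  fixes \<tau> :: "real^'n::{finite,wellorder} \<Rightarrow> real^'n::_"
  assumes S: "open S" and \<tau>: "C1_on S \<tau>" "inj_on \<tau> S" and B: "B \<in> sets borel" "B \<subseteq> S"
  shows "emeasure lebesgue (\<tau> ` B) =
    emeasure (density lborel (\<lambda>x. indicator S x * ennreal \<bar>det (matrix (frechet_derivative \<tau> (at x)))\<bar>)) B"
    and "\<tau> ` B \<in> sets lebesgue"
proof -
  define J where "J x = \<bar>det (matrix (frechet_derivative \<tau> (at x)))\<bar>" for x
  have "continuous_on S J"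
    unfolding J_def det_def matrix_def
    by (intro continuous_intros) (auto intro!: continuous_intros C1_on_continuous_derivative[OF \<tau>(1)])
  then have J': "(\<lambda>x. indicator S x *\<^sub>R J x) \<in> borel_measurable borel"
    using S by (intro borel_measurable_continuous_on_indicator) auto
  define M where "M = density lborel (\<lambda>x. ennreal (indicator S x *\<^sub>R J x))"
  have M_eq: "M = density lborel (\<lambda>x. indicator S x * ennreal (J x))"
    unfolding M_def by (rule arg_cong[of _ _ "density lborel"]) (auto simp: indicator_def)
  \<comment> \<open>The n-th piece lies in the ball of radius n, and the Jacobian is at most n
    there.\<close>
  define B' where "B' n = B \<inter> {x. indicator S x *\<^sub>R J x \<le> real n} \<inter> cball 0 (real n)" for n
  have B'_borel: "B' n \<in> sets borel" for n
    unfolding B'_def using B(1) J' by measurable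
  have B'_sub: "B' n \<subseteq> S" for n using B(2) by (auto simp: B'_def)
  have inc: "incseq B'"
    by (auto simp: B'_def incseq_def intro: order_trans)
  have UN: "(\<Union>n. B' n) = B"
  proof -
    have "\<exists>n. x \<in> B' n" if x: "x \<in> B" for x
    proof -
      obtain n1 n2 where n: "indicator S x *\<^sub>R J x \<le> real n1" "norm x \<le> real n2" 
        using real_arch_simple by metis
      then have "indicator S x *\<^sub>R J x \<le> real (max n1 n2)" "norm x \<le> real (max n1 n2)"
        by (simp_all add: max_def split: if_splits)
      then show ?thesis using x by (auto simp: B'_def)
    qed
    then show ?thesis by (auto simp: B'_def)
  qed
  have step: "\<tau> ` B' n \<in> lmeasurable \<and> emeasure lebesgue (\<tau> ` B' n) = emeasure M (B' n)" for n
  proof -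
    let ?f = "\<lambda>x. indicator (B' n) x *\<^sub>R (indicator S x *\<^sub>R J x)"
    have int: "integrable lborel ?f"
    proof (rule Bochner_Integration.integrable_bound[where f="\<lambda>x. indicator (B' n) x *\<^sub>R real n"])
      have "bounded (B' n)" unfolding B'_def by (simp add: bounded_Int)
      then have "emeasure lborel (B' n) < \<infinity>" by (rule emeasure_bounded_finite)
      then show "integrable lborel (\<lambda>x. indicator (B' n) x *\<^sub>R real n)"
        using B'_borel by (intro integrable_scaleR_left) (simp add: integrable_indicator_iff)
      show "?f \<in> borel_measurable lborel" using B'_borel J' by measurable
      show "AE x in lborel. norm (?f x) \<le> norm (indicator (B' n) x *\<^sub>R real n)"
        by (auto simp: B'_def indicator_def J_def)
    qed
    define m where "m = (LINT x|lborel. ?f x)"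
    have fJ: "?f x = (if x \<in> B' n then J x else 0)" for x
      using B'_sub by (auto simp: indicator_def)
    have "(?f has_integral m) UNIV" unfolding m_def by (rule has_integral_integral_lborel[OF int])
    then have "(J has_integral m) (B' n)"
      unfolding fJ by (simp add: has_integral_restrict_UNIV)
    moreover have "(\<tau> has_derivative frechet_derivative \<tau> (at x)) (at x within B' n)" if "x \<in> B' n" for x
      by (rule has_derivative_at_withinI[OF C1_on_has_derivative[OF \<tau>(1)]]) (use that B'_sub in auto)
    moreover have "B' n \<in> sets lebesgue" using B'_borel by simp
    ultimately have im: "\<tau> ` B' n \<in> lmeasurable" "measure lebesgue (\<tau> ` B' n) = m"
      using has_measure_differentiable_image[of "B' n" \<tau> "\<lambda>x. frechet_derivative \<tau> (at x)" m]
        inj_on_subset[OF \<tau>(2) B'_sub]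
      unfolding J_def by auto
    have "emeasure M (B' n) = (\<integral>\<^sup>+x. ennreal (?f x) \<partial>lborel)"
      unfolding M_def using J' B'_borel
      by (subst emeasure_density) (auto intro!: nn_integral_cong simp: indicator_def)
    also have "\<dots> = ennreal m"
      unfolding m_def by (rule nn_integral_eq_integral[OF int]) (auto simp: J_def)
    finally show ?thesis
      using im by (auto simp: emeasure_eq_measure2)
  qed
  have im_UN: "\<tau> ` B = (\<Union>n. \<tau> ` B' n)" using UN by blast
  show "\<tau> ` B \<in> sets lebesgue" unfolding im_UN using step by (auto simp: fmeasurable_def)
  have "emeasure lebesgue (\<tau> ` B) = (SUP n. emeasure lebesgue (\<tau> ` B' n))"
    unfolding im_UN using inc step
    by (intro SUP_emeasure_incseq[symmetric]) (auto simp: incseq_def fmeasurable_def)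
  also have "\<dots> = (SUP n. emeasure M (B' n))" using step by simp
  also have "\<dots> = emeasure M (\<Union>n. B' n)"
    using inc B'_borel by (intro SUP_emeasure_incseq) (auto simp: M_def)
  finally show "emeasure lebesgue (\<tau> ` B) =
      emeasure (density lborel (\<lambda>x. indicator S x * ennreal \<bar>det (matrix (frechet_derivative \<tau> (at x)))\<bar>)) B"
    unfolding UN M_eq J_def .
qed

lemma nn_integral_C1_image:
  fixes \<tau> :: "real^'n::{finite,wellorder} \<Rightarrow> real^'n::_"
  assumes S: "open S" and \<tau>: "C1_on S \<tau>" "inj_on \<tau> S" "\<tau> ` S \<in> sets borel"
    and B: "B \<in> sets borel" "B \<subseteq> S" "\<tau> ` B \<in> sets borel" and h: "(\<lambda>y. indicator (\<tau> ` B) y * h y) \<in> borel_measurable borel"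
  shows "(\<integral>\<^sup>+y. indicator (\<tau> ` B) y * h y \<partial>lborel)
    = (\<integral>\<^sup>+x. indicator B x * (ennreal \<bar>det (matrix (frechet_derivative \<tau> (at x)))\<bar> * h (\<tau> x)) \<partial>lborel)"
proof -
  define J where "J x = \<bar>det (matrix (frechet_derivative \<tau> (at x)))\<bar>" for x
  have "continuous_on S J"
    unfolding J_def det_def matrix_def
    by (intro continuous_intros) (auto intro!: continuous_intros C1_on_continuous_derivative[OF \<tau>(1)])
  then have "(\<lambda>x. ennreal (indicator S x *\<^sub>R J x)) \<in> borel_measurable borel"
    using S by (intro measurable_compose[OF _ measurable_ennreal] borel_measurable_continuous_on_indicator) auto
  moreover have "(\<lambda>x. ennreal (indicator S x *\<^sub>R J x)) = (\<lambda>x. indicator S x * ennreal (J x))"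
    by (auto simp: indicator_def)
  ultimately have J': "(\<lambda>x. indicator S x * ennreal (J x)) \<in> borel_measurable borel" by simp
  define M where "M = density lborel (\<lambda>x. indicator S x * ennreal (J x))"
  \<comment> \<open>A total Borel map that agrees with \<open>\<tau>\<close> on \<open>S\<close>;
    its values elsewhere have weight zero in \<open>M\<close>.\<close>
  define t where "t x = (if x \<in> S then \<tau> x else 0)" for x
  have t: "t \<in> borel_measurable borel"
    unfolding t_def using S C1_on_continuous[OF \<tau>(1)]
    by (intro borel_measurable_continuous_on_if) auto
  have distr: "distr M borel t = density lborel (indicator (\<tau> ` S))"
  proof (rule measure_eqI)
    fix A assume "A \<in> sets (distr M borel t)"
    then have A: "A \<in> sets borel" by simp
    have meas: "t -` A \<in> sets borel" using measurable_sets_borel[OF t A] by simp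
    have eq: "S \<inter> \<tau> -` A = S \<inter> t -` A" by (auto simp: t_def)
    have SA: "S \<inter> \<tau> -` A \<in> sets borel" unfolding eq using S meas by auto
    have "emeasure (distr M borel t) A = emeasure M (t -` A)"
      using A t by (subst emeasure_distr) (auto simp: M_def)
    also have "\<dots> = emeasure M (S \<inter> \<tau> -` A)"
      unfolding M_def using J' meas SA
      by (simp add: emeasure_density) (rule nn_integral_cong, auto simp: indicator_def t_def)
    also have "\<dots> = emeasure lebesgue (\<tau> ` (S \<inter> \<tau> -` A))"
      unfolding M_def J_def by (rule emeasure_C1_image(1)[OF S \<tau>(1,2) SA, symmetric]) auto
    also have "\<tau> ` (S \<inter> \<tau> -` A) = A \<inter> \<tau> ` S" by auto
    also have "emeasure lebesgue (A \<inter> \<tau> ` S) = emeasure lborel (A \<inter> \<tau> ` S)"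
      using A \<tau>(3) by simp
    also have "\<dots> = emeasure (density lborel (indicator (\<tau> ` S))) A"
      using A \<tau>(3) by (simp add: emeasure_density indicator_inter_arith[symmetric] Int_commute)
    finally show "emeasure (distr M borel t) A = emeasure (density lborel (indicator (\<tau> ` S))) A" .
  qed simp
  have "(\<integral>\<^sup>+y. indicator (\<tau> ` B) y * h y \<partial>lborel) = (\<integral>\<^sup>+y. indicator (\<tau> ` B) y * h y \<partial>density lborel (indicator (\<tau> ` S)))"
  proof -
    have "indicator (\<tau> ` S) y * (indicator (\<tau> ` B) y * h y) = indicator (\<tau> ` B) y * h y" for y
      by (cases "y \<in> \<tau> ` B") (use B(2) in auto)
    then show ?thesis using h \<tau>(3) by (subst nn_integral_density) auto
  qed
  also have "\<dots> = (\<integral>\<^sup>+x. indicator (\<tau> ` B) (t x) * h (t x) \<partial>M)"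
    unfolding distr[symmetric] using h t by (intro nn_integral_distr) (auto simp: M_def)
  also have "\<dots> = (\<integral>\<^sup>+x. (indicator S x * ennreal (J x)) * (indicator (\<tau> ` B) (t x) * h (t x)) \<partial>lborel)"
    unfolding M_def using J' measurable_compose[OF t h] by (intro nn_integral_density) auto
  also have "\<dots> = (\<integral>\<^sup>+x. indicator B x * (ennreal (J x) * h (\<tau> x)) \<partial>lborel)"
    using B(2) \<tau>(2) by (intro nn_integral_cong) (auto simp: indicator_def t_def inj_on_def subset_eq)
  finally show ?thesis unfolding J_def .
qed

lemma image_Int_vimage: "S \<subseteq> f ` U \<Longrightarrow> f ` (U \<inter> f -` S) = S"
  by blast

context hypersurface
begin

section \<open>Volume densities and their independence of the chart\<close>

definition vol_density :: "(real^3 \<Rightarrow> 'm) \<Rightarrow> real^3 \<Rightarrow> real" where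
  "vol_density \<phi> u = sqrt (det (gram_matrix X \<phi> u))"

lemma vol_density_jac: "(U, \<phi>) \<in> \<A> \<Longrightarrow> u \<in> U \<Longrightarrow> vol_density \<phi> u = \<bar>jac \<phi> u\<bar>"
  by (simp add: vol_density_def jac_gram)

lemma vol_density_pos: "(U, \<phi>) \<in> \<A> \<Longrightarrow> u \<in> U \<Longrightarrow> vol_density \<phi> u > 0"
  by (simp add: vol_density_jac jac_gram)

lemma pd_continuous:
  assumes "C1_map f" "(U, \<phi>) \<in> \<A>"
  shows "continuous_on U (\<lambda>u. pd f \<phi> u i)"
  unfolding pd_def by (rule C1_on_continuous_derivative[OF C1_mapD[OF assms]])

lemma continuous_on_det4:
  assumes "continuous_on S a" "continuous_on S b" "continuous_on S c" "continuous_on S d"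
  shows "continuous_on S (\<lambda>x. det4 (a x) (b x) (c x) (d x))"
  unfolding det4_def by (intro continuous_intros assms)

lemma C1_map_continuous: "C1_map f \<Longrightarrow> (U, \<phi>) \<in> \<A> \<Longrightarrow> continuous_on U (\<lambda>u. f (\<phi> u))"
  using C1_on_continuous[OF C1_mapD] by (simp add: o_def)

lemma jac_continuous: "(U, \<phi>) \<in> \<A> \<Longrightarrow> continuous_on U (jac \<phi>)"
  unfolding jac_def by (intro continuous_on_det4 pd_continuous C1_map_continuous C1_XN)

lemma vol_density_continuous:
  assumes c: "(U, \<phi>) \<in> \<A>" shows "continuous_on U (vol_density \<phi>)"
proof -
  have "continuous_on U (\<lambda>u. \<bar>jac \<phi> u\<bar>)" by (intro continuous_on_rabs jac_continuous c)
  then show ?thesis by (simp add: vol_density_jac[OF c] cong: continuous_on_cong)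
qed

lemma vol_density_measurable:
  assumes "(U, \<phi>) \<in> \<A>"
  shows "(\<lambda>u. indicator U u * ennreal (vol_density \<phi> u)) \<in> borel_measurable borel"
proof -
  have "(\<lambda>x. ennreal (indicator U x *\<^sub>R vol_density \<phi> x)) \<in> borel_measurable borel"
    using chart_open(1)[OF assms] vol_density_continuous[OF assms]
    by (intro measurable_compose[OF _ measurable_ennreal] borel_measurable_continuous_on_indicator) auto
  moreover have "(\<lambda>x. ennreal (indicator U x *\<^sub>R vol_density \<phi> x)) = (\<lambda>u. indicator U u * ennreal (vol_density \<phi> u))"
    by (auto simp: indicator_def)
  ultimately show ?thesis by simp
qed

lemma chart_measurable:
  assumes "(U, \<phi>) \<in> \<A>"
  shows "(\<lambda>u. if u \<in> U then \<phi> u else p) \<in> borel_measurable borel"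
  using chart_open(1)[OF assms] chart_continuous(1)[OF assms]
  by (intro borel_measurable_continuous_on_if) auto

lemma chart_preimage_borel:
  assumes "(U, \<phi>) \<in> \<A>" "E \<in> sets borel"
  shows "U \<inter> \<phi> -` E \<in> sets borel"
proof -
  have "U \<inter> \<phi> -` E = U \<inter> (\<lambda>u. if u \<in> U then \<phi> u else undefined) -` E" by auto
  then show ?thesis
    using measurable_sets_borel[OF chart_measurable[OF assms(1)] assms(2)] chart_open(1)[OF assms(1)] by auto
qed

lemma chart_image_borel:
  assumes c: "(U, \<phi>) \<in> \<A>" and B: "B \<in> sets borel" "B \<subseteq> U"
  shows "\<phi> ` B \<in> sets borel"
proof -
  let ?g = "\<lambda>p. if p \<in> \<phi> ` U then inv_into U \<phi> p else 0"
  have "?g \<in> borel_measurable borel"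
    using chart_open(2)[OF c] chart_continuous(2)[OF c] by (intro borel_measurable_continuous_on_if) auto
  from measurable_sets_borel[OF this B(1)] have "\<phi> ` U \<inter> ?g -` B \<in> sets borel"
    using chart_open(2)[OF c] by auto
  moreover have "\<phi> ` U \<inter> ?g -` B = \<phi> ` B"
    using B(2) chart_inv[OF c] by (auto simp: subset_eq)
  ultimately show ?thesis by simp
qed

text \<open>Only the part of \<open>E\<close> inside the chart image is counted, which makes this a
  countably additive function of all Borel sets.\<close>

definition chart_measure :: "(real^3) set \<Rightarrow> (real^3 \<Rightarrow> 'm) \<Rightarrow> 'm set \<Rightarrow> ennreal" where
  "chart_measure U \<phi> E = (\<integral>\<^sup>+u. indicator E (\<phi> u) * (indicator U u * ennreal (vol_density \<phi> u)) \<partial>lborel)"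

lemma chart_measure_measurable:
  assumes c: "(U, \<phi>) \<in> \<A>" and E: "E \<in> sets borel"
  shows "(\<lambda>u. indicator E (\<phi> u) * (indicator U u * ennreal (vol_density \<phi> u))) \<in> borel_measurable borel"
proof -
  have "(\<lambda>u. indicator (U \<inter> \<phi> -` E) u * (indicator U u * ennreal (vol_density \<phi> u))) \<in> borel_measurable borel"
    using chart_preimage_borel[OF c E] vol_density_measurable[OF c] by measurable
  moreover have "(\<lambda>u. indicator (U \<inter> \<phi> -` E) u * (indicator U u * ennreal (vol_density \<phi> u)))
    = (\<lambda>u. indicator E (\<phi> u) * (indicator U u * ennreal (vol_density \<phi> u)))"
    by (auto simp: indicator_def)
  ultimately show ?thesis by metis
qed

lemma chart_measure_countably_additive:
  fixes E :: "nat \<Rightarrow> 'm set"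
  assumes c: "(U, \<phi>) \<in> \<A>" and E: "\<And>i. E i \<in> sets borel" "disjoint_family E"
  shows "(\<Sum>i. chart_measure U \<phi> (E i)) = chart_measure U \<phi> (\<Union>i. E i)"
proof -
  have "(\<Sum>i. chart_measure U \<phi> (E i))
      = (\<integral>\<^sup>+u. (\<Sum>i. indicator (E i) (\<phi> u) * (indicator U u * ennreal (vol_density \<phi> u))) \<partial>lborel)"
    unfolding chart_measure_def using chart_measure_measurable[OF c E(1)]
    by (intro nn_integral_suminf[symmetric]) auto
  also have "\<dots> = chart_measure U \<phi> (\<Union>i. E i)"
    unfolding chart_measure_def by (simp add: suminf_indicator[OF E(2)])
  finally show ?thesis .
qed

text \<open>The normal is the same in both charts, so only the three coordinate vectors change, by
  the transpose of the Jacobian matrix of the transition map.\<close>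

lemma jac_transition:
  assumes c: "(U, \<phi>) \<in> \<A>" "(V, \<psi>) \<in> \<A>" and u: "u \<in> U" "\<phi> u \<in> \<psi> ` V"
  defines "\<tau> \<equiv> inv_into V \<psi> \<circ> \<phi>"
  shows "jac \<phi> u = det (matrix (frechet_derivative \<tau> (at u))) * jac \<psi> (\<tau> u)"
proof -
  have v: "\<tau> u \<in> V" "\<phi> u = \<psi> (\<tau> u)"
    using u by (auto simp: \<tau>_def inv_into_into f_inv_into_f)
  let ?M = "transpose (matrix (frechet_derivative \<tau> (at u)))"
  have lin: "linear (frechet_derivative (X \<circ> \<psi>) (at (\<tau> u)))"
    by (rule C1_on_linear[OF C1_mapD[OF C1_XN(1) c(2)] v(1)])
  have pd: "pd X \<phi> u i = (\<Sum>a\<in>UNIV. ?M$i$a *\<^sub>R pd X \<psi> (\<tau> u) a)" for i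
  proof -
    let ?w = "frechet_derivative \<tau> (at u) (axis i 1)"
    have "pd X \<phi> u i = frechet_derivative (X \<circ> \<psi>) (at (\<tau> u)) ?w"
      unfolding pd_def using transition_derivative[OF c u(1) v C1_XN(1)] by (simp add: \<tau>_def)
    also have "?w = (\<Sum>a\<in>UNIV. ?w $ a *\<^sub>R axis a 1)"
      using basis_expansion[of ?w] by (simp add: scalar_mult_eq_scaleR)
    also have "frechet_derivative (X \<circ> \<psi>) (at (\<tau> u)) \<dots> = (\<Sum>a\<in>UNIV. ?w $ a *\<^sub>R pd X \<psi> (\<tau> u) a)"
      using lin by (simp add: linear_sum linear_scale pd_def)
    finally show ?thesis by (simp add: transpose_def matrix_def)
  qed
  have "6 * jac \<phi> u = alternate (\<lambda>i j k. det4 (pd X \<phi> u i) (N (\<phi> u)) (pd X \<phi> u j) (pd X \<phi> u k))"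
    unfolding alternate_det4 jac_def ..
  also have "\<dots> = det ?M * alternate (\<lambda>i j k. det4 (pd X \<psi> (\<tau> u) i) (N (\<phi> u)) (pd X \<psi> (\<tau> u) j) (pd X \<psi> (\<tau> u) k))"
    by (rule alternate_change) (simp only: pd sum_3, simp add: det4_linear algebra_simps)
  also have "\<dots> = 6 * (det ?M * jac \<psi> (\<tau> u))"
    unfolding alternate_det4 jac_def v(2) by simp
  finally show ?thesis by (simp add: det_transpose)
qed

text \<open>The factor picked up by \<open>jac\<close> under the transition map is, in absolute
  value, the Jacobian factor of the change of variables. This is the compatibility that lets chart
  measures be glued.\<close>

lemma chart_measure_overlap:
  assumes c: "(U, \<phi>) \<in> \<A>" "(V, \<psi>) \<in> \<A>" and E: "E \<in> sets borel" "E \<subseteq> \<phi> ` U" "E \<subseteq> \<psi> ` V"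
  shows "chart_measure U \<phi> E = chart_measure V \<psi> E"
proof -
  define \<tau> where "\<tau> = inv_into V \<psi> \<circ> \<phi>"
  let ?O = "U \<inter> \<phi> -` (\<psi> ` V)" and ?B = "U \<inter> \<phi> -` E"
  have im: "\<tau> ` (U \<inter> \<phi> -` F) = V \<inter> \<psi> -` F" if "F \<subseteq> \<phi> ` U" "F \<subseteq> \<psi> ` V" for F
  proof
    show "\<tau> ` (U \<inter> \<phi> -` F) \<subseteq> V \<inter> \<psi> -` F"
    proof
      fix v assume "v \<in> \<tau> ` (U \<inter> \<phi> -` F)"
      then obtain u where u: "u \<in> U" "\<phi> u \<in> F" "v = \<tau> u" by blast
      then have "\<phi> u \<in> \<psi> ` V" using that(2) by blast
      then show "v \<in> V \<inter> \<psi> -` F" using u by (simp add: \<tau>_def inv_into_into f_inv_into_f)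
    qed
    show "V \<inter> \<psi> -` F \<subseteq> \<tau> ` (U \<inter> \<phi> -` F)"
    proof
      fix v assume v: "v \<in> V \<inter> \<psi> -` F"
      then have "\<psi> v \<in> \<phi> ` U" using that(1) by blast
      then obtain u where u: "u \<in> U" "\<phi> u = \<psi> v" by (metis imageE)
      then have "\<tau> u = v" using v chart_inv[OF c(2)] by (simp add: \<tau>_def)
      moreover have "u \<in> U \<inter> \<phi> -` F" using u v by simp
      ultimately show "v \<in> \<tau> ` (U \<inter> \<phi> -` F)" by blast
    qed
  qed
  have "?O = U \<inter> \<phi> -` (\<phi> ` U \<inter> \<psi> ` V)" by auto
  then have "\<tau> ` ?O = V \<inter> \<psi> -` (\<phi> ` U \<inter> \<psi> ` V)"
    by (simp only: im[OF Int_lower1 Int_lower2])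
  also have "\<dots> = V \<inter> \<psi> -` (\<phi> ` U)" by auto
  finally have imO: "\<tau> ` ?O = V \<inter> \<psi> -` (\<phi> ` U)" .
  have inj: "inj_on \<tau> ?O"
  proof (rule inj_onI)
    fix x y assume xy: "x \<in> ?O" "y \<in> ?O" "\<tau> x = \<tau> y"
    have "\<phi> x = \<psi> (\<tau> x)" "\<phi> y = \<psi> (\<tau> y)"
      unfolding \<tau>_def by (rule transition(4)[OF c xy(1), symmetric], rule transition(4)[OF c xy(2), symmetric])
    then have "\<phi> x = \<phi> y" by (simp only: xy(3))
    from inj_onD[OF chart_inj[OF c(1)] this] show "x = y" using xy(1,2) by blast
  qed
  have imB: "\<tau> ` ?B = V \<inter> \<psi> -` E" by (rule im[OF E(2,3)])
  have B: "?B \<in> sets borel" "?B \<subseteq> ?O" "\<tau> ` ?B \<in> sets borel"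
    using chart_preimage_borel[OF _ E(1)] c E unfolding imB by auto
  have O: "open ?O" "C1_on ?O \<tau>" "\<tau> ` ?O \<in> sets borel"
    using transition(1,2)[OF c] chart_preimage_borel[OF c(2) borel_open[OF chart_open(2)[OF c(1)]]]
    unfolding imO \<tau>_def[symmetric] by simp_all
  have ind: "indicator F (\<phi> u) * (indicator U u * ennreal (vol_density \<phi> u)) = indicator (U \<inter> \<phi> -` F) u * ennreal (vol_density \<phi> u)" for U \<phi> u F
    by (auto simp: indicator_def)
  have meas: "(\<lambda>y. indicator (\<tau> ` ?B) y * ennreal (vol_density \<psi> y)) \<in> borel_measurable borel"
    using chart_measure_measurable[OF c(2) E(1)] unfolding imB ind .
  have "chart_measure V \<psi> E = (\<integral>\<^sup>+y. indicator (\<tau> ` ?B) y * ennreal (vol_density \<psi> y) \<partial>lborel)"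
    unfolding chart_measure_def imB ind ..
  also have "\<dots> = (\<integral>\<^sup>+x. indicator ?B x * (ennreal \<bar>det (matrix (frechet_derivative \<tau> (at x)))\<bar> * ennreal (vol_density \<psi> (\<tau> x))) \<partial>lborel)"
    by (rule nn_integral_C1_image[OF O(1,2) inj O(3) B meas])
  also have "\<dots> = (\<integral>\<^sup>+x. indicator ?B x * ennreal (vol_density \<phi> x) \<partial>lborel)"
  proof (rule nn_integral_cong)
    fix x
    have "ennreal \<bar>det (matrix (frechet_derivative \<tau> (at x)))\<bar> * ennreal (vol_density \<psi> (\<tau> x)) = ennreal (vol_density \<phi> x)" if x: "x \<in> ?B"
    proof -
      have x': "x \<in> U" "\<phi> x \<in> \<psi> ` V" "\<tau> x \<in> V"
        using x E(3) by (auto simp: \<tau>_def intro!: inv_into_into)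
      show ?thesis
        using jac_transition[OF c x'(1,2)] x'
        unfolding \<tau>_def[symmetric]
        by (simp add: vol_density_jac[OF c(1)] vol_density_jac[OF c(2)] ennreal_mult[symmetric] abs_mult)
    qed
    then show "indicator ?B x * (ennreal \<bar>det (matrix (frechet_derivative \<tau> (at x)))\<bar> * ennreal (vol_density \<psi> (\<tau> x))) = indicator ?B x * ennreal (vol_density \<phi> x)"
      by (cases "x \<in> ?B") (simp_all only: indicator_simps mult_1_left mult_zero_left not_False_eq_True)
  qed
  also have "\<dots> = chart_measure U \<phi> E"
    unfolding chart_measure_def ind ..
  finally show ?thesis by simp
qed

section \<open>Existence and uniqueness of the volume measure\<close>

lemma countable_atlas:
  obtains C :: "nat \<Rightarrow> 'm param" where "range C \<subseteq> \<A>" "(\<Union>n. snd (C n) ` fst (C n)) = UNIV"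
proof -
  let ?im = "\<lambda>c::'m param. snd c ` fst c"
  \<comment> \<open>Second countability, through Lindelof's theorem, reduces an arbitrary atlas to
    countably many charts, as countable additivity requires.\<close>
  obtain F where F: "F \<subseteq> ?im ` \<A>" "countable F" "\<Union>F = \<Union>(?im ` \<A>)"
    by (rule Lindelof[of "?im ` \<A>"]) (use chart_open(2) in auto)
  have cov: "\<Union>(?im ` \<A>) = UNIV"
  proof (rule UNIV_eq_I[symmetric])
    fix p
    obtain U \<phi> u where "(U, \<phi>) \<in> \<A>" "u \<in> U" "\<phi> u = p" by (rule chart_cover)
    then have "p \<in> ?im (U, \<phi>)" by auto
    moreover have "?im (U, \<phi>) \<in> ?im ` \<A>" by (rule imageI) fact
    ultimately show "p \<in> \<Union>(?im ` \<A>)" by blast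
  qed
  then have "F \<noteq> {}" using F(3) by auto
  define C where "C n = (SOME c. c \<in> \<A> \<and> ?im c = from_nat_into F n)" for n
  have "\<exists>c. c \<in> \<A> \<and> ?im c = from_nat_into F n" for n
  proof -
    have "from_nat_into F n \<in> ?im ` \<A>" using from_nat_into[OF \<open>F \<noteq> {}\<close>, of n] F(1) by blast
    then obtain c where "from_nat_into F n = ?im c" "c \<in> \<A>" by (rule imageE)
    then show ?thesis by (intro exI[of _ c]) simp
  qed
  then have C: "C n \<in> \<A> \<and> ?im (C n) = from_nat_into F n" for n
    unfolding C_def by (rule someI_ex)
  show thesis
  proof (rule that)
    show "range C \<subseteq> \<A>" using C by blast
    have "(\<Union>n. ?im (C n)) = \<Union>(range (from_nat_into F))" using C by simp
    then show "(\<Union>n. ?im (C n)) = UNIV"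
      using F cov range_from_nat_into[OF \<open>F \<noteq> {}\<close> F(2)] by simp
  qed
qed

text \<open>The condition under the description in \<open>volume_measure\<close>, in the same form
  so that it can be discharged directly.\<close>

abbreviation is_volume :: "'m measure \<Rightarrow> bool" where
  "is_volume \<mu> \<equiv> sets \<mu> = sets borel \<and>
        (\<forall>(U, \<phi>)\<in>\<A>. \<forall>B\<in>sets borel. B \<subseteq> U \<longrightarrow>
           emeasure \<mu> (\<phi> ` B) = (\<integral>\<^sup>+u\<in>B. ennreal (sqrt (det (gram_matrix X \<phi> u))) \<partial>lborel))"

lemma chart_measure_image:
  assumes c: "(U, \<phi>) \<in> \<A>" and B: "B \<subseteq> U"
  shows "chart_measure U \<phi> (\<phi> ` B) = (\<integral>\<^sup>+u\<in>B. ennreal (sqrt (det (gram_matrix X \<phi> u))) \<partial>lborel)"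
  unfolding chart_measure_def vol_density_def using B inj_on_image_mem_iff[OF chart_inj[OF c] _ B]
  by (intro nn_integral_cong) (auto simp: indicator_def)

text \<open>Cut the manifold into countably many disjoint Borel pieces, each inside one chart, and
  add up the chart measures of the pieces. Agreement on overlaps gives the required formula in every
  chart, and any measure with that formula is determined on each piece.\<close>

lemma volume_unique_exists: "\<exists>!\<mu>. is_volume \<mu>"
proof -
  obtain C :: "nat \<Rightarrow> 'm param" where C: "range C \<subseteq> \<A>" "(\<Union>n. snd (C n) ` fst (C n)) = UNIV"
    by (rule countable_atlas)
  define U \<phi> where "U n = fst (C n)" and "\<phi> n = snd (C n)" for n
  have c: "(U n, \<phi> n) \<in> \<A>" for n using C(1) by (auto simp: U_def \<phi>_def)
  define A where "A = disjointed (\<lambda>n. \<phi> n ` U n)"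
  have A_disj: "disjoint_family A" unfolding A_def by (rule disjoint_family_disjointed)
  have A_UN: "(\<Union>n. A n) = UNIV" unfolding A_def UN_disjointed_eq using C(2) by (simp add: U_def \<phi>_def)
  have A_sub: "A n \<subseteq> \<phi> n ` U n" for n unfolding A_def by (rule disjointed_subset)
  have A_borel: "A n \<in> sets borel" for n
    unfolding A_def using chart_open(2)[OF c] by (intro sets.range_disjointed_sets[THEN subsetD[OF _ rangeI]]) auto
  define m where "m E = (\<Sum>n. chart_measure (U n) (\<phi> n) (E \<inter> A n))" for E
  have piece: "E \<inter> A n = \<phi> n ` (U n \<inter> \<phi> n -` (E \<inter> A n))" for E n
    by (rule image_Int_vimage[symmetric]) (use A_sub in blast)
  define \<mu> where "\<mu> = measure_of UNIV (sets borel) m"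
  have sets: "sets \<mu> = sets borel"
    unfolding \<mu>_def by (metis sets.sets_measure_of_eq space_borel)
  have em: "emeasure \<mu> E = m E" if "E \<in> sets borel" for E
  proof (rule emeasure_measure_of[OF \<mu>_def])
    show "positive (sets \<mu>) m"
      by (auto simp: positive_def m_def chart_measure_def)
    show "countably_additive (sets \<mu>) m"
    proof (rule countably_additiveI)
      fix E :: "nat \<Rightarrow> 'm set" assume E: "range E \<subseteq> sets \<mu>" "disjoint_family E"
      have "chart_measure (U n) (\<phi> n) ((\<Union>i. E i) \<inter> A n) = (\<Sum>i. chart_measure (U n) (\<phi> n) (E i \<inter> A n))" for n
      proof -
        have "(\<Sum>i. chart_measure (U n) (\<phi> n) (E i \<inter> A n)) = chart_measure (U n) (\<phi> n) (\<Union>i. E i \<inter> A n)"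
          by (rule chart_measure_countably_additive[OF c])
             (use E A_borel sets in \<open>auto simp: disjoint_family_on_def\<close>)
        then show ?thesis by (simp add: Int_UN_distrib2)
      qed
      then have "m (\<Union>i. E i) = (\<Sum>n i. chart_measure (U n) (\<phi> n) (E i \<inter> A n))"
        unfolding m_def by simp
      \<comment> \<open>The outer sum is read as an integral against counting measure, so that the
        two sums may be exchanged.\<close>
      also have "\<dots> = (\<integral>\<^sup>+n. (\<Sum>i. chart_measure (U n) (\<phi> n) (E i \<inter> A n)) \<partial>count_space UNIV)"
        by (rule nn_integral_count_space_nat[symmetric])
      also have "\<dots> = (\<Sum>i. \<integral>\<^sup>+n. chart_measure (U n) (\<phi> n) (E i \<inter> A n) \<partial>count_space UNIV)"
        by (rule nn_integral_suminf) auto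
      also have "\<dots> = (\<Sum>i. m (E i))"
        unfolding m_def nn_integral_count_space_nat ..
      finally show "(\<Sum>i. m (E i)) = m (\<Union>i. E i)" by simp
    qed
    show "sets borel \<subseteq> Pow (UNIV :: 'm set)" by simp
    show "E \<in> sets \<mu>" using that sets by simp
  qed
  have vol: "is_volume \<mu>"
  proof (intro conjI sets, clarify)
    fix V \<psi> B assume V: "(V, \<psi>) \<in> \<A>" and B: "B \<in> sets borel" "B \<subseteq> V"
    have im: "\<psi> ` B \<in> sets borel" by (rule chart_image_borel[OF V B])
    have "emeasure \<mu> (\<psi> ` B) = (\<Sum>n. chart_measure V \<psi> (\<psi> ` B \<inter> A n))"
      unfolding em[OF im] m_def
      by (intro suminf_cong chart_measure_overlap[OF c V])
         (use im A_borel A_sub B in \<open>auto\<close>)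
    also have "\<dots> = chart_measure V \<psi> (\<Union>n. \<psi> ` B \<inter> A n)"
      by (rule chart_measure_countably_additive[OF V])
         (use im A_borel A_disj in \<open>auto simp: disjoint_family_on_def\<close>)
    also have "(\<Union>n. \<psi> ` B \<inter> A n) = \<psi> ` B" using A_UN by (metis Int_UN_distrib Int_UNIV_right)
    finally show "emeasure \<mu> (\<psi> ` B) = (\<integral>\<^sup>+u\<in>B. ennreal (sqrt (det (gram_matrix X \<psi> u))) \<partial>lborel)"
      unfolding chart_measure_image[OF V B(2)] .
  qed
  have uniq: "\<nu> = \<mu>" if \<nu>: "is_volume \<nu>" for \<nu>
  proof (rule measure_eqI)
    show "sets \<nu> = sets \<mu>" using \<nu> sets by simp
    fix E assume "E \<in> sets \<nu>"
    then have E: "E \<in> sets borel" using \<nu> by simp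
    have EA: "range (\<lambda>n. E \<inter> A n) \<subseteq> sets \<nu>" using E A_borel \<nu> by auto
    have "emeasure \<nu> E = emeasure \<nu> (\<Union>n. E \<inter> A n)" using A_UN by (metis Int_UN_distrib Int_UNIV_right)
    also have "\<dots> = (\<Sum>n. emeasure \<nu> (E \<inter> A n))"
      by (rule suminf_emeasure[OF EA, symmetric]) (use A_disj in \<open>auto simp: disjoint_family_on_def\<close>)
    also have "\<dots> = (\<Sum>n. chart_measure (U n) (\<phi> n) (E \<inter> A n))"
    proof (rule suminf_cong)
      fix n
      let ?B = "U n \<inter> \<phi> n -` (E \<inter> A n)"
      have "?B \<in> sets borel" by (rule chart_preimage_borel[OF c]) (use E A_borel in auto)
      then have "emeasure \<nu> (\<phi> n ` ?B) = chart_measure (U n) (\<phi> n) (\<phi> n ` ?B)"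
        using \<nu> c[of n] chart_measure_image[OF c, of ?B n] by auto
      then show "emeasure \<nu> (E \<inter> A n) = chart_measure (U n) (\<phi> n) (E \<inter> A n)"
        unfolding piece[symmetric] .
    qed
    also have "\<dots> = emeasure \<mu> E" unfolding em[OF E] m_def ..
    finally show "emeasure \<nu> E = emeasure \<mu> E" .
  qed
  show ?thesis by (rule ex1I[where a=\<mu>], rule vol, rule uniq)
qed

abbreviation vol :: "'m measure" where "vol \<equiv> volume_measure \<A> X"

lemma is_volume_vol: "is_volume vol"
  unfolding volume_measure_def by (rule theI'[OF volume_unique_exists])

lemma sets_vol: "sets vol = sets borel"
  by (rule conjunct1[OF is_volume_vol])

lemma emeasure_vol:
  assumes c: "(U, \<phi>) \<in> \<A>" and E: "E \<in> sets borel" "E \<subseteq> \<phi> ` U"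
  shows "emeasure vol E = chart_measure U \<phi> E"
proof -
  let ?B = "U \<inter> \<phi> -` E"
  have B: "?B \<in> sets borel" "?B \<subseteq> U" using chart_preimage_borel[OF c E(1)] by simp_all
  have im: "\<phi> ` ?B = E" by (rule image_Int_vimage[OF E(2)])
  from bspec[OF conjunct2[OF is_volume_vol] c] have "\<forall>B\<in>sets borel. B \<subseteq> U \<longrightarrow>
      emeasure vol (\<phi> ` B) = (\<integral>\<^sup>+u\<in>B. ennreal (sqrt (det (gram_matrix X \<phi> u))) \<partial>lborel)"
    by (simp only: prod.case)
  then have "emeasure vol (\<phi> ` ?B) = (\<integral>\<^sup>+u\<in>?B. ennreal (sqrt (det (gram_matrix X \<phi> u))) \<partial>lborel)"
    using B by blast
  also have "\<dots> = chart_measure U \<phi> (\<phi> ` ?B)" by (rule chart_measure_image[OF c B(2), symmetric])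
  finally show ?thesis unfolding im .
qed

end

subsection \<open>Integration on the hypersurface\<close>

context hypersurface
begin

lemma chart_image_open:
  assumes c: "(U, \<phi>) \<in> \<A>" and B: "open B" "B \<subseteq> U"
  shows "open (\<phi> ` B)"
proof -
  have "open (inv_into U \<phi> -` B \<inter> \<phi> ` U)"
    using continuous_on_open_vimage[OF chart_open(2)[OF c]] chart_continuous(2)[OF c] B(1) by blast
  moreover have "inv_into U \<phi> -` B \<inter> \<phi> ` U = \<phi> ` B"
  proof
    show "inv_into U \<phi> -` B \<inter> \<phi> ` U \<subseteq> \<phi> ` B"
    proof
      fix p assume "p \<in> inv_into U \<phi> -` B \<inter> \<phi> ` U"
      then have "inv_into U \<phi> p \<in> B" "p = \<phi> (inv_into U \<phi> p)" by (simp_all add: f_inv_into_f)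
      then show "p \<in> \<phi> ` B" by blast
    qed
    show "\<phi> ` B \<subseteq> inv_into U \<phi> -` B \<inter> \<phi> ` U"
    proof
      fix p assume "p \<in> \<phi> ` B"
      then obtain u where u: "u \<in> B" "p = \<phi> u" by blast
      then have "inv_into U \<phi> p = u" using chart_inv[OF c] B(2) by blast
      then show "p \<in> inv_into U \<phi> -` B \<inter> \<phi> ` U" using u B(2) by blast
    qed
  qed
  ultimately show ?thesis by simp
qed

text \<open>The doubled radius leaves room: supports will lie in the closed ball of radius
  \<open>\<epsilon>\<close>, hence compactly inside the open ball of radius
  \<open>2 * \<epsilon>\<close>.\<close>

lemma chart_ball:
  obtains U \<phi> u \<epsilon> where "(U, \<phi>) \<in> \<A>" "\<epsilon> > 0" "cball u (2 * \<epsilon>) \<subseteq> U" "\<phi> u = p"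
proof -
  obtain U \<phi> u where c: "(U, \<phi>) \<in> \<A>" "u \<in> U" "\<phi> u = p" by (rule chart_cover)
  obtain e where e: "e > 0" "cball u e \<subseteq> U"
    using open_contains_cball chart_open(1)[OF c(1)] c(2) by blast
  show thesis by (rule that[of U \<phi> "e / 2" u]) (use c e in simp_all)
qed

lemma continuous_mapI:
  assumes "\<And>U \<phi>. (U, \<phi>) \<in> \<A> \<Longrightarrow> continuous_on U (\<lambda>u. f (\<phi> u))"
  shows "continuous_on UNIV f"
proof (rule continuous_at_imp_continuous_on, rule ballI)
  fix p
  obtain U \<phi> u where c: "(U, \<phi>) \<in> \<A>" "u \<in> U" "\<phi> u = p" by (rule chart_cover)
  have "continuous_on (\<phi> ` U) (\<lambda>q. f (\<phi> (inv_into U \<phi> q)))"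
    by (rule continuous_on_compose2[OF assms[OF c(1)] chart_continuous(2)[OF c(1)]]) (auto intro: inv_into_into)
  then have "continuous_on (\<phi> ` U) f"
    by (rule continuous_on_eq) (simp add: f_inv_into_f)
  then show "isCont f p"
    using chart_open(2)[OF c(1)] c(2,3) continuous_on_eq_continuous_at by blast
qed

lemma borel_measurable_vol:
  "f \<in> borel_measurable vol \<longleftrightarrow> f \<in> borel_measurable borel"
  by (intro measurable_cong_sets[THEN eqset_imp_iff] sets_vol refl)

text \<open>Two measures on the manifold agree: the volume restricted to the chart image, and the
  push-forward by the chart of Lebesgue measure with density \<open>vol_density\<close>. The
  integral formula follows by density and transfer.\<close>

lemma integral_vol_chart:
  fixes f :: "'m \<Rightarrow> real"
  assumes c: "(U, \<phi>) \<in> \<A>" and f: "f \<in> borel_measurable borel" and zero: "\<And>p. p \<notin> \<phi> ` U \<Longrightarrow> f p = 0"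
  shows "(LINT p|vol. f p) = (LINT u|lborel. (indicator U u *\<^sub>R vol_density \<phi> u) *\<^sub>R f (\<phi> u))"
proof -
  \<comment> \<open>An arbitrary value with which the chart is continued outside \<open>U\<close>;
    the density vanishes there.\<close>
  obtain p0 :: 'm where True by simp
  let ?g = "\<lambda>u. indicator U u *\<^sub>R vol_density \<phi> u"
  have g: "?g \<in> borel_measurable borel"
    using chart_open(1)[OF c] vol_density_continuous[OF c] by (intro borel_measurable_continuous_on_indicator) auto
  have g0: "0 \<le> ?g u" for u
    using vol_density_pos[OF c, of u] by (auto simp: indicator_def)
  define \<nu> where "\<nu> = density lborel (\<lambda>u. ennreal (?g u))"
  define t where "t = (\<lambda>u. if u \<in> U then \<phi> u else p0)"
  have t: "t \<in> borel_measurable borel" unfolding t_def by (rule chart_measurable[OF c])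
  have im: "\<phi> ` U \<in> sets borel" using chart_open(2)[OF c] by simp
  have distr: "distr \<nu> borel t = density vol (\<lambda>p. ennreal (indicator (\<phi> ` U) p))"
  proof (rule measure_eqI)
    show "sets (distr \<nu> borel t) = sets (density vol (\<lambda>p. ennreal (indicator (\<phi> ` U) p)))"
      by (simp add: sets_vol)
    fix E assume "E \<in> sets (distr \<nu> borel t)"
    then have E: "E \<in> sets borel" by simp
    have tE: "t -` E \<in> sets borel" by (rule measurable_sets_borel[OF t E])
    have "emeasure (distr \<nu> borel t) E = emeasure \<nu> (t -` E)"
      using t E by (subst emeasure_distr) (auto simp: \<nu>_def)
    also have "\<dots> = (\<integral>\<^sup>+u. ennreal (?g u) * indicator (t -` E) u \<partial>lborel)"
      unfolding \<nu>_def by (rule emeasure_density) (use g tE in auto)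
    also have "\<dots> = chart_measure U \<phi> (E \<inter> \<phi> ` U)"
      unfolding chart_measure_def by (rule nn_integral_cong) (simp add: indicator_def t_def)
    also have "\<dots> = emeasure vol (E \<inter> \<phi> ` U)"
      by (rule emeasure_vol[OF c, symmetric]) (use E im in auto)
    also have "\<dots> = (\<integral>\<^sup>+p. indicator (E \<inter> \<phi> ` U) p \<partial>vol)"
      by (rule nn_integral_indicator[symmetric]) (unfold sets_vol, rule sets.Int[OF E im])
    also have "\<dots> = (\<integral>\<^sup>+p. ennreal (indicator (\<phi> ` U) p) * indicator E p \<partial>vol)"
      by (rule nn_integral_cong) (auto simp: indicator_def)
    also have "\<dots> = emeasure (density vol (\<lambda>p. ennreal (indicator (\<phi> ` U) p))) E"
      by (rule emeasure_density[symmetric]) (use E im sets_vol in \<open>auto simp: borel_measurable_vol\<close>)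
    finally show "emeasure (distr \<nu> borel t) E = emeasure (density vol (\<lambda>p. ennreal (indicator (\<phi> ` U) p))) E" .
  qed
  have "(LINT p|vol. f p) = (LINT p|vol. indicator (\<phi> ` U) p *\<^sub>R f p)"
    by (rule Bochner_Integration.integral_cong[OF refl]) (use zero in \<open>auto simp: indicator_def\<close>)
  also have "\<dots> = (LINT p|density vol (\<lambda>p. ennreal (indicator (\<phi> ` U) p)). f p)"
    by (rule integral_density[symmetric]) (use f im sets_vol in \<open>auto simp: borel_measurable_vol\<close>)
  also have "\<dots> = (LINT u|\<nu>. f (t u))"
    unfolding distr[symmetric] by (rule integral_distr) (use t f in \<open>auto simp: \<nu>_def\<close>)
  also have "\<dots> = (LINT u|lborel. ?g u *\<^sub>R f (t u))"
    unfolding \<nu>_def by (rule integral_density) (use g g0 measurable_compose[OF t f] in auto)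
  also have "\<dots> = (LINT u|lborel. ?g u *\<^sub>R f (\<phi> u))"
    by (rule Bochner_Integration.integral_cong[OF refl]) (simp add: t_def indicator_def)
  finally show ?thesis .
qed

text \<open>The density is bounded on a closed coordinate ball, so every point has a neighbourhood
  of finite volume, and finitely many of these cover a compact set.\<close>

lemma vol_compact_finite:
  assumes "compact K" shows "emeasure vol K < \<infinity>"
proof -
  have "\<exists>G. open G \<and> p \<in> G \<and> emeasure vol G < \<infinity>" for p
  proof -
    obtain U \<phi> u \<epsilon> where c: "(U, \<phi>) \<in> \<A>" and \<epsilon>: "\<epsilon> > 0" "cball u (2 * \<epsilon>) \<subseteq> U" "\<phi> u = p" by (rule chart_ball)
    have sub: "ball u \<epsilon> \<subseteq> U" using \<epsilon> by (auto simp: subset_eq)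
    have op: "open (\<phi> ` ball u \<epsilon>)" by (rule chart_image_open[OF c open_ball sub])
    have "bounded (vol_density \<phi> ` cball u \<epsilon>)"
      by (intro compact_imp_bounded compact_continuous_image compact_cball continuous_on_subset[OF vol_density_continuous[OF c]])
         (use \<epsilon> in \<open>auto simp: subset_eq\<close>)
    then obtain B where B: "B > 0" "\<And>v. v \<in> cball u \<epsilon> \<Longrightarrow> \<bar>vol_density \<phi> v\<bar> \<le> B"
      by (auto simp: bounded_pos)
    have "emeasure vol (\<phi> ` ball u \<epsilon>) = chart_measure U \<phi> (\<phi> ` ball u \<epsilon>)"
      by (rule emeasure_vol[OF c]) (use op sub in auto)
    also have "\<dots> = (\<integral>\<^sup>+v\<in>ball u \<epsilon>. ennreal (vol_density \<phi> v) \<partial>lborel)"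
      using chart_measure_image[OF c sub] by (simp add: vol_density_def)
    also have "\<dots> \<le> (\<integral>\<^sup>+v\<in>ball u \<epsilon>. ennreal B \<partial>lborel)"
    proof (rule nn_integral_mono)
      fix v
      have "vol_density \<phi> v \<le> B" if "v \<in> ball u \<epsilon>" using B(2)[of v] that by simp
      then show "ennreal (vol_density \<phi> v) * indicator (ball u \<epsilon>) v \<le> ennreal B * indicator (ball u \<epsilon>) v"
        by (cases "v \<in> ball u \<epsilon>") (simp_all add: ennreal_leI)
    qed
    also have "\<dots> = ennreal B * emeasure lborel (ball u \<epsilon>)"
      by (simp add: nn_integral_cmult_indicator)
    also have "\<dots> < \<infinity>"
      using emeasure_lborel_ball_finite[of u \<epsilon>] by (simp add: ennreal_mult_less_top)
    finally show ?thesis using op \<epsilon> by (intro exI[of _ "\<phi> ` ball u \<epsilon>"]) auto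
  qed
  then obtain G where G: "\<And>p. open (G p)" "\<And>p. p \<in> G p" "\<And>p. emeasure vol (G p) < \<infinity>" by metis
  obtain P where P: "P \<subseteq> K" "finite P" "K \<subseteq> (\<Union>p\<in>P. G p)"
    by (rule compactE_image[OF assms, of K G]) (use G in auto)
  have "emeasure vol K \<le> emeasure vol (\<Union>p\<in>P. G p)"
    by (rule emeasure_mono[OF P(3)]) (use G(1) sets_vol P(2) in auto)
  also have "\<dots> \<le> (\<Sum>p\<in>P. emeasure vol (G p))"
    by (rule emeasure_subadditive_finite[OF P(2)]) (use G(1) sets_vol in auto)
  also have "\<dots> < \<infinity>" using G(3) P(2) by (simp add: less_top[symmetric])
  finally show ?thesis .
qed

lemma integrable_compact_support:
  fixes f :: "'m \<Rightarrow> real"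
  assumes "continuous_on UNIV f" "compact K" "\<And>p. p \<notin> K \<Longrightarrow> f p = 0"
  shows "integrable vol f"
proof -
  have "bounded (f ` K)"
    by (intro compact_imp_bounded compact_continuous_image assms continuous_on_subset[OF assms(1)]) auto
  then obtain B where B: "B > 0" "\<And>p. p \<in> K \<Longrightarrow> \<bar>f p\<bar> \<le> B" by (auto simp: bounded_pos)
  have K: "K \<in> sets vol" using compact_imp_closed[OF assms(2)] by (simp add: sets_vol borel_closed)
  show ?thesis
  proof (rule Bochner_Integration.integrable_bound[where f="\<lambda>p. indicator K p *\<^sub>R B"])
    show "integrable vol (\<lambda>p. indicator K p *\<^sub>R B)"
      using vol_compact_finite[OF assms(2)] K by (intro integrable_scaleR_left) (simp add: integrable_indicator_iff)
    show "f \<in> borel_measurable vol"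
      unfolding borel_measurable_vol by (rule borel_measurable_continuous_onI[OF assms(1)])
    show "AE p in vol. norm (f p) \<le> norm (indicator K p *\<^sub>R B)"
      using B assms(3) by (auto simp: indicator_def)
  qed
qed

text \<open>In a chart the density is positive and a nonempty open set is not negligible. This turns
  positivity at a single point into positivity of an integral.\<close>

lemma vol_open_pos:
  assumes "open G" "G \<noteq> {}" shows "emeasure vol G > 0"
proof -
  obtain p where p: "p \<in> G" using assms(2) by blast
  obtain U \<phi> u where c: "(U, \<phi>) \<in> \<A>" "u \<in> U" "\<phi> u = p" by (rule chart_cover)
  define E where "E = G \<inter> \<phi> ` U"
  have E: "E \<in> sets borel" "E \<subseteq> \<phi> ` U"
    using assms(1) chart_open(2)[OF c(1)] by (auto simp: E_def)
  let ?B = "U \<inter> \<phi> -` G"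
  have op: "open ?B" by (rule chart_open_preimage[OF c(1) assms(1)])
  have "emeasure vol E \<noteq> 0"
  proof
    assume "emeasure vol E = 0"
    then have "(\<integral>\<^sup>+u. indicator E (\<phi> u) * (indicator U u * ennreal (vol_density \<phi> u)) \<partial>lborel) = 0"
      using emeasure_vol[OF c(1) E] by (simp add: chart_measure_def)
    then have "AE u in lborel. indicator E (\<phi> u) * (indicator U u * ennreal (vol_density \<phi> u)) = 0"
      using chart_measure_measurable[OF c(1) E(1)] by (subst (asm) nn_integral_0_iff_AE) auto
    then have "AE u in lborel. u \<notin> ?B"
    proof (rule AE_mp, intro AE_I2 impI notI)
      fix v assume v: "indicator E (\<phi> v) * (indicator U v * ennreal (vol_density \<phi> v)) = 0" "v \<in> ?B"
      then have "ennreal (vol_density \<phi> v) = 0" by (simp add: E_def)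
      then show False using vol_density_pos[OF c(1), of v] v(2) by (simp add: ennreal_eq_0_iff)
    qed
    then have "?B \<in> null_sets lborel"
      using op by (subst AE_iff_null_sets) auto
    then have "negligible ?B" by (simp add: negligible_iff_null_sets null_sets_completionI)
    then show False using open_not_negligible[OF op] c p by blast
  qed
  then have "0 < emeasure vol E" by (simp add: zero_less_iff_neq_zero)
  also have "\<dots> \<le> emeasure vol G"
    by (rule emeasure_mono) (use assms(1) sets_vol in \<open>auto simp: E_def\<close>)
  finally show ?thesis .
qed

lemma integral_pos:
  fixes f :: "'m \<Rightarrow> real"
  assumes f: "continuous_on UNIV f" "compact K" "\<And>p. p \<notin> K \<Longrightarrow> f p = 0"
    and nonneg: "\<And>p. f p \<ge> 0" and pos: "f p > 0"
  shows "(LINT p|vol. f p) > 0"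
proof -
  have int: "integrable vol f" by (rule integrable_compact_support[OF f])
  have "(LINT p|vol. f p) \<noteq> 0"
  proof
    assume "(LINT p|vol. f p) = 0"
    then have "AE p in vol. f p = 0"
      using integral_nonneg_eq_0_iff_AE[OF int] nonneg by simp
    then have ae: "AE p in vol. p \<notin> {p. f p > 0}" by (rule AE_mp) (simp add: AE_I2)
    have op: "open {p. f p > 0}"
      using open_Collect_less[of "\<lambda>_. 0" f] f(1) by simp
    have "{p. f p > 0} \<in> null_sets vol"
      using ae op by (subst AE_iff_null_sets) (auto simp: sets_vol)
    then show False using vol_open_pos[OF op] pos by (auto simp: null_sets_def)
  qed
  moreover have "(LINT p|vol. f p) \<ge> 0" using nonneg by (simp add: integral_nonneg)
  ultimately show ?thesis by simp
qed

section \<open>Regularity of functions, curvatures and gradients on the hypersurface\<close>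

lemma C1_map_iff: "C1_map f \<longleftrightarrow> (\<forall>U \<phi>. (U, \<phi>) \<in> \<A> \<longrightarrow> C1_on U (\<lambda>u. f (\<phi> u)))"
  unfolding C1_map_def by (auto simp: o_def)

lemma C1_map_const: "C1_map (\<lambda>_. c)" by (simp add: C1_map_iff C1_on_const)

lemma C1_map_mult:
  fixes f g :: "'m \<Rightarrow> real"
  shows "C1_map f \<Longrightarrow> C1_map g \<Longrightarrow> C1_map (\<lambda>p. f p * g p)"
  unfolding C1_map_iff by (intro allI impI C1_on_mult) blast+

lemma C1_map_inner:
  fixes f g :: "'m \<Rightarrow> real^4"
  shows "C1_map f \<Longrightarrow> C1_map g \<Longrightarrow> C1_map (\<lambda>p. f p \<bullet> g p)"
  unfolding C1_map_iff by (intro allI impI C1_on_inner) blast+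

lemma C1_map_diff: "C1_map f \<Longrightarrow> C1_map g \<Longrightarrow> C1_map (\<lambda>p. f p - g p)"
  unfolding C1_map_iff by (intro allI impI C1_on_diff) blast+

lemma C1_map_sum: "(\<And>i. i \<in> I \<Longrightarrow> C1_map (f i)) \<Longrightarrow> C1_map (\<lambda>p. \<Sum>i\<in>I. f i p)"
  unfolding C1_map_iff by (intro allI impI C1_on_sum) blast

lemma C1_map_imp_continuous: "C1_map f \<Longrightarrow> continuous_on UNIV f"
  by (rule continuous_mapI) (rule C1_map_continuous)

lemma continuous_on_alternate:
  assumes "\<And>i j l. continuous_on S (\<lambda>x. T x i j l)"
  shows "continuous_on S (\<lambda>x. alternate (T x))"
  unfolding alternate_def by (intro continuous_intros assms)

text \<open>Pointwise chosen principal curvatures show no continuity; the quotient of determinants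
  from \<open>curvature_formulas\<close> does, as \<open>jac\<close> never vanishes.\<close>

lemma mean_curvature_continuous: "continuous_on UNIV (mean_curvature \<A> X N)"
proof (rule continuous_mapI)
  fix U \<phi> assume c: "(U, \<phi>) \<in> \<A>"
  have "continuous_on U (\<lambda>u. alternate (\<lambda>i j l. det4 (pd X \<phi> u i) (N (\<phi> u)) (pd X \<phi> u j) (pd N \<phi> u l)) / (- 6 * jac \<phi> u))"
    by (intro continuous_on_divide continuous_on_alternate continuous_on_det4 pd_continuous C1_map_continuous
        C1_XN c continuous_intros jac_continuous) (use jac_gram(1)[OF c] in auto)
  then show "continuous_on U (\<lambda>u. mean_curvature \<A> X N (\<phi> u))"
    by (rule continuous_on_eq) (use curvature_formulas(1)[OF c] jac_gram(1)[OF c] in auto)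
qed

lemma gauss_kronecker_continuous: "continuous_on UNIV (gauss_kronecker_curvature \<A> X N)"
proof (rule continuous_mapI)
  fix U \<phi> assume c: "(U, \<phi>) \<in> \<A>"
  have "continuous_on U (\<lambda>u. det4 (pd N \<phi> u 1) (N (\<phi> u)) (pd N \<phi> u 2) (pd N \<phi> u 3) / (- jac \<phi> u))"
    by (intro continuous_on_divide continuous_on_det4 pd_continuous C1_map_continuous
        C1_XN c continuous_intros jac_continuous) (use jac_gram(1)[OF c] in auto)
  then show "continuous_on U (\<lambda>u. gauss_kronecker_curvature \<A> X N (\<phi> u))"
    by (rule continuous_on_eq) (use curvature_formulas(3)[OF c] jac_gram(1)[OF c] in auto)
qed

lemma gradient_continuous:
  assumes h: "C1_map h"
  shows "continuous_on UNIV (gradient \<A> X h)"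
proof (rule continuous_mapI)
  fix U \<phi> assume c: "(U, \<phi>) \<in> \<A>"
  have "continuous_on U (\<lambda>u. gradient \<A> X h (\<phi> u) \<bullet> Y)" for Y
  proof -
    have "continuous_on U (\<lambda>u. alternate (\<lambda>i j l. pd h \<phi> u i * det4 Y (N (\<phi> u)) (pd X \<phi> u j) (pd X \<phi> u l)) / (2 * jac \<phi> u))"
      by (intro continuous_on_divide continuous_on_alternate continuous_on_det4 pd_continuous C1_map_continuous
          C1_XN h c continuous_intros jac_continuous) (use jac_gram(1)[OF c] in auto)
    then show ?thesis
      by (rule continuous_on_eq) (use gradient_formulas(2)[OF c _ h] jac_gram(1)[OF c] in auto)
  qed
  then show "continuous_on U (\<lambda>u. gradient \<A> X h (\<phi> u))"
    by (subst continuous_on_componentwise) auto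
qed

lemma P1_gradient_continuous:
  assumes h: "C1_map h" and Y: "continuous_on UNIV Y"
  shows "continuous_on UNIV (\<lambda>p. P1 \<A> X N p (gradient \<A> X h p) \<bullet> Y p)"
proof (rule continuous_mapI)
  fix U \<phi> assume c: "(U, \<phi>) \<in> \<A>"
  have "continuous_on U (\<lambda>u. alternate (\<lambda>i j l. pd h \<phi> u i * det4 (Y (\<phi> u)) (N (\<phi> u)) (pd X \<phi> u j) (pd N \<phi> u l)) / (- jac \<phi> u))"
    by (intro continuous_on_divide continuous_on_alternate continuous_on_det4 pd_continuous C1_map_continuous
        C1_XN h c continuous_intros jac_continuous continuous_on_compose2[OF Y chart_continuous(1)])
       (use jac_gram(1)[OF c] in auto)
  then show "continuous_on U (\<lambda>u. P1 \<A> X N (\<phi> u) (gradient \<A> X h (\<phi> u)) \<bullet> Y (\<phi> u))"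
    by (rule continuous_on_eq) (use gradient_formulas(1)[OF c _ h] jac_gram(1)[OF c] in auto)
qed

lemma pd_zero_outside:
  assumes h: "C1_map h" "closed K" "\<And>p. p \<notin> K \<Longrightarrow> h p = 0" and c: "(U, \<phi>) \<in> \<A>" "u \<in> U" "\<phi> u \<notin> K"
  shows "pd h \<phi> u i = 0"
proof -
  have op: "open (U \<inter> \<phi> -` (- K))" by (rule chart_open_preimage[OF c(1)]) (use h(2) in auto)
  have "(h \<circ> \<phi> has_derivative (\<lambda>_. 0)) (at u)"
    by (rule has_derivative_transform_within_open[OF has_derivative_const[of 0] op]) (use c h(3) in auto)
  then show ?thesis unfolding pd_def using frechet_derivative_at by metis
qed

text \<open>The determinant formula shows that the gradient is orthogonal to every vector, in
  particular to itself.\<close>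

lemma gradient_zero_outside:
  assumes h: "C1_map h" "closed K" "\<And>p. p \<notin> K \<Longrightarrow> h p = 0" "p \<notin> K"
  shows "gradient \<A> X h p = 0"
proof -
  obtain U \<phi> u where c: "(U, \<phi>) \<in> \<A>" "u \<in> U" "\<phi> u = p" by (rule chart_cover)
  have "2 * jac \<phi> u * (gradient \<A> X h p \<bullet> Y) = 0" for Y
    using gradient_formulas(2)[OF c(1,2) h(1), of Y] pd_zero_outside[OF h(1-3) c(1,2)] c(3) h(4)
    by (simp add: alternate_def)
  then have "gradient \<A> X h p \<bullet> gradient \<A> X h p = 0" using jac_gram(1)[OF c(1,2)] by simp
  then show ?thesis by simp
qed

end

subsection \<open>The divergence theorem\<close>

lemma det4_has_derivative:
  assumes "(a has_derivative a') (at x within S)" "(b has_derivative b') (at x within S)"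
    "(c has_derivative c') (at x within S)" "(d has_derivative d') (at x within S)"
  shows "((\<lambda>x. det4 (a x) (b x) (c x) (d x)) has_derivative
     (\<lambda>v. det4 (a' v) (b x) (c x) (d x) + det4 (a x) (b' v) (c x) (d x)
        + det4 (a x) (b x) (c' v) (d x) + det4 (a x) (b x) (c x) (d' v))) (at x within S)"
proof -
  note nth = bounded_linear.has_derivative[OF bounded_linear_vec_nth]
  note [derivative_intros] = nth[OF assms(1)] nth[OF assms(2)]
    nth[OF assms(3)] nth[OF assms(4)]
  show ?thesis
    unfolding det4_def
    by (rule has_derivative_eq_rhs, (rule derivative_intros)+) (simp add: fun_eq_iff algebra_simps)
qed

lemma C1_on_det4:
  assumes "C1_on S a" "C1_on S b" "C1_on S c" "C1_on S d"
  shows "C1_on S (\<lambda>x. det4 (a x) (b x) (c x) (d x))"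
  unfolding det4_def
  by (intro C1_on_add C1_on_diff C1_on_mult C1_on_bounded_linear[OF bounded_linear_vec_nth] assms)

lemma frechet_derivative_det4:
  assumes "C1_on S a" "C1_on S b" "C1_on S c" "C1_on S d" "x \<in> S"
  shows "frechet_derivative (\<lambda>x. det4 (a x) (b x) (c x) (d x)) (at x) v =
     det4 (frechet_derivative a (at x) v) (b x) (c x) (d x) + det4 (a x) (frechet_derivative b (at x) v) (c x) (d x)
     + det4 (a x) (b x) (frechet_derivative c (at x) v) (d x) + det4 (a x) (b x) (c x) (frechet_derivative d (at x) v)"
  unfolding frechet_derivative_at[OF det4_has_derivative[OF C1_on_has_derivative[OF assms(1,5)]
      C1_on_has_derivative[OF assms(2,5)] C1_on_has_derivative[OF assms(3,5)] C1_on_has_derivative[OF assms(4,5)]], symmetric] ..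

text \<open>Exhibits the coefficient of \<open>h i\<close> as the i-th component of the curl-like
  vector field attached to \<open>T\<close>; this is the field whose divergence is taken
  below.\<close>

lemma alternate_divergence:
  "alternate (\<lambda>i j l. (h i :: real) * T j l) = h 1 * (T 2 3 - T 3 2) + h 2 * (T 3 1 - T 1 3) + h 3 * (T 1 2 - T 2 1)"
  by (simp add: alternate_def algebra_simps)

lemma alternate_symmetric:
  assumes "\<And>i j l. T i j l = T j i l" shows "alternate T = 0"
  unfolding alternate_def using assms[of 1 2 3] assms[of 1 3 2] assms[of 2 3 1] by simp

lemma alternate_symmetric':
  assumes "\<And>i j l. T i j l = T l j i" shows "alternate T = 0"
  unfolding alternate_def using assms[of 1 2 3] assms[of 1 3 2] assms[of 2 1 3] by simp

lemma alternate_add: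
  "alternate (\<lambda>i j l. S i j l + T i j l) = alternate S + alternate T"
  by (simp add: alternate_def)

context hypersurface
begin

text \<open>When R = 0 this is the divergence of \<open>\<eta>\<close> times \<open>P1\<close>
  applied to the tangential part of \<open>X - c\<close>: the first term differentiates
  \<open>\<eta>\<close>, and \<open>6 H\<close> is the trace of \<open>P1\<close>.\<close>

definition flux :: "real^4 \<Rightarrow> ('m \<Rightarrow> real) \<Rightarrow> 'm \<Rightarrow> real" where
  "flux c \<eta> p = P1 \<A> X N p (gradient \<A> X \<eta> p) \<bullet> (X p - c) + 6 * mean_curvature \<A> X N p * \<eta> p"

lemma flux_continuous:
  assumes "C1_map \<eta>" shows "continuous_on UNIV (flux c \<eta>)"
  unfolding flux_def
  by (intro continuous_on_add P1_gradient_continuous[OF assms] continuous_on_mult continuous_on_const continuous_on_diff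
      mean_curvature_continuous C1_map_imp_continuous[OF assms] C1_map_imp_continuous[OF C1_XN(1)])

lemma P1_zero: "P1 \<A> X N p 0 = 0"
proof -
  obtain U \<phi> u where c: "(U, \<phi>) \<in> \<A>" "u \<in> U" "\<phi> u = p" by (rule chart_cover)
  have "0 \<in> tangent_space \<A> X p"
    using subspace_0[OF tangent_space_props(1)[OF c(1,2)]] c(3) by simp
  from P1_add_scale[OF this this, of 0 0] show ?thesis by simp
qed

lemma flux_zero_outside:
  assumes "C1_map \<eta>" "closed K" "\<And>p. p \<notin> K \<Longrightarrow> \<eta> p = 0" "p \<notin> K"
  shows "flux c \<eta> p = 0"
  using gradient_zero_outside[OF assms] assms(3)[OF assms(4)] by (simp add: flux_def P1_zero)

text \<open>The vector field of the divergence theorem is \<open>V\<^sup>i = \<Sum> \<epsilon>\<^sup>i\<^sup>j\<^sup>l det (x, n, x\<^sub>j, n\<^sub>l)\<close>, the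
  coordinate form of the 2-form \<open>det (x, n, dx, dn)\<close>: mixed second derivatives cancel, so neither
  Christoffel symbols nor the Codazzi equations are needed.\<close>

lemma coordinate_divergence:
  assumes ch: "(U, \<phi>) \<in> \<A>" and R: "\<And>p. scalar_curvature \<A> X N p = 0"
  shows "\<exists>G :: 3 \<Rightarrow> real^3 \<Rightarrow> real. (\<forall>i. C1_on U (G i)) \<and>
    (\<forall>\<eta>. C1_map \<eta> \<longrightarrow> (\<forall>u\<in>U. (\<Sum>i\<in>UNIV. pd \<eta> \<phi> u i * G i u
        + \<eta> (\<phi> u) * frechet_derivative (G i) (at u) (axis i 1)) = - jac \<phi> u * flux c \<eta> (\<phi> u)))"
proof -
  define y where "y = (\<lambda>u. X (\<phi> u) - c)"
  define n where "n = N \<circ> \<phi>"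
  define T where "T j l u = det4 (y u) (n u) (pd X \<phi> u j) (pd N \<phi> u l)" for j l u
  have ax: "axis i (1::real) \<in> Basis" for i :: 3 by simp
  have C1X: "C1_on U (\<lambda>u. pd X \<phi> u i)" and C1N: "C1_on U (\<lambda>u. pd N \<phi> u i)" for i
    unfolding pd_def using smooth_on_derivative_C1[OF smooth_chart(1)[OF ch] ax] smooth_on_derivative_C1[OF smooth_chart(2)[OF ch] ax] by simp_all
  have C1x: "C1_on U (X \<circ> \<phi>)" and C1n: "C1_on U n"
    unfolding n_def by (rule C1_mapD[OF C1_XN(1) ch], rule C1_mapD[OF C1_XN(2) ch])
  have C1y: "C1_on U y"
    unfolding y_def using C1_on_diff[OF C1x C1_on_const[of _ c]] by (simp add: o_def)
  have C1T: "C1_on U (T j l)" for j l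
    unfolding T_def by (rule C1_on_det4[OF C1y C1n C1X C1N])
  have dT: "frechet_derivative (T j l) (at u) (axis i 1) =
      det4 (pd X \<phi> u i) (n u) (pd X \<phi> u j) (pd N \<phi> u l) + det4 (y u) (pd N \<phi> u i) (pd X \<phi> u j) (pd N \<phi> u l)
      + det4 (y u) (n u) (frechet_derivative (\<lambda>u. pd X \<phi> u j) (at u) (axis i 1)) (pd N \<phi> u l)
      + det4 (y u) (n u) (pd X \<phi> u j) (frechet_derivative (\<lambda>u. pd N \<phi> u l) (at u) (axis i 1))" if u: "u \<in> U" for i j l u
  proof -
    have "(y has_derivative (\<lambda>v. frechet_derivative (X \<circ> \<phi>) (at u) v - 0)) (at u)"
      unfolding y_def
      using has_derivative_diff[OF C1_on_has_derivative[OF C1x u] has_derivative_const[of c]] by (simp add: o_def)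
    then have "frechet_derivative y (at u) = frechet_derivative (X \<circ> \<phi>) (at u)"
      by (subst frechet_derivative_at[symmetric]) simp_all
    then have y: "frechet_derivative y (at u) (axis i 1) = pd X \<phi> u i" by (simp add: pd_def)
    have n: "frechet_derivative n (at u) (axis i 1) = pd N \<phi> u i" by (simp add: pd_def n_def)
    show ?thesis
      unfolding T_def frechet_derivative_det4[OF C1y C1n C1X C1N u] y n ..
  qed
  \<comment> \<open>The components of the vector field, independent of \<open>\<eta>\<close>; the
    product rule with any \<open>\<eta>\<close> is then the formula to be shown.\<close>
  define G :: "3 \<Rightarrow> real^3 \<Rightarrow> real" where
    "G i = (if i = 1 then (\<lambda>u. T 2 3 u - T 3 2 u) else if i = 2 then (\<lambda>u. T 3 1 u - T 1 3 u) else (\<lambda>u. T 1 2 u - T 2 1 u))" for i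
  have G: "G 1 = (\<lambda>u. T 2 3 u - T 3 2 u)" "G 2 = (\<lambda>u. T 3 1 u - T 1 3 u)" "G 3 = (\<lambda>u. T 1 2 u - T 2 1 u)"
    by (simp_all add: G_def)
  have C1G: "C1_on U (G i)" for i
    using exhaust_3[of i] by (auto simp: G intro!: C1_on_diff C1T)
  have dTT: "frechet_derivative (\<lambda>u. T j l u - T j' l' u) (at u) v = frechet_derivative (T j l) (at u) v - frechet_derivative (T j' l') (at u) v"
    if u: "u \<in> U" for j l j' l' u v
    unfolding frechet_derivative_at[OF has_derivative_diff[OF C1_on_has_derivative[OF C1T u] C1_on_has_derivative[OF C1T u]], symmetric] ..
  have div: "(\<Sum>i\<in>UNIV. frechet_derivative (G i) (at u) (axis i 1)) = - 6 * jac \<phi> u * mean_curvature \<A> X N (\<phi> u)" if u: "u \<in> U" for u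
  proof -
    have symX: "frechet_derivative (\<lambda>u. pd X \<phi> u j) (at u) (axis i 1) = frechet_derivative (\<lambda>u. pd X \<phi> u i) (at u) (axis j 1)" for i j
      unfolding pd_def by (rule smooth_on_symmetric[OF chart_open(1)[OF ch] u smooth_chart(1)[OF ch] ax ax])
    have symN: "frechet_derivative (\<lambda>u. pd N \<phi> u j) (at u) (axis i 1) = frechet_derivative (\<lambda>u. pd N \<phi> u i) (at u) (axis j 1)" for i j
      unfolding pd_def by (rule smooth_on_symmetric[OF chart_open(1)[OF ch] u smooth_chart(2)[OF ch] ax ax])
    have "(\<Sum>i\<in>UNIV. frechet_derivative (G i) (at u) (axis i 1)) = alternate (\<lambda>i j l. frechet_derivative (T j l) (at u) (axis i 1))"
      by (simp add: sum_3 G dTT[OF u] alternate_def)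
    also have "\<dots> = alternate (\<lambda>i j l. det4 (pd X \<phi> u i) (n u) (pd X \<phi> u j) (pd N \<phi> u l))
        + alternate (\<lambda>i j l. det4 (y u) (pd N \<phi> u i) (pd X \<phi> u j) (pd N \<phi> u l))
        + alternate (\<lambda>i j l. det4 (y u) (n u) (frechet_derivative (\<lambda>u. pd X \<phi> u j) (at u) (axis i 1)) (pd N \<phi> u l))
        + alternate (\<lambda>i j l. det4 (y u) (n u) (pd X \<phi> u j) (frechet_derivative (\<lambda>u. pd N \<phi> u l) (at u) (axis i 1)))"
      unfolding dT[OF u] alternate_add ..
    also have "alternate (\<lambda>i j l. det4 (y u) (n u) (frechet_derivative (\<lambda>u. pd X \<phi> u j) (at u) (axis i 1)) (pd N \<phi> u l)) = 0"
      by (rule alternate_symmetric) (subst symX, rule refl)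
    also have "alternate (\<lambda>i j l. det4 (y u) (n u) (pd X \<phi> u j) (frechet_derivative (\<lambda>u. pd N \<phi> u l) (at u) (axis i 1))) = 0"
      by (rule alternate_symmetric') (subst symN, rule refl)
    \<comment> \<open>The term in which the undifferentiated normal of the 2-form is differentiated.
      It is a multiple of the scalar curvature; this is where R = 0 enters the divergence
      theorem.\<close>
    also have "alternate (\<lambda>i j l. det4 (y u) (pd N \<phi> u i) (pd X \<phi> u j) (pd N \<phi> u l)) = 0"
      by (rule curvature_formulas(2)[OF ch u R])
    finally show ?thesis using curvature_formulas(1)[OF ch u] by (simp add: n_def)
  qed
  show ?thesis
  proof (intro exI[of _ G] conjI allI impI ballI C1G)
    fix \<eta> :: "'m \<Rightarrow> real" and u assume \<eta>: "C1_map \<eta>" and u: "u \<in> U"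
    have "(\<Sum>i\<in>UNIV. pd \<eta> \<phi> u i * G i u) = alternate (\<lambda>i j l. pd \<eta> \<phi> u i * T j l u)"
      unfolding alternate_divergence by (simp add: sum_3 G)
    also have "\<dots> = - jac \<phi> u * (P1 \<A> X N (\<phi> u) (gradient \<A> X \<eta> (\<phi> u)) \<bullet> (X (\<phi> u) - c))"
      unfolding T_def y_def n_def using gradient_formulas(1)[OF ch u \<eta>, of "X (\<phi> u) - c"] by simp
    finally show "(\<Sum>i\<in>UNIV. pd \<eta> \<phi> u i * G i u + \<eta> (\<phi> u) * frechet_derivative (G i) (at u) (axis i 1)) = - jac \<phi> u * flux c \<eta> (\<phi> u)"
      by (simp add: sum.distrib sum_distrib_left[symmetric] div[OF u] flux_def algebra_simps)
  qed
qed

text \<open>In coordinates the flux times \<open>jac\<close> is, up to sign, a sum of partial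
  derivatives of compactly supported functions and so integrates to zero. The volume uses the
  absolute value of \<open>jac\<close>, which on a ball differs from \<open>jac\<close> by a
  constant sign.\<close>

lemma integral_flux_local:
  assumes ch: "(U, \<phi>) \<in> \<A>" and R: "\<And>p. scalar_curvature \<A> X N p = 0"
    and S: "ball u0 r \<subseteq> U" and K: "compact K" "K \<subseteq> \<phi> ` ball u0 r"
    and \<eta>: "C1_map \<eta>" "\<And>p. p \<notin> K \<Longrightarrow> \<eta> p = 0"
  shows "(LINT p|vol. flux c \<eta> p) = 0"
proof -
  obtain G :: "3 \<Rightarrow> real^3 \<Rightarrow> real" where G': "\<forall>i. C1_on U (G i)"
    "\<forall>\<eta>. C1_map \<eta> \<longrightarrow> (\<forall>u\<in>U. (\<Sum>i\<in>UNIV. pd \<eta> \<phi> u i * G i u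
        + \<eta> (\<phi> u) * frechet_derivative (G i) (at u) (axis i 1)) = - jac \<phi> u * flux c \<eta> (\<phi> u))"
    using coordinate_divergence[OF ch R, of c] by (elim exE conjE)
  have G: "C1_on U (G i)" for i using G'(1) by blast
  have G_div: "(\<Sum>i\<in>UNIV. pd \<eta> \<phi> u i * G i u
        + \<eta> (\<phi> u) * frechet_derivative (G i) (at u) (axis i 1)) = - jac \<phi> u * flux c \<eta> (\<phi> u)" if "u \<in> U" for u
    using G'(2) \<eta>(1) that by blast
  have closedK: "closed K" by (rule compact_imp_closed[OF K(1)])
  have KU: "K \<subseteq> \<phi> ` U" using K(2) S by blast
  define K' where "K' = inv_into U \<phi> ` K"
  have K': "compact K'"
    unfolding K'_def by (rule compact_continuous_image[OF continuous_on_subset[OF chart_continuous(2)[OF ch] KU] K(1)])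
  have notK: "\<phi> u \<notin> K" if "u \<in> U" "u \<notin> K'" for u
  proof
    assume "\<phi> u \<in> K"
    then have "inv_into U \<phi> (\<phi> u) \<in> K'" unfolding K'_def by (rule imageI)
    then show False using that by (simp add: chart_inv[OF ch])
  qed
  have K'S: "K' \<subseteq> ball u0 r"
  proof
    fix u assume "u \<in> K'"
    then obtain p where "p \<in> K" "u = inv_into U \<phi> p" unfolding K'_def by blast
    moreover then obtain v where "v \<in> ball u0 r" "p = \<phi> v" using K(2) by blast
    ultimately show "u \<in> ball u0 r" using chart_inv[OF ch, of v] S by auto
  qed
  \<comment> \<open>Extension by zero: \<open>F i\<close> is C1 on \<open>U\<close> and vanishes on
    the open complement of \<open>K'\<close>, and these two open sets cover 3-space.\<close>
  define F where "F i u = (if u \<in> U then \<eta> (\<phi> u) * G i u else 0)" for i u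
  have F0: "F i u = 0" if "u \<notin> K'" for i u
    using notK that \<eta>(2) unfolding F_def by auto
  have openU: "open U" by (rule chart_open(1)[OF ch])
  have C1\<eta>: "C1_on U (\<eta> \<circ> \<phi>)" by (rule C1_mapD[OF \<eta>(1) ch])
  have prod: "C1_on U (\<lambda>u. (\<eta> \<circ> \<phi>) u * G i u)" for i by (rule C1_on_mult[OF C1\<eta> G])
  have FU: "C1_on U (F i)" for i
    by (rule C1_on_cong[OF openU _ prod[of i]]) (simp add: F_def)
  have F1: "C1_on (- K') (F i)" for i
    by (rule C1_on_cong[OF _ _ C1_on_const[of _ 0]]) (use K' F0 in \<open>auto simp: compact_imp_closed\<close>)
  have UN: "U \<union> - K' = UNIV" using K'S S by blast
  have C1F: "C1_on UNIV (F i)" for i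
    using C1_on_Un[OF openU _ FU F1, of i] K' unfolding UN by (simp add: compact_imp_closed open_Compl)
  have FD: "(F i has_derivative frechet_derivative (F i) (at u)) (at u)" for i u
    by (rule C1_on_has_derivative[OF C1F UNIV_I])
  note parts = integral_directional_derivative_compact_support[OF FD C1_on_continuous_derivative[OF C1F] K']
  have int: "integrable lborel (\<lambda>u. frechet_derivative (F i) (at u) (axis i 1))" for i
    by (rule parts(1)) (rule F0)
  have int0: "(LINT u|lborel. frechet_derivative (F i) (at u) (axis i 1)) = 0" for i
    by (rule parts(2)) (rule F0)
  have dF: "frechet_derivative (F i) (at u) (axis i 1) = pd \<eta> \<phi> u i * G i u + \<eta> (\<phi> u) * frechet_derivative (G i) (at u) (axis i 1)"
    if u: "u \<in> U" for u i
  proof -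
    have "((\<lambda>u. (\<eta> \<circ> \<phi>) u * G i u) has_derivative (\<lambda>v. (\<eta> \<circ> \<phi>) u * frechet_derivative (G i) (at u) v
        + frechet_derivative (\<eta> \<circ> \<phi>) (at u) v * G i u)) (at u)"
      by (rule has_derivative_mult[OF C1_on_has_derivative[OF C1\<eta> u] C1_on_has_derivative[OF G u]])
    then have "(F i has_derivative (\<lambda>v. (\<eta> \<circ> \<phi>) u * frechet_derivative (G i) (at u) v
        + frechet_derivative (\<eta> \<circ> \<phi>) (at u) v * G i u)) (at u)"
      by (rule has_derivative_transform_within_open[OF _ openU u]) (simp add: F_def)
    from frechet_derivative_at[OF this, symmetric] show ?thesis by (simp add: pd_def)
  qed
  have divF: "(\<Sum>i\<in>UNIV. frechet_derivative (F i) (at u) (axis i 1)) = indicator U u * (- jac \<phi> u * flux c \<eta> (\<phi> u))" for u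
  proof (cases "u \<in> U")
    case True
    then show ?thesis using G_div[OF True] by (simp add: dF)
  next
    case False
    then have "u \<notin> K'" using K'S S by blast
    then have "frechet_derivative (F i) (at u) = (\<lambda>_. 0)" for i
      using has_derivative_zero_outside[OF FD compact_imp_closed[OF K'] F0] by blast
    then show ?thesis using False by simp
  qed
  have zero: "(LINT u|lborel. indicator U u * (jac \<phi> u * flux c \<eta> (\<phi> u))) = 0"
  proof -
    have "(LINT u|lborel. (\<Sum>i\<in>UNIV. frechet_derivative (F i) (at u) (axis i 1)))
        = (\<Sum>i\<in>UNIV. LINT u|lborel. frechet_derivative (F i) (at u) (axis i 1))"
      by (rule Bochner_Integration.integral_sum) (rule int)
    also have "\<dots> = 0" unfolding int0 by simp
    finally have "(LINT u|lborel. - (indicator U u * (jac \<phi> u * flux c \<eta> (\<phi> u)))) = 0"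
      unfolding divF by simp
    then show ?thesis by simp
  qed
  \<comment> \<open>The ball is connected and \<open>jac\<close> is continuous without zeros. The
    domain \<open>U\<close> itself may be disconnected, with different signs on its
    components.\<close>
  have "\<exists>s. \<forall>u\<in>ball u0 r. \<bar>jac \<phi> u\<bar> = s * jac \<phi> u"
  proof (rule ccontr)
    assume no: "\<not> ?thesis"
    have "\<exists>u\<in>ball u0 r. jac \<phi> u < 0"
      using no[unfolded not_ex, rule_format, of 1] by force
    moreover have "\<exists>u\<in>ball u0 r. jac \<phi> u > 0"
      using no[unfolded not_ex, rule_format, of "-1"] by force
    ultimately obtain u v where uv: "u \<in> ball u0 r" "v \<in> ball u0 r" "jac \<phi> u < 0" "jac \<phi> v > 0" by blast
    have "connected (jac \<phi> ` ball u0 r)"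
      by (rule connected_continuous_image[OF continuous_on_subset[OF jac_continuous[OF ch] S] connected_ball])
    then have "0 \<in> jac \<phi> ` ball u0 r"
      using uv connectedD_interval[of "jac \<phi> ` ball u0 r" "jac \<phi> u" "jac \<phi> v" 0] by auto
    then show False using jac_gram(1)[OF ch] S by auto
  qed
  then obtain s where s: "\<And>u. u \<in> ball u0 r \<Longrightarrow> \<bar>jac \<phi> u\<bar> = s * jac \<phi> u" by blast
  have flux0: "p \<notin> K \<Longrightarrow> flux c \<eta> p = 0" for p
    by (rule flux_zero_outside[OF \<eta>(1) closedK \<eta>(2)])
  have "(LINT p|vol. flux c \<eta> p) = (LINT u|lborel. (indicator U u *\<^sub>R vol_density \<phi> u) *\<^sub>R flux c \<eta> (\<phi> u))"
    by (rule integral_vol_chart[OF ch borel_measurable_continuous_onI[OF flux_continuous[OF \<eta>(1)]]])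
       (use flux0 KU in blast)
  also have "\<dots> = (LINT u|lborel. s * (indicator U u * (jac \<phi> u * flux c \<eta> (\<phi> u))))"
  proof (rule Bochner_Integration.integral_cong[OF refl])
    fix u
    show "(indicator U u *\<^sub>R vol_density \<phi> u) *\<^sub>R flux c \<eta> (\<phi> u) = s * (indicator U u * (jac \<phi> u * flux c \<eta> (\<phi> u)))"
    proof (cases "u \<in> ball u0 r")
      case True
      then have "u \<in> U" using S by blast
      then show ?thesis using s[OF True] by (simp add: vol_density_jac[OF ch])
    next
      case False
      show ?thesis
      proof (cases "u \<in> U")
        case True
        have "\<phi> u \<notin> K" using notK[OF True] False K'S by blast
        then show ?thesis using flux0 by simp
      qed simp
    qed
  qed
  also have "\<dots> = 0" using zero by simp
  finally show ?thesis .
qed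

end

section \<open>Cut-off functions and globalisation of the divergence theorem\<close>

lemma C1_on_pos_part_square: "C1_on UNIV (\<lambda>s::real. (max 0 s)\<^sup>2)"
proof (rule C1_onI)
  fix s :: real
  have "((\<lambda>s. (max 0 s)\<^sup>2) has_real_derivative 2 * max 0 s) (at s)"
  proof -
    consider "s > 0" | "s < 0" | "s = 0" by linarith
    then show ?thesis
    proof cases
      case 1
      have "((\<lambda>s. s\<^sup>2) has_real_derivative 2 * s) (at s)" by (auto intro!: derivative_eq_intros)
      then have "((\<lambda>s. (max 0 s)\<^sup>2) has_real_derivative 2 * s) (at s)"
        by (rule has_field_derivative_transform_within_open[of _ _ _ "{0<..}"]) (use 1 in auto)
      then show ?thesis using 1 by simp
    next
      case 2
      have "((\<lambda>s. 0) has_real_derivative 0) (at s)" by simp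
      then have "((\<lambda>s. (max 0 s)\<^sup>2) has_real_derivative 0) (at s)"
        by (rule has_field_derivative_transform_within_open[of _ _ _ "{..<0}"]) (use 2 in auto)
      then show ?thesis using 2 by simp
    next
      case 3
      have "((\<lambda>h. (max 0 h)\<^sup>2 / h) \<longlongrightarrow> 0) (at (0::real))"
      proof (rule Lim_null_comparison)
        show "\<forall>\<^sub>F h in at 0. norm ((max 0 h)\<^sup>2 / h) \<le> \<bar>h\<bar>"
          by (rule always_eventually) (auto simp: max_def power2_eq_square)
        show "((\<lambda>h. \<bar>h\<bar>) \<longlongrightarrow> 0) (at (0::real))" by (auto intro!: tendsto_eq_intros)
      qed
      then show ?thesis using 3 by (simp add: has_field_derivative_iff)
    qed
  qed
  then show "((\<lambda>s. (max 0 s)\<^sup>2) has_derivative (\<lambda>v. (2 * max 0 s) * v)) (at s)"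
    by (simp add: has_field_derivative_def)
qed (intro continuous_intros)

context hypersurface
begin

text \<open>A radial cut-off in one chart, extended by zero. In any other chart it is C1 because the
  preimage of the first chart image and the preimage of the complement of the compact support form
  an open cover.\<close>

lemma bump_function:
  fixes p :: 'm
  shows "\<exists>b. C1_map b \<and> (\<forall>q. b q \<ge> (0::real)) \<and> b p > 0 \<and>
    (\<exists>U \<phi> u \<epsilon>. (U, \<phi>) \<in> \<A> \<and> cball u (2 * \<epsilon>) \<subseteq> U \<and> \<epsilon> > 0 \<and> (\<forall>q. q \<notin> \<phi> ` cball u \<epsilon> \<longrightarrow> b q = 0))"
proof -
  obtain U \<phi> u \<epsilon> where c: "(U, \<phi>) \<in> \<A>" and \<epsilon>: "\<epsilon> > 0" "cball u (2 * \<epsilon>) \<subseteq> U" "\<phi> u = p" by (rule chart_ball)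
  have uU: "u \<in> U" "cball u \<epsilon> \<subseteq> U" using \<epsilon> by (auto simp: subset_eq)
  \<comment> \<open>Squaring the positive part makes the function C1 across the sphere of radius
    \<open>\<epsilon>\<close>.\<close>
  define \<beta> where "\<beta> v = (max 0 (\<epsilon>\<^sup>2 - (v - u) \<bullet> (v - u)))\<^sup>2" for v
  have id: "C1_on UNIV (\<lambda>v. v - u)"
    by (rule C1_on_diff[OF _ C1_on_const]) (rule C1_onI[where f'="\<lambda>_ v. v"], auto)
  have \<beta>: "C1_on UNIV \<beta>"
    unfolding \<beta>_def
    by (rule C1_on_compose[OF C1_on_diff[OF C1_on_const C1_on_inner[OF id id]] C1_on_pos_part_square]) simp
  have \<beta>0: "\<beta> v = 0" if "v \<notin> cball u \<epsilon>" for v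
  proof -
    have "\<epsilon> < norm (v - u)" using that by (simp add: dist_norm norm_minus_commute)
    then have "\<epsilon>\<^sup>2 < (norm (v - u))\<^sup>2" using \<epsilon>(1) by (intro power_strict_mono) auto
    then show ?thesis by (simp add: \<beta>_def power2_norm_eq_inner)
  qed
  define b where "b q = (if q \<in> \<phi> ` U then \<beta> (inv_into U \<phi> q) else 0)" for q
  have b0: "b q = 0" if "q \<notin> \<phi> ` cball u \<epsilon>" for q
  proof (cases "q \<in> \<phi> ` U")
    case True
    then obtain v where v: "v \<in> U" "q = \<phi> v" by blast
    then have "v \<notin> cball u \<epsilon>" using that by blast
    then show ?thesis using v \<beta>0 by (simp add: b_def chart_inv[OF c])
  qed (simp add: b_def)
  have comp: "compact (\<phi> ` cball u \<epsilon>)"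
    by (rule compact_continuous_image[OF continuous_on_subset[OF chart_continuous(1)[OF c] uU(2)] compact_cball])
  have "C1_map b"
    unfolding C1_map_iff
  proof (intro allI impI)
    fix V \<psi> assume d: "(V, \<psi>) \<in> \<A>"
    let ?O1 = "V \<inter> \<psi> -` (\<phi> ` U)" and ?O2 = "V \<inter> \<psi> -` (- \<phi> ` cball u \<epsilon>)"
    have "C1_on ?O1 (\<lambda>v. \<beta> ((inv_into U \<phi> \<circ> \<psi>) v))"
      by (rule C1_on_compose[OF transition(2)[OF d c] \<beta>]) simp
    then have 1: "C1_on ?O1 (\<lambda>v. b (\<psi> v))"
      by (rule C1_on_cong[OF transition(1)[OF d c], rotated]) (simp add: b_def)
    have op2: "open ?O2"
      by (rule chart_open_preimage[OF d]) (use compact_imp_closed[OF comp] in auto)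
    have 2: "C1_on ?O2 (\<lambda>v. b (\<psi> v))"
      by (rule C1_on_cong[OF op2 _ C1_on_const[of _ 0]]) (simp add: b0)
    have "?O1 \<union> ?O2 = V" using uU(2) by blast
    then show "C1_on V (\<lambda>v. b (\<psi> v))"
      using C1_on_Un[OF transition(1)[OF d c] op2 1 2] by simp
  qed
  moreover have "\<forall>q. b q \<ge> 0" by (simp add: b_def \<beta>_def)
  moreover have "b p > 0"
    using \<epsilon> uU(1) chart_inv[OF c uU(1)] by (auto simp: b_def \<beta>_def)
  ultimately show ?thesis using c \<epsilon>(1,2) b0 by blast
qed

text \<open>Where \<open>h\<close> is nonzero the quotient rule applies; off the closed set
  \<open>K\<close> the numerator, hence the quotient, is zero. The two open sets cover the manifold,
  so zeros of \<open>h\<close> away from \<open>K\<close> do no harm.\<close>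

lemma C1_map_divide:
  fixes f h :: "'m \<Rightarrow> real"
  assumes f: "C1_map f" and h: "C1_map h" and K: "closed K" "\<And>p. p \<notin> K \<Longrightarrow> f p = 0" "\<And>p. p \<in> K \<Longrightarrow> h p \<noteq> 0"
  shows "C1_map (\<lambda>p. f p / h p)"
  unfolding C1_map_iff
proof (intro allI impI)
  fix V \<psi> assume d: "(V, \<psi>) \<in> \<A>"
  let ?O1 = "V \<inter> \<psi> -` {p. h p \<noteq> 0}" and ?O2 = "V \<inter> \<psi> -` (- K)"
  have op1: "open ?O1"
    by (rule chart_open_preimage[OF d]) (intro open_Collect_neq C1_map_imp_continuous[OF h] continuous_on_const)
  have op2: "open ?O2" by (rule chart_open_preimage[OF d]) (use K(1) in auto)
  have "C1_on V (\<lambda>v. f (\<psi> v))" "C1_on V (\<lambda>v. h (\<psi> v))" using f h d unfolding C1_map_iff by blast+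
  then have 1: "C1_on ?O1 (\<lambda>v. f (\<psi> v) / h (\<psi> v))"
    by (intro C1_on_divide) (auto intro: C1_on_subset)
  have 2: "C1_on ?O2 (\<lambda>v. f (\<psi> v) / h (\<psi> v))"
    by (rule C1_on_cong[OF op2 _ C1_on_const[of _ 0]]) (use K(2) in auto)
  have "?O1 \<union> ?O2 = V" using K(3) by blast
  then show "C1_on V (\<lambda>v. f (\<psi> v) / h (\<psi> v))" using C1_on_Un[OF op1 op2 1 2] by simp
qed

lemma pd_sum:
  assumes c: "(U, \<phi>) \<in> \<A>" "u \<in> U" and f: "\<And>k. k \<in> I \<Longrightarrow> C1_map (f k)"
  shows "pd (\<lambda>p. \<Sum>k\<in>I. f k p) \<phi> u i = (\<Sum>k\<in>I. pd (f k) \<phi> u i)"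
proof -
  have "((\<lambda>u. \<Sum>k\<in>I. (f k \<circ> \<phi>) u) has_derivative (\<lambda>v. \<Sum>k\<in>I. frechet_derivative (f k \<circ> \<phi>) (at u) v)) (at u)"
    by (rule has_derivative_sum) (rule C1_on_has_derivative[OF C1_mapD[OF f c(1)] c(2)])
  from frechet_derivative_at[OF this, symmetric] show ?thesis
    by (simp add: pd_def o_def)
qed

text \<open>The determinant formula is linear in the partial derivatives, and dividing by
  \<open>jac\<close> returns linearity of the flux term.\<close>

lemma flux_sum:
  assumes f: "\<And>k. k \<in> I \<Longrightarrow> C1_map (f k)"
  shows "flux c (\<lambda>p. \<Sum>k\<in>I. f k p) p = (\<Sum>k\<in>I. flux c (f k) p)"
proof -
  obtain U \<phi> u where ch: "(U, \<phi>) \<in> \<A>" "u \<in> U" and p: "\<phi> u = p" by (rule chart_cover)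
  define T where "T j l = det4 (X p - c) (N p) (pd X \<phi> u j) (pd N \<phi> u l)" for j l
  have P: "- jac \<phi> u * (P1 \<A> X N p (gradient \<A> X h p) \<bullet> (X p - c)) = alternate (\<lambda>i j l. pd h \<phi> u i * T j l)"
    if "C1_map h" for h
    using gradient_formulas(1)[OF ch that, of "X p - c"] by (simp add: p T_def)
  have C1: "C1_map (\<lambda>p. \<Sum>k\<in>I. f k p)" by (rule C1_map_sum[OF f])
  have pd: "pd (\<lambda>p. \<Sum>k\<in>I. f k p) \<phi> u = (\<lambda>i. \<Sum>k\<in>I. pd (f k) \<phi> u i)"
    by (rule ext) (rule pd_sum[OF ch f])
  have "- jac \<phi> u * (P1 \<A> X N p (gradient \<A> X (\<lambda>p. \<Sum>k\<in>I. f k p) p) \<bullet> (X p - c))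
      = alternate (\<lambda>i j l. (\<Sum>k\<in>I. pd (f k) \<phi> u i) * T j l)"
    unfolding P[OF C1] pd ..
  also have "\<dots> = (\<Sum>k\<in>I. alternate (\<lambda>i j l. pd (f k) \<phi> u i * T j l))"
    unfolding alternate_divergence by (simp add: sum_distrib_right sum.distrib)
  also have "\<dots> = (\<Sum>k\<in>I. - jac \<phi> u * (P1 \<A> X N p (gradient \<A> X (f k) p) \<bullet> (X p - c)))"
    by (rule sum.cong[OF refl]) (rule P[OF f, symmetric])
  also have "\<dots> = - jac \<phi> u * (\<Sum>k\<in>I. P1 \<A> X N p (gradient \<A> X (f k) p) \<bullet> (X p - c))"
    by (rule sum_distrib_left[symmetric])
  finally have "P1 \<A> X N p (gradient \<A> X (\<lambda>p. \<Sum>k\<in>I. f k p) p) \<bullet> (X p - c)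
      = (\<Sum>k\<in>I. P1 \<A> X N p (gradient \<A> X (f k) p) \<bullet> (X p - c))"
    using jac_gram(1)[OF ch] by simp
  then show ?thesis by (simp add: flux_def sum.distrib sum_distrib_left)
qed

text \<open>Partition of unity on the compact support: finitely many bump functions have a positive
  sum on \<open>K\<close>, and normalising by it splits \<open>\<eta>\<close> into pieces each
  supported in one coordinate ball.\<close>

lemma integral_flux:
  assumes R: "\<And>p. scalar_curvature \<A> X N p = 0"
    and \<eta>: "C1_map \<eta>" and K: "compact K" "\<And>p. p \<notin> K \<Longrightarrow> \<eta> p = 0"
  shows "(LINT p|vol. flux c \<eta> p) = 0"
proof -
  have "\<exists>b. \<forall>p. C1_map (b p) \<and> (\<forall>q. b p q \<ge> (0::real)) \<and> b p p > 0 \<and>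
    (\<exists>U \<phi> u \<epsilon>. (U, \<phi>) \<in> \<A> \<and> cball u (2 * \<epsilon>) \<subseteq> U \<and> \<epsilon> > 0 \<and> (\<forall>q. q \<notin> \<phi> ` cball u \<epsilon> \<longrightarrow> b p q = 0))"
    by (rule choice, rule allI, rule bump_function)
  then obtain b where b: "\<forall>p. C1_map (b p) \<and> (\<forall>q. b p q \<ge> (0::real)) \<and> b p p > 0 \<and>
    (\<exists>U \<phi> u \<epsilon>. (U, \<phi>) \<in> \<A> \<and> cball u (2 * \<epsilon>) \<subseteq> U \<and> \<epsilon> > 0 \<and> (\<forall>q. q \<notin> \<phi> ` cball u \<epsilon> \<longrightarrow> b p q = 0))"
    by (rule exE)
  then have C1b: "C1_map (b p)" for p by blast
  have op: "open {q. b p q > 0}" for p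
    by (intro open_Collect_less continuous_on_const C1_map_imp_continuous[OF C1b])
  obtain P where P: "P \<subseteq> K" "finite P" "K \<subseteq> (\<Union>p\<in>P. {q. b p q > 0})"
  proof (rule compactE_image[OF K(1), of K "\<lambda>p. {q. b p q > 0}"])
    show "open {q. b p q > 0}" for p by (rule op)
    show "K \<subseteq> (\<Union>p\<in>K. {q. b p q > 0})" using b by blast
  qed
  define B where "B q = (\<Sum>p\<in>P. b p q)" for q
  have C1B: "C1_map B" unfolding B_def by (rule C1_map_sum[OF C1b])
  have B: "B q \<noteq> 0" if "q \<in> K" for q
  proof -
    from subsetD[OF P(3) that] obtain p where p: "p \<in> P" "b p q > 0" by blast
    have "B q > 0" unfolding B_def by (rule sum_pos2[where f="\<lambda>p. b p q", OF P(2) p]) (use b in blast)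
    then show ?thesis by simp
  qed
  \<comment> \<open>The sum \<open>B\<close> may vanish off \<open>K\<close>, but
    \<open>\<eta>\<close> is zero there, so the quotient remains C1.\<close>
  define f where "f p q = \<eta> q * b p q / B q" for p q
  have clK: "closed K" by (rule compact_imp_closed[OF K(1)])
  have C1f: "C1_map (f p)" for p
    unfolding f_def by (rule C1_map_divide[OF C1_map_mult[OF \<eta> C1b] C1B clK _ B]) (use K(2) in auto)
  have sum: "\<eta> = (\<lambda>q. \<Sum>p\<in>P. f p q)"
  proof
    fix q
    show "\<eta> q = (\<Sum>p\<in>P. f p q)"
    proof (cases "q \<in> K")
      case True
      have "(\<Sum>p\<in>P. f p q) = \<eta> q * B q / B q"
        unfolding f_def B_def by (simp add: sum_divide_distrib sum_distrib_left)
      then show ?thesis using B[OF True] by simp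
    qed (simp add: f_def K(2))
  qed
  have zero: "(LINT q|vol. flux c (f p) q) = 0" for p
  proof -
    obtain U \<phi> u \<epsilon> where c: "(U, \<phi>) \<in> \<A>" "cball u (2 * \<epsilon>) \<subseteq> U" "\<epsilon> > 0" "\<forall>q. q \<notin> \<phi> ` cball u \<epsilon> \<longrightarrow> b p q = 0"
      using conjunct2[OF conjunct2[OF conjunct2[OF spec[OF b, of p]]]] by (elim exE conjE)
    have S: "ball u (2 * \<epsilon>) \<subseteq> U" "cball u \<epsilon> \<subseteq> ball u (2 * \<epsilon>)" using c(2,3) by (auto simp: subset_eq)
    have comp: "compact (\<phi> ` cball u \<epsilon>)"
      by (rule compact_continuous_image[OF continuous_on_subset[OF chart_continuous(1)[OF c(1)] subset_trans[OF S(2,1)]] compact_cball])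
    show ?thesis
      by (rule integral_flux_local[OF c(1) R S(1) comp image_mono[OF S(2)] C1f]) (use c(4) in \<open>simp add: f_def\<close>)
  qed
  have "integrable vol (flux c (f p))" for p
    by (rule integrable_compact_support[OF flux_continuous[OF C1f] K(1)])
       (rule flux_zero_outside[OF C1f clK], simp_all add: f_def K(2))
  then have "(LINT q|vol. (\<Sum>p\<in>P. flux c (f p) q)) = (\<Sum>p\<in>P. LINT q|vol. flux c (f p) q)"
    by (rule Bochner_Integration.integral_sum)
  moreover have "flux c \<eta> q = (\<Sum>p\<in>P. flux c (f p) q)" for q
    by (subst sum) (rule flux_sum[OF C1f])
  ultimately show ?thesis using zero by simp
qed

section \<open>Gradients of the comparison functions and Picone's identity\<close>

lemma gradient_pd:
  assumes c: "(U, \<phi>) \<in> \<A>" "u \<in> U" and h: "C1_map h"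
  shows "gradient \<A> X h (\<phi> u) \<bullet> pd X \<phi> u i = pd h \<phi> u i"
proof -
  obtain e where e: "principal_frame (\<phi> u) e" using principal_frame_exists by blast
  show ?thesis
    unfolding gradient_frame[OF e h] pd_differential[OF c h] differential_frame[OF e h pd_tangent[OF c]]
    by (simp add: inner_sum_left inner_sum_right inner_commute mult.commute)
qed

text \<open>The coordinate vectors span the tangent space, so the difference of the two vectors is
  orthogonal to itself.\<close>

lemma tangent_eqI:
  assumes c: "(U, \<phi>) \<in> \<A>" "u \<in> U" and v: "v \<in> tangent_space \<A> X (\<phi> u)" "w \<in> tangent_space \<A> X (\<phi> u)"
    and eq: "\<And>i. v \<bullet> pd X \<phi> u i = w \<bullet> pd X \<phi> u i"
  shows "v = w"
proof -
  have lin: "linear (frechet_derivative (X \<circ> \<phi>) (at u))"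
    by (rule C1_on_linear[OF C1_mapD[OF C1_XN(1) c(1)] c(2)])
  have "v - w \<in> tangent_space \<A> X (\<phi> u)" by (rule subspace_diff[OF tangent_space_props(1)[OF c] v])
  then obtain a where a: "v - w = frechet_derivative (X \<circ> \<phi>) (at u) a"
    using tangent_space_chart[OF c] by auto
  have "a = (\<Sum>i\<in>UNIV. a $ i *\<^sub>R axis i 1)"
    using basis_expansion[of a] by (simp add: scalar_mult_eq_scaleR)
  then have "frechet_derivative (X \<circ> \<phi>) (at u) a = frechet_derivative (X \<circ> \<phi>) (at u) (\<Sum>i\<in>UNIV. a $ i *\<^sub>R axis i 1)"
    by (rule arg_cong)
  also have "\<dots> = (\<Sum>i\<in>UNIV. a $ i *\<^sub>R pd X \<phi> u i)"
    using lin by (simp add: pd_def linear_sum linear_scale)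
  finally have "(v - w) \<bullet> (v - w) = (v - w) \<bullet> (\<Sum>i\<in>UNIV. a $ i *\<^sub>R pd X \<phi> u i)" unfolding a by simp
  also have "\<dots> = 0" using eq by (simp add: inner_sum_right inner_diff_left)
  finally show ?thesis by simp
qed

lemma pd_C1_has_derivative:
  assumes c: "(U, \<phi>) \<in> \<A>" "u \<in> U" and h: "C1_map h"
  shows "((\<lambda>u. h (\<phi> u)) has_derivative frechet_derivative (h \<circ> \<phi>) (at u)) (at u)"
  using C1_on_has_derivative[OF C1_mapD[OF h c(1)] c(2)] by (simp add: o_def)

lemma pd_eqI:
  assumes "((\<lambda>u. h (\<phi> u)) has_derivative D) (at u)"
  shows "pd h \<phi> u i = D (axis i 1)"
  unfolding pd_def using frechet_derivative_at[OF assms] by (simp add: o_def)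

lemma gradient_quotient:
  fixes g h :: "'m \<Rightarrow> real"
  assumes g: "C1_map g" and h: "C1_map h" and q: "C1_map (\<lambda>p. g p * g p / h p)" and nz: "h p \<noteq> 0"
  shows "gradient \<A> X (\<lambda>p. g p * g p / h p) p
       = (2 * g p / h p) *\<^sub>R gradient \<A> X g p + (- (g p / h p)\<^sup>2) *\<^sub>R gradient \<A> X h p"
proof -
  obtain U \<phi> u where c: "(U, \<phi>) \<in> \<A>" "u \<in> U" and p: "\<phi> u = p" by (rule chart_cover)
  have nz': "h (\<phi> u) \<noteq> 0" using nz p by simp
  have sub: "subspace (tangent_space \<A> X (\<phi> u))" by (rule tangent_space_props(1)[OF c])
  have d: "((\<lambda>u. g (\<phi> u) * g (\<phi> u) / h (\<phi> u)) has_derivative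
     (\<lambda>v. (2 * g (\<phi> u) / h (\<phi> u)) * frechet_derivative (g \<circ> \<phi>) (at u) v - (g (\<phi> u) / h (\<phi> u))\<^sup>2 * frechet_derivative (h \<circ> \<phi>) (at u) v)) (at u)"
    by (rule has_derivative_eq_rhs[OF has_derivative_divide'[OF has_derivative_mult[OF pd_C1_has_derivative[OF c g] pd_C1_has_derivative[OF c g]]
            pd_C1_has_derivative[OF c h] nz']])
       (use nz' in \<open>simp add: fun_eq_iff field_simps power2_eq_square\<close>)
  show ?thesis
    unfolding p[symmetric]
  proof (rule tangent_eqI[OF c gradient_tangent[OF q]])
    show "(2 * g (\<phi> u) / h (\<phi> u)) *\<^sub>R gradient \<A> X g (\<phi> u) + (- (g (\<phi> u) / h (\<phi> u))\<^sup>2) *\<^sub>R gradient \<A> X h (\<phi> u)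
        \<in> tangent_space \<A> X (\<phi> u)"
      by (intro subspace_add[OF sub] subspace_scale[OF sub] gradient_tangent g h)
    fix i
    show "gradient \<A> X (\<lambda>p. g p * g p / h p) (\<phi> u) \<bullet> pd X \<phi> u i =
        ((2 * g (\<phi> u) / h (\<phi> u)) *\<^sub>R gradient \<A> X g (\<phi> u) + (- (g (\<phi> u) / h (\<phi> u))\<^sup>2) *\<^sub>R gradient \<A> X h (\<phi> u)) \<bullet> pd X \<phi> u i"
      unfolding gradient_pd[OF c q] inner_add_left inner_scaleR_left gradient_pd[OF c g] gradient_pd[OF c h]
        pd_eqI[OF d] by (simp add: pd_def)
  qed
qed

lemma gradient_distance:
  fixes c :: "real^4" and C :: real
  defines "h \<equiv> \<lambda>p. C - (X p - c) \<bullet> (X p - c)"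
  shows "C1_map h" and "w \<in> tangent_space \<A> X p \<Longrightarrow> gradient \<A> X h p \<bullet> w = - 2 * ((X p - c) \<bullet> w)"
proof -
  show h: "C1_map h"
    unfolding h_def by (intro C1_map_diff C1_map_const C1_map_inner C1_XN)
  assume w: "w \<in> tangent_space \<A> X p"
  obtain U \<phi> u where ch: "(U, \<phi>) \<in> \<A>" "u \<in> U" and p: "\<phi> u = p" by (rule chart_cover)
  have lin: "linear (frechet_derivative (X \<circ> \<phi>) (at u))"
    by (rule C1_on_linear[OF C1_mapD[OF C1_XN(1) ch(1)] ch(2)])
  note dX = has_derivative_diff[OF pd_C1_has_derivative[OF ch C1_XN(1)] has_derivative_const[of c]]
  have d: "((\<lambda>u. h (\<phi> u)) has_derivative (\<lambda>v. - 2 * ((X (\<phi> u) - c) \<bullet> frechet_derivative (X \<circ> \<phi>) (at u) v))) (at u)"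
    unfolding h_def
    by (rule has_derivative_eq_rhs[OF has_derivative_diff[OF has_derivative_const bounded_bilinear.FDERIV[OF bounded_bilinear_inner dX dX]]])
       (simp add: fun_eq_iff inner_commute)
  have "w \<in> range (frechet_derivative (X \<circ> \<phi>) (at u))" using w tangent_space_chart[OF ch] p by simp
  then obtain a where a: "w = frechet_derivative (X \<circ> \<phi>) (at u) a" by blast
  have "gradient \<A> X h p \<bullet> w = differential \<A> X h p w"
  proof -
    obtain e where e: "principal_frame p e" using principal_frame_exists by blast
    show ?thesis
      unfolding gradient_frame[OF e h] differential_frame[OF e h w]
      by (simp add: inner_sum_left inner_sum_right inner_commute mult.commute)
  qed
  also have "\<dots> = frechet_derivative (h \<circ> \<phi>) (at u) a"
    unfolding a p[symmetric] by (rule differential_chart[OF ch h])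
  also have "\<dots> = - 2 * ((X p - c) \<bullet> w)"
    using frechet_derivative_at[OF d] by (simp add: o_def a p fun_eq_iff)
  finally show "gradient \<A> X h p \<bullet> w = - 2 * ((X p - c) \<bullet> w)" .
qed

lemma P1_tangent:
  assumes w: "w \<in> tangent_space \<A> X p" shows "P1 \<A> X N p w \<in> tangent_space \<A> X p"
proof -
  obtain e where e: "principal_frame p e" using principal_frame_exists by blast
  obtain U \<phi> u where c: "(U, \<phi>) \<in> \<A>" "u \<in> U" and p: "\<phi> u = p" by (rule chart_cover)
  have sub: "subspace (tangent_space \<A> X p)" using tangent_space_props(1)[OF c] p by simp
  have "e a \<in> tangent_space \<A> X p" for a using e unfolding principal_frame_def by blast
  then show ?thesis
    unfolding P1_frame[OF e w] by (intro subspace_sum[OF sub] subspace_scale[OF sub])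
qed

text \<open>Picone's identity for the quadratic form of \<open>P\<^sub>1\<close>, with the comparison function
  \<open>h = C - \<bar>X - c\<bar>\<^sup>2\<close>, whose gradient is \<open>- 2\<close> times the tangential part of \<open>X - c\<close>.\<close>

lemma picone:
  fixes c :: "real^4" and C :: real
  defines "h \<equiv> \<lambda>p. C - (X p - c) \<bullet> (X p - c)"
  assumes R: "scalar_curvature \<A> X N p = 0" and g: "C1_map g" and q: "C1_map (\<lambda>p. g p * g p / h p)" and nz: "h p \<noteq> 0"
    and s: "s * mean_curvature \<A> X N p > 0"
  shows "s * (P1 \<A> X N p (gradient \<A> X g p) \<bullet> gradient \<A> X g p)
       \<ge> s * (- 2 * (P1 \<A> X N p (gradient \<A> X (\<lambda>p. g p * g p / h p) p) \<bullet> (X p - c)))"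
proof -
  have h: "C1_map h" unfolding h_def by (rule gradient_distance(1))
  define G V E where "G = gradient \<A> X g p" and "V = gradient \<A> X h p" and "E = gradient \<A> X (\<lambda>p. g p * g p / h p) p"
  define t where "t = g p / h p"
  let ?P = "P1 \<A> X N p"
  have T: "G \<in> tangent_space \<A> X p" "V \<in> tangent_space \<A> X p" "E \<in> tangent_space \<A> X p"
    unfolding G_def V_def E_def by (intro gradient_tangent g h q)+
  have E: "E = (2 * t) *\<^sub>R G + (- t\<^sup>2) *\<^sub>R V"
    unfolding E_def G_def V_def t_def using gradient_quotient[OF g h q nz] by simp
  obtain U \<phi> u where c: "(U, \<phi>) \<in> \<A>" "u \<in> U" and p: "\<phi> u = p" by (rule chart_cover)
  have sub: "subspace (tangent_space \<A> X p)" using tangent_space_props(1)[OF c] p by simp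
  have W: "1 *\<^sub>R G + (- t) *\<^sub>R V \<in> tangent_space \<A> X p"
    by (intro subspace_add[OF sub] subspace_scale[OF sub] T)
  have sym: "?P V \<bullet> G = ?P G \<bullet> V" by (rule P1_symmetric[OF T(2,1)])
  have "V \<bullet> ?P E = - 2 * ((X p - c) \<bullet> ?P E)"
    unfolding V_def h_def by (rule gradient_distance(2)[OF P1_tangent[OF T(3)]])
  then have 1: "- 2 * (?P E \<bullet> (X p - c)) = ?P E \<bullet> V" by (simp add: inner_commute)
  have 2: "?P E \<bullet> V = 2 * t * (?P G \<bullet> V) - t\<^sup>2 * (?P V \<bullet> V)"
    unfolding E P1_add_scale[OF T(1,2)] by (simp add: inner_diff_left)
  \<comment> \<open>Completing the square: the difference of the two sides of the claim, apart from
    \<open>s\<close>, is the quadratic form of \<open>P1\<close> at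
    \<open>G - t *\<^sub>R V\<close>, which is semidefinite with the sign of the mean
    curvature.\<close>
  have 3: "?P (1 *\<^sub>R G + (- t) *\<^sub>R V) \<bullet> (1 *\<^sub>R G + (- t) *\<^sub>R V) = ?P G \<bullet> G - ?P E \<bullet> V"
    unfolding 2 P1_add_scale[OF T(1,2)]
    by (simp add: inner_add_left inner_add_right inner_diff_left inner_diff_right sym power2_eq_square algebra_simps)
  have "mean_curvature \<A> X N p * (?P G \<bullet> G - ?P E \<bullet> V) \<ge> 0"
    using P1_semidefinite[OF R W] unfolding 3 .
  \<comment> \<open>Multiplying by a square and regrouping transfers the sign from the mean
    curvature to \<open>s\<close>, which has the same sign; both orientations are treated at
    once.\<close>
  then have "(s * s) * (mean_curvature \<A> X N p * (?P G \<bullet> G - ?P E \<bullet> V)) \<ge> 0"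
    by (rule mult_nonneg_nonneg[OF zero_le_square])
  then have "(s * mean_curvature \<A> X N p) * (s * (?P G \<bullet> G - ?P E \<bullet> V)) \<ge> 0"
    by (simp add: mult_ac)
  then have "s * (?P G \<bullet> G - ?P E \<bullet> V) \<ge> 0"
    using s by (simp add: zero_le_mult_iff)
  then show ?thesis
    using 1 unfolding G_def E_def by (simp add: right_diff_distrib)
qed

end

subsection \<open>Stability\<close>

context hypersurface
begin

text \<open>A constant \<open>X\<close> near a point would have vanishing derivatives there,
  contradicting \<open>jac\<close> being nonzero. It ensures that the enclosing radius is
  positive.\<close>

lemma X_not_constant:
  assumes G: "open G" "G \<noteq> {}"
  shows "\<exists>p\<in>G. \<exists>q\<in>G. X p \<noteq> X q"
proof (rule ccontr)
  assume no: "\<not> ?thesis"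
  obtain p where p: "p \<in> G" using G(2) by blast
  have const: "X q = X p" if "q \<in> G" for q using no that p by blast
  obtain U \<phi> u where c: "(U, \<phi>) \<in> \<A>" "u \<in> U" "\<phi> u = p" by (rule chart_cover)
  have op: "open (U \<inter> \<phi> -` G)" by (rule chart_open_preimage[OF c(1) G(1)])
  have "((\<lambda>u. X (\<phi> u)) has_derivative (\<lambda>_. 0)) (at u)"
  proof (rule has_derivative_transform_within_open[OF has_derivative_const[of "X p"] op])
    show "u \<in> U \<inter> \<phi> -` G" using c p by simp
    show "X p = X (\<phi> v)" if "v \<in> U \<inter> \<phi> -` G" for v
      by (rule const[symmetric]) (use that in simp)
  qed
  then have "pd X \<phi> u i = 0" for i by (rule pd_eqI)
  then have "jac \<phi> u = 0" by (simp add: jac_def det4_def)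
  then show False using jac_gram(1)[OF c(1,2)] by simp
qed

text \<open>Any ball containing two distinct image points has radius at least half their distance,
  hence \<open>r > 0\<close>. A ball of radius strictly above the infimum always exists, which is
  why the conclusion has \<open>2 * r\<^sup>2\<close> in place of \<open>r\<^sup>2\<close>.\<close>

lemma enclosing_ball:
  assumes G: "open G" "G \<noteq> {}" "compact (closure G)"
  defines "r \<equiv> enclosing_radius (X ` G)"
  shows "r > 0" and "\<exists>c. \<forall>p\<in>G. (X p - c) \<bullet> (X p - c) \<le> 2 * r\<^sup>2"
proof -
  let ?S = "{r. \<exists>c. X ` G \<subseteq> cball c r}"
  have "bounded (X ` closure G)"
    by (intro compact_imp_bounded compact_continuous_image G continuous_on_subset[OF C1_map_imp_continuous[OF C1_XN(1)]]) simp
  then have "bounded (X ` G)" by (rule bounded_subset) (intro image_mono closure_subset)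
  then obtain c0 r0 where "X ` G \<subseteq> cball c0 r0"
    unfolding bounded_subset_cball by blast
  then have ne: "?S \<noteq> {}" by blast
  obtain p q where pq: "p \<in> G" "q \<in> G" "X p \<noteq> X q" using X_not_constant[OF G(1,2)] by blast
  have "dist (X p) (X q) / 2 \<le> r"
    unfolding r_def enclosing_radius_def
  proof (rule cInf_greatest[OF ne])
    fix r' assume "r' \<in> ?S"
    then obtain c where "X ` G \<subseteq> cball c r'" by blast
    then have "dist c (X p) \<le> r'" "dist c (X q) \<le> r'" using pq by auto
    then show "dist (X p) (X q) / 2 \<le> r'" using dist_triangle3[of "X p" "X q" c] by simp
  qed
  moreover have "dist (X p) (X q) > 0" using pq by simp
  ultimately show r: "r > 0" by linarith
  \<comment> \<open>Any factor above 1 with square at most 2 would do; the square of 4/3 is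
    16/9.\<close>
  then have "Inf ?S < 4 / 3 * r" unfolding r_def enclosing_radius_def by simp
  from cInf_lessD[OF ne this] obtain r' c where r': "X ` G \<subseteq> cball c r'" "r' < 4 / 3 * r" by blast
  have "(X p - c) \<bullet> (X p - c) \<le> 2 * r\<^sup>2" if "p \<in> G" for p
  proof -
    have "norm (X p - c) \<le> 4 / 3 * r"
      using r' that by (auto simp: dist_norm norm_minus_commute)
    then have "(norm (X p - c))\<^sup>2 \<le> (4 / 3 * r)\<^sup>2" by (intro power_mono) auto
    also have "\<dots> \<le> 2 * r\<^sup>2" by (simp add: power_mult_distrib power_divide)
    finally show ?thesis by (simp add: power2_norm_eq_inner)
  qed
  then show "\<exists>c. \<forall>p\<in>G. (X p - c) \<bullet> (X p - c) \<le> 2 * r\<^sup>2" by blast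
qed

text \<open>The comparison function \<open>h\<close> satisfies \<open>L\<^sub>1 h = - 12 H\<close> and \<open>0 < h \<le> 4 r\<^sup>2\<close> on \<open>\<Omega>\<close>, so that
  \<open>- 3 K h \<le> 6 H < 12 H\<close> if \<open>H > 0\<close>.\<close>

lemma second_variation_sign:
  assumes R: "\<And>p. scalar_curvature \<A> X N p = 0"
    and \<Omega>: "open \<Omega>" "\<Omega> \<noteq> {}" "compact (closure \<Omega>)"
    and s: "s\<^sup>2 = 1" "\<And>p. p \<in> \<Omega> \<Longrightarrow> s * mean_curvature \<A> X N p > 0"
    and bound: "\<And>p. p \<in> \<Omega> \<Longrightarrow> - 3 * gauss_kronecker_curvature \<A> X N p / mean_curvature \<A> X N p
        \<le> 3 / (2 * (enclosing_radius (X ` \<Omega>))\<^sup>2)"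
    and g: "test_function \<A> \<Omega> g"
  shows "s * second_variation \<A> X N \<Omega> g > 0"
proof -
  define r where "r = enclosing_radius (X ` \<Omega>)"
  have r: "r > 0" unfolding r_def by (rule enclosing_ball(1)[OF \<Omega>])
  obtain c where c: "\<forall>p\<in>\<Omega>. (X p - c) \<bullet> (X p - c) \<le> 2 * r\<^sup>2"
    using enclosing_ball(2)[OF \<Omega>] unfolding r_def by blast
  let ?H = "mean_curvature \<A> X N" and ?K = "gauss_kronecker_curvature \<A> X N"
  \<comment> \<open>With \<open>4 * r\<^sup>2\<close> the function is at least
    \<open>2 * r\<^sup>2\<close> on \<open>\<Omega>\<close>, and \<open>12 / h\<close> is at least
    twice the bound \<open>m\<close> on \<open>- 3 K / H\<close>.\<close>
  define h where "h p = 4 * r\<^sup>2 - (X p - c) \<bullet> (X p - c)" for p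
  have h: "C1_map h" unfolding h_def by (rule gradient_distance(1))
  have h_pos: "h p > 0" if "p \<in> \<Omega>" for p
  proof -
    have "(X p - c) \<bullet> (X p - c) \<le> 2 * r\<^sup>2" using c that by blast
    moreover have "r\<^sup>2 > 0" using r by simp
    ultimately show ?thesis unfolding h_def by linarith
  qed
  have h_le: "h p \<le> 4 * r\<^sup>2" for p unfolding h_def by simp
  define S where "S = closure {p. g p \<noteq> 0}"
  have S: "compact S" "S \<subseteq> \<Omega>" and gC1: "C1_map g" and g_nz: "\<exists>p. g p \<noteq> 0"
    using g smooth_map_C1 unfolding test_function_def S_def by blast+
  have clS: "closed S" unfolding S_def by simp
  have g0: "g p = 0" if "p \<notin> S" for p
    using that closure_subset[of "{p. g p \<noteq> 0}"] unfolding S_def by blast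
  define \<eta> where "\<eta> = (\<lambda>p. g p * g p / h p)"
  have \<eta>: "C1_map \<eta>"
    unfolding \<eta>_def by (rule C1_map_divide[OF C1_map_mult[OF gC1 gC1] h clS]) (use g0 h_pos S(2) in force)+
  have \<eta>0: "\<eta> p = 0" if "p \<notin> S" for p using g0[OF that] by (simp add: \<eta>_def)
  define F where "F p = P1 \<A> X N p (gradient \<A> X g p) \<bullet> gradient \<A> X g p + 3 * ?K p * (g p)\<^sup>2" for p
  have F0: "F p = 0" if "p \<notin> S" for p
    using gradient_zero_outside[OF gC1 clS g0 that] g0[OF that] by (simp add: F_def P1_zero)
  have contF: "continuous_on UNIV F"
    unfolding F_def
    by (intro continuous_on_add continuous_on_mult continuous_on_power continuous_on_const gauss_kronecker_continuous
        P1_gradient_continuous[OF gC1 gradient_continuous[OF gC1]] C1_map_imp_continuous[OF gC1])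
  have intF: "integrable vol F" by (rule integrable_compact_support[OF contF S(1) F0])
  \<comment> \<open>The leftover of the estimate. Its integral is positive because the mean
    curvature has no zero on \<open>\<Omega>\<close> and \<open>g\<close> is not identically zero;
    this yields strict stability.\<close>
  define Z where "Z p = \<bar>?H p\<bar> * (g p)\<^sup>2" for p
  have contZ: "continuous_on UNIV Z"
    unfolding Z_def
    by (intro continuous_on_mult continuous_on_rabs continuous_on_power mean_curvature_continuous C1_map_imp_continuous[OF gC1])
  have Z0: "Z p = 0" if "p \<notin> S" for p using g0[OF that] by (simp add: Z_def)
  have intZ: "integrable vol Z" by (rule integrable_compact_support[OF contZ S(1) Z0])
  have Zpos: "(LINT p|vol. Z p) > 0"
  proof -
    obtain p where p: "g p \<noteq> 0" using g_nz by blast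
    then have "p \<in> \<Omega>" using g0 S(2) by blast
    then have "?H p \<noteq> 0" using s(2) by force
    then have Zp: "Z p > 0" using p by (simp add: Z_def)
    have Znn: "Z q \<ge> 0" for q by (simp add: Z_def)
    show ?thesis by (rule integral_pos[OF contZ S(1) Z0 Znn Zp])
  qed
  have flux0: "flux c \<eta> p = 0" if "p \<notin> S" for p by (rule flux_zero_outside[OF \<eta> clS \<eta>0 that])
  have int_flux: "integrable vol (flux c \<eta>)"
    by (rule integrable_compact_support[OF flux_continuous[OF \<eta>] S(1) flux0])
  have flux_int: "(LINT p|vol. flux c \<eta> p) = 0" by (rule integral_flux[OF R \<eta> S(1) \<eta>0])
  define m where "m = 3 / (2 * r\<^sup>2)"
  have m: "m > 0" using r by (simp add: m_def)
  \<comment> \<open>The pointwise core: Picone bounds the gradient term by the first part of the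
    flux of \<open>g\<^sup>2 / h\<close>, and the curvature bound controls the rest with
    \<open>m * Z p\<close> to spare. After integration the flux drops out.\<close>
  have est: "s * (- 2 * flux c \<eta> p) + m * Z p \<le> s * F p" for p
  proof (cases "p \<in> S")
    case True
    then have p: "p \<in> \<Omega>" using S(2) by blast
    have sH: "s * ?H p > 0" by (rule s(2)[OF p])
    then have absH: "\<bar>?H p\<bar> = s * ?H p"
      using s(1) by (auto simp: power2_eq_1_iff abs_if)
    have nz: "h p \<noteq> 0" using h_pos[OF p] by simp
    have pic: "s * (- 2 * (P1 \<A> X N p (gradient \<A> X \<eta> p) \<bullet> (X p - c)))
        \<le> s * (P1 \<A> X N p (gradient \<A> X g p) \<bullet> gradient \<A> X g p)"
      using picone[of p g "4 * r\<^sup>2" c s] R gC1 \<eta> nz sH unfolding h_def \<eta>_def by blast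
    have K: "- 3 * (s * ?K p) \<le> m * (s * ?H p)"
    proof -
      have "- 3 * ?K p / ?H p \<le> m" using bound[OF p] unfolding m_def r_def .
      then have "(- 3 * ?K p / ?H p) * (s * ?H p) \<le> m * (s * ?H p)"
        using sH by (intro mult_right_mono) auto
      moreover have "?H p \<noteq> 0" using sH by auto
      ultimately show ?thesis by (simp add: mult_ac)
    qed
    \<comment> \<open>Of the two copies of \<open>m\<close>, one pays for the curvature term by
      \<open>K\<close> and the other remains as the gain.\<close>
    have "(s * ?H p) * (2 * m) \<le> (s * ?H p) * (12 / h p)"
    proof (rule mult_left_mono)
      have "12 / (4 * r\<^sup>2) \<le> 12 / h p"
        using h_le[of p] h_pos[OF p] by (intro frac_le) auto
      then show "2 * m \<le> 12 / h p" by (simp add: m_def)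
    qed (use sH in simp)
    then have "m * (s * ?H p) \<le> 12 * (s * ?H p) / h p + 3 * (s * ?K p)"
      using K by (simp add: algebra_simps)
    then have "m * (s * ?H p) * (g p)\<^sup>2 \<le> (12 * (s * ?H p) / h p + 3 * (s * ?K p)) * (g p)\<^sup>2"
      by (rule mult_right_mono) simp
    then have "m * Z p \<le> s * (12 * ?H p * \<eta> p) + s * (3 * ?K p * (g p)\<^sup>2)"
      by (simp add: Z_def absH \<eta>_def power2_eq_square algebra_simps)
    then show ?thesis
      using pic unfolding F_def flux_def by (simp add: algebra_simps)
  next
    case False
    then show ?thesis using F0 Z0 flux0 by simp
  qed
  \<comment> \<open>The integrand vanishes off the support of \<open>g\<close>, which lies in
    \<open>\<Omega>\<close>, so integrating over the whole manifold changes nothing.\<close>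
  have "second_variation \<A> X N \<Omega> g = (LINT p|vol. F p)"
    unfolding second_variation_def set_lebesgue_integral_def
  proof (rule Bochner_Integration.integral_cong[OF refl])
    fix p
    have "p \<notin> \<Omega> \<Longrightarrow> F p = 0" using F0 S(2) by blast
    then show "indicator \<Omega> p *\<^sub>R (P1 \<A> X N p (gradient \<A> X g p) \<bullet> gradient \<A> X g p + 3 * ?K p * (g p)\<^sup>2) = F p"
      unfolding F_def[symmetric] by (cases "p \<in> \<Omega>") simp_all
  qed
  moreover have "0 < m * (LINT p|vol. Z p)" using m Zpos by simp
  moreover have "m * (LINT p|vol. Z p) = (LINT p|vol. s * (- 2 * flux c \<eta> p) + m * Z p)"
    using int_flux intZ flux_int by simp
  moreover have "\<dots> \<le> (LINT p|vol. s * F p)"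
    by (rule integral_mono) (use int_flux intZ intF est in auto)
  ultimately show ?thesis by simp
qed

end

theorem theorem1p5:
  fixes \<A> :: "'m::{t2_space,second_countable_topology} param set"
    and X N :: "'m \<Rightarrow> real^4"
    and \<Omega> :: "'m set"
  assumes "oriented_hypersurface \<A> X N"
    and "\<And>p. scalar_curvature \<A> X N p = 0"
    and "\<And>p. mean_curvature \<A> X N p \<noteq> 0"
    and "regular_domain \<A> \<Omega>"
    and "(SUP p\<in>\<Omega>. ereal (- 3 * gauss_kronecker_curvature \<A> X N p / mean_curvature \<A> X N p))
           \<le> ereal (3 / (2 * (enclosing_radius (X ` \<Omega>))\<^sup>2))"
  shows "stable_domain \<A> X N \<Omega>"
proof -
  interpret hypersurface \<A> X N by unfold_locales (rule assms(1))
  let ?H = "mean_curvature \<A> X N"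
  have \<Omega>: "open \<Omega>" "connected \<Omega>" "\<Omega> \<noteq> {}" "compact (closure \<Omega>)"
    using assms(4) unfolding regular_domain_def by blast+
  \<comment> \<open>The supremum is taken in the extended reals, so it dominates every value without
    a separate boundedness argument.\<close>
  have bound: "- 3 * gauss_kronecker_curvature \<A> X N p / ?H p \<le> 3 / (2 * (enclosing_radius (X ` \<Omega>))\<^sup>2)"
    if "p \<in> \<Omega>" for p
    using order_trans[OF SUP_upper[OF that] assms(5)] by simp
  have conn: "connected (?H ` \<Omega>)"
    by (rule connected_continuous_image[OF continuous_on_subset[OF mean_curvature_continuous] \<Omega>(2)]) simp
  \<comment> \<open>A continuous function without zeros has constant sign on the connected set
    \<open>\<Omega>\<close>; this selects the alternative in \<open>stable_domain\<close>.\<close>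
  have "(\<forall>p\<in>\<Omega>. ?H p > 0) \<or> (\<forall>p\<in>\<Omega>. ?H p < 0)"
  proof (rule ccontr)
    assume "\<not> ?thesis"
    then obtain p q where "p \<in> \<Omega>" "q \<in> \<Omega>" "?H p \<le> 0" "0 \<le> ?H q" by (auto simp: not_less)
    then have "0 \<in> ?H ` \<Omega>"
      using connectedD_interval[OF conn, of "?H p" "?H q" 0] by blast
    then show False using assms(3) by force
  qed
  then show ?thesis
  proof
    assume H: "\<forall>p\<in>\<Omega>. ?H p > 0"
    have "second_variation \<A> X N \<Omega> g > 0" if "test_function \<A> \<Omega> g" for g
      using second_variation_sign[OF assms(2) \<Omega>(1,3,4), of 1, OF _ _ bound that] H by simp
    then show ?thesis unfolding stable_domain_def using H by blast
  next
    assume H: "\<forall>p\<in>\<Omega>. ?H p < 0"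
    have "second_variation \<A> X N \<Omega> g < 0" if "test_function \<A> \<Omega> g" for g
      \<comment> \<open>For negative mean curvature the sign \<open>s\<close> is -1, which reverses
        the inequality for the second variation.\<close>
      using second_variation_sign[OF assms(2) \<Omega>(1,3,4), of "- 1", OF _ _ bound that] H by simp
    then show ?thesis unfolding stable_domain_def using H by blast
  qed
qed

end
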